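(* In the two-dimensional Finsleroid-regular space with metric function $K(x,y)$, where the Finsleroid charge $g(x)\in(-2,2)$, the one-form $b_i(x)$ with norm $c(x)\in(0,1)$, and the Riemannian metric $a_{ij}(x)$ are allowed an arbitrary smooth dependence on $x$, the angle function $\theta=\theta(x,y)$ is of class $C^\infty$ with respect to $y$ over all of $T_xM\setminus\{0\}$, and the partial derivatives $\partial K/\partial x^n$ and $\partial\theta/\partial x^n$ are of class $C^\infty$ with respect to $y$ globally on $T_xM\setminus\{0\}$. Therefore all the ingredients of the coefficients $$N^k_n=-l^k\,\frac{\partial K}{\partial x^n}-K\,m^k\left(\frac{\partial\theta}{\partial x^n}-k_n\right),$$ with $k_n=k_n(x)$ a covariant vector field, have this regularity, so that the space possesses the angle-preserving connection of $C^\infty$-regular status globally regarding the $y$-dependence.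
   Context: $M$ is a 2-dimensional $C^\infty$ manifold (local coordinates $x^i$, tangent vectors $y=(y^i)\in T_xM$) with a Riemannian metric tensor $a_{ij}(x)$ and two covector fields $\tilde b_i(x),n_i(x)$ orthonormal with respect to $a_{ij}$. Indices of $\tilde b_i,n_i,b_i$ are raised with the inverse $a^{ij}$. $c(x)$ with $0<c<1$ and $g(x)\in(-2,2)$ are scalars. Put $b_i=c\,\tilde b_i$, $b=b_iy^i$, $n=n_iy^i$, $S=\sqrt{a_{ij}y^iy^j}$, $q=\sqrt{S^2-b^2}=\sqrt{\frac{1-c^2}{c^2}b^2+n^2}$ (nonvanishing for $y\ne0$), $h=\sqrt{1-g^2/4}$, $G=g/h$, $B=b^2+gbq+q^2$, $L=q+\frac g2 b$, $\nu=q+(1-c^2)gb>0$. The Finsleroid-regular metric function is $K=\sqrt B\,e^{-\frac12Gf}$, where $f=-\arctan\frac G2+\arctan\frac{L}{hb}$ if $b\ge0$ and $f=\pi-\arctan\frac G2+\arctan\frac{L}{hb}$ if $b\le0$ (at $b=0$ in the sense of the limiting value). Put $l^k=y^k/K$, $g_{ij}=\frac12\partial^2K^2/\partial y^i\partial y^j$, $g^{ij}$ its inverse, $y_k=g_{kj}y^j$, $T=\frac1c\sqrt{\frac{\nu}{q}}\,\frac{K^2}{B}$, $m_i=\frac1K T\,(bn_i-nb_i)$, $m^i=g^{ij}m_j$. The angle function $\theta=\theta(x,y)$ is a single function on $T_xM\setminus\{0\}$, positively homogeneous of degree zero in $y$, defined by $K\,\partial\theta/\partial y^i=m_i$ and $\theta(x,b(x))=0$,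 where $b(x)=(b^i(x))$. The space $T_xM\setminus\{0\}$ is covered by the atlas of the four charts $\{b>0\}$, $\{n>0\}$, $\{n<0\}$, $\{b<0\}$. When a point moves along the indicatrix $\{K=1\}$ from the north pole (in the direction of $b^i$, where $\theta=0$) in the right direction, $\theta$ increases monotonically, $0\le\theta<\theta^{\max}(x)$, where $\theta^{\max}=2(\theta^{I}+\theta^{II})$ is the total length of the indicatrix, with $$\theta^{I}=\frac1c\int_0^\infty\frac{\sqrt{1+(1-c^2)g/w}}{1+gw+w^2}\,d\tilde w,\qquad \theta^{II}=\frac1c\int_0^\infty\frac{\sqrt{1-(1-c^2)g/w}}{1-gw+w^2}\,d\tilde w,\qquad w=\sqrt{\tilde w^2+\tfrac{1-c^2}{c^2}}.$$ Angle-preserving connection: with $d_n=\partial/\partial x^n+N^k_n\,\partial/\partial y^k$, the coefficients $N^k_n$ above satisfy $d_nK=0$, $d_n\theta=k_n$ and $y_k\,\partial^2N^k_n/\partial y^m\partial y^i=0$; hence $d_n(\theta(x,y_2)-\theta(x,y_1))=0$ for pairs of tangent vectors $y_1,y_2\in T_xM$ (with $d_n$ acting on both arguments). The connection consists of $N^k_n$ and $D^k{}_{nm}=-\partial N^k_n/\partial y^m$.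
   Formalization: No single-valued smooth θ exists on T_xM∖{0} (it gains θ^max per turn), so regularity of θ, ∂θ/∂x^n and N^k_n is claimed for every continuous determination of θ modulo θ^max; single-valued global ∂θ/∂x^n and N^k_n are claimed where ∂θ^max/∂x^n=0 for all n. *)

theory Defs
  imports "HOL-Analysis.Analysis"
begin

section \<open>Smoothness and partial derivatives\<close>

text \<open>Meant for open \<open>S\<close>. In finite dimension, having all iterated directional derivatives
  differentiable resp. continuous is the usual notion of class \<open>C\<close>-\<open>k\<close>.\<close>

primrec Ck_on :: "nat \<Rightarrow> 'a::real_normed_vector set \<Rightarrow> ('a \<Rightarrow> 'b::real_normed_vector) \<Rightarrow> bool" where
  "Ck_on 0 S f \<longleftrightarrow> continuous_on S f"
| "Ck_on (Suc k) S f \<longleftrightarrow>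
     (\<forall>x\<in>S. f differentiable (at x)) \<and> (\<forall>v. Ck_on k S (\<lambda>x. frechet_derivative f (at x) v))"

definition smooth_on :: "'a::real_normed_vector set \<Rightarrow> ('a \<Rightarrow> 'b::real_normed_vector) \<Rightarrow> bool" where
  "smooth_on S f \<longleftrightarrow> (\<forall>k. Ck_on k S f)"

definition pd :: "2 \<Rightarrow> (real^2 \<Rightarrow> real) \<Rightarrow> real^2 \<Rightarrow> real" where
  "pd i f x = frechet_derivative f (at x) (axis i 1)"

section \<open>Surfaces and tensor fields in local components\<close>

type_synonym 'm chart = "'m set \<times> ('m \<Rightarrow> real^2)"

definition chart_image :: "'m chart \<Rightarrow> (real^2) set" where
  "chart_image \<kappa> = snd \<kappa> ` fst \<kappa>"

definition transition :: "'m chart \<Rightarrow> 'm chart \<Rightarrow> real^2 \<Rightarrow> real^2" where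
  "transition \<kappa> \<mu> = snd \<mu> \<circ> inv_into (fst \<kappa>) (snd \<kappa>)"

definition overlap :: "'m chart \<Rightarrow> 'm chart \<Rightarrow> (real^2) set" where
  "overlap \<kappa> \<mu> = snd \<kappa> ` (fst \<kappa> \<inter> fst \<mu>)"

definition smooth_surface :: "'m topology \<Rightarrow> 'm chart set \<Rightarrow> bool" where
  "smooth_surface M A \<longleftrightarrow>
     Hausdorff_space M \<and> second_countable M \<and> topspace M = (\<Union>\<kappa>\<in>A. fst \<kappa>) \<and>
     (\<forall>\<kappa>\<in>A. openin M (fst \<kappa>) \<and> open (chart_image \<kappa>) \<and>
        homeomorphic_map (subtopology M (fst \<kappa>)) (top_of_set (chart_image \<kappa>)) (snd \<kappa>)) \<and>
     (\<forall>\<kappa>\<in>A. \<forall>\<mu>\<in>A. smooth_on (overlap \<kappa> \<mu>) (transition \<kappa> \<mu>))"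

text \<open>Entry \<open>$ i $ j\<close> is the derivative of the new coordinate \<open>i\<close> by the old coordinate \<open>j\<close>.\<close>

definition jacobian :: "'m chart \<Rightarrow> 'm chart \<Rightarrow> real^2 \<Rightarrow> real^2^2" where
  "jacobian \<kappa> \<mu> x = matrix (frechet_derivative (transition \<kappa> \<mu>) (at x))"

text \<open>Fields are families of local components, indexed by the charts and expressed in the
  coordinates of the chart, that obey the transformation law of their type.\<close>

definition scalar_field :: "'m chart set \<Rightarrow> ('m chart \<Rightarrow> real^2 \<Rightarrow> real) \<Rightarrow> bool" where
  "scalar_field A s \<longleftrightarrow>
     (\<forall>\<kappa>\<in>A. \<forall>\<mu>\<in>A. \<forall>x\<in>overlap \<kappa> \<mu>. s \<kappa> x = s \<mu> (transition \<kappa> \<mu> x))"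

definition covector_field :: "'m chart set \<Rightarrow> ('m chart \<Rightarrow> real^2 \<Rightarrow> real^2) \<Rightarrow> bool" where
  "covector_field A w \<longleftrightarrow>
     (\<forall>\<kappa>\<in>A. \<forall>\<mu>\<in>A. \<forall>x\<in>overlap \<kappa> \<mu>.
        w \<kappa> x = transpose (jacobian \<kappa> \<mu> x) *v w \<mu> (transition \<kappa> \<mu> x))"

definition bilinear_form_field :: "'m chart set \<Rightarrow> ('m chart \<Rightarrow> real^2 \<Rightarrow> real^2^2) \<Rightarrow> bool" where
  "bilinear_form_field A a \<longleftrightarrow>
     (\<forall>\<kappa>\<in>A. \<forall>\<mu>\<in>A. \<forall>x\<in>overlap \<kappa> \<mu>.
        a \<kappa> x = transpose (jacobian \<kappa> \<mu> x) ** a \<mu> (transition \<kappa> \<mu> x) ** jacobian \<kappa> \<mu> x)"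

text \<open>Functions on the slit tangent bundle.\<close>

definition slit_tangent_function ::
    "'m chart set \<Rightarrow> ('m chart \<Rightarrow> real^2 \<Rightarrow> real^2 \<Rightarrow> real) \<Rightarrow> bool" where
  "slit_tangent_function A s \<longleftrightarrow>
     (\<forall>\<kappa>\<in>A. \<forall>\<mu>\<in>A. \<forall>x\<in>overlap \<kappa> \<mu>. \<forall>y. y \<noteq> 0 \<longrightarrow>
        s \<kappa> x y = s \<mu> (transition \<kappa> \<mu> x) (jacobian \<kappa> \<mu> x *v y))"

section \<open>The Finsleroid-regular metric function\<close>

text \<open>Components, in one chart, of the Riemannian metric \<open>a\<close>, the covectors
  \<open>b~\<close> (\<open>bt_cov\<close>) and \<open>n\<close>, and the scalars \<open>c\<close> and \<open>g\<close>.\<close>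

record fields =
  metric :: "real^2 \<Rightarrow> real^2^2"
  bt_cov :: "real^2 \<Rightarrow> real^2"
  n_cov :: "real^2 \<Rightarrow> real^2"
  c_of :: "real^2 \<Rightarrow> real"
  g_of :: "real^2 \<Rightarrow> real"

definition finsleroid_space :: "'m chart set \<Rightarrow> ('m chart \<Rightarrow> fields) \<Rightarrow> bool" where
  "finsleroid_space A F \<longleftrightarrow>
     bilinear_form_field A (\<lambda>\<kappa>. metric (F \<kappa>)) \<and>
     covector_field A (\<lambda>\<kappa>. bt_cov (F \<kappa>)) \<and> covector_field A (\<lambda>\<kappa>. n_cov (F \<kappa>)) \<and>
     scalar_field A (\<lambda>\<kappa>. c_of (F \<kappa>)) \<and> scalar_field A (\<lambda>\<kappa>. g_of (F \<kappa>)) \<and>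
     (\<forall>\<kappa>\<in>A.
        smooth_on (chart_image \<kappa>) (metric (F \<kappa>)) \<and>
        smooth_on (chart_image \<kappa>) (bt_cov (F \<kappa>)) \<and> smooth_on (chart_image \<kappa>) (n_cov (F \<kappa>)) \<and>
        smooth_on (chart_image \<kappa>) (c_of (F \<kappa>)) \<and> smooth_on (chart_image \<kappa>) (g_of (F \<kappa>)) \<and>
        (\<forall>x\<in>chart_image \<kappa>.
           transpose (metric (F \<kappa>) x) = metric (F \<kappa>) x \<and>
           (\<forall>v. v \<noteq> 0 \<longrightarrow> 0 < v \<bullet> (metric (F \<kappa>) x *v v)) \<and>
           bt_cov (F \<kappa>) x \<bullet> (matrix_inv (metric (F \<kappa>) x) *v bt_cov (F \<kappa>) x) = 1 \<and>
           n_cov (F \<kappa>) x \<bullet> (matrix_inv (metric (F \<kappa>) x) *v n_cov (F \<kappa>) x) = 1 \<and>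
           bt_cov (F \<kappa>) x \<bullet> (matrix_inv (metric (F \<kappa>) x) *v n_cov (F \<kappa>) x) = 0 \<and>
           0 < c_of (F \<kappa>) x \<and> c_of (F \<kappa>) x < 1 \<and> - 2 < g_of (F \<kappa>) x \<and> g_of (F \<kappa>) x < 2))"

definition b_cov :: "fields \<Rightarrow> real^2 \<Rightarrow> real^2" where
  "b_cov F x = c_of F x *\<^sub>R bt_cov F x"

definition b_vec :: "fields \<Rightarrow> real^2 \<Rightarrow> real^2" where
  "b_vec F x = matrix_inv (metric F x) *v b_cov F x"

definition b_val :: "fields \<Rightarrow> real^2 \<Rightarrow> real^2 \<Rightarrow> real" where
  "b_val F x y = b_cov F x \<bullet> y"

definition n_val :: "fields \<Rightarrow> real^2 \<Rightarrow> real^2 \<Rightarrow> real" where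
  "n_val F x y = n_cov F x \<bullet> y"

definition S_val :: "fields \<Rightarrow> real^2 \<Rightarrow> real^2 \<Rightarrow> real" where
  "S_val F x y = sqrt (y \<bullet> (metric F x *v y))"

definition q_val :: "fields \<Rightarrow> real^2 \<Rightarrow> real^2 \<Rightarrow> real" where
  "q_val F x y = sqrt ((S_val F x y)\<^sup>2 - (b_val F x y)\<^sup>2)"

definition h_of :: "fields \<Rightarrow> real^2 \<Rightarrow> real" where
  "h_of F x = sqrt (1 - (g_of F x)\<^sup>2 / 4)"

definition G_of :: "fields \<Rightarrow> real^2 \<Rightarrow> real" where
  "G_of F x = g_of F x / h_of F x"

definition B_val :: "fields \<Rightarrow> real^2 \<Rightarrow> real^2 \<Rightarrow> real" where
  "B_val F x y = (b_val F x y)\<^sup>2 + g_of F x * b_val F x y * q_val F x y + (q_val F x y)\<^sup>2"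

definition L_val :: "fields \<Rightarrow> real^2 \<Rightarrow> real^2 \<Rightarrow> real" where
  "L_val F x y = q_val F x y + g_of F x / 2 * b_val F x y"

definition nu_val :: "fields \<Rightarrow> real^2 \<Rightarrow> real^2 \<Rightarrow> real" where
  "nu_val F x y = q_val F x y + (1 - (c_of F x)\<^sup>2) * g_of F x * b_val F x y"

text \<open>For \<open>b = 0\<close> and \<open>y \<noteq> 0\<close> one has \<open>L > 0\<close>, so the limiting value of the arctan term is
  \<open>pi/2\<close> from the right and \<open>- pi/2\<close> from the left.\<close>

definition f_val :: "fields \<Rightarrow> real^2 \<Rightarrow> real^2 \<Rightarrow> real" where
  "f_val F x y =
     (if b_val F x y > 0 then - arctan (G_of F x / 2) + arctan (L_val F x y / (h_of F x * b_val F x y))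
      else if b_val F x y < 0
        then pi - arctan (G_of F x / 2) + arctan (L_val F x y / (h_of F x * b_val F x y))
      else pi / 2 - arctan (G_of F x / 2))"

definition K_val :: "fields \<Rightarrow> real^2 \<Rightarrow> real^2 \<Rightarrow> real" where
  "K_val F x y = sqrt (B_val F x y) * exp (- (1/2) * G_of F x * f_val F x y)"

definition l_vec :: "fields \<Rightarrow> real^2 \<Rightarrow> real^2 \<Rightarrow> real^2" where
  "l_vec F x y = y /\<^sub>R K_val F x y"

definition g_low :: "fields \<Rightarrow> real^2 \<Rightarrow> real^2 \<Rightarrow> real^2^2" where
  "g_low F x y = (\<chi> i j. 1/2 * pd i (pd j (\<lambda>z. (K_val F x z)\<^sup>2)) y)"

definition y_low :: "fields \<Rightarrow> real^2 \<Rightarrow> real^2 \<Rightarrow> real^2" where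
  "y_low F x y = g_low F x y *v y"

definition T_val :: "fields \<Rightarrow> real^2 \<Rightarrow> real^2 \<Rightarrow> real" where
  "T_val F x y =
     1 / c_of F x * sqrt (nu_val F x y / q_val F x y) * ((K_val F x y)\<^sup>2 / B_val F x y)"

definition m_cov :: "fields \<Rightarrow> real^2 \<Rightarrow> real^2 \<Rightarrow> real^2" where
  "m_cov F x y =
     (1 / K_val F x y * T_val F x y) *\<^sub>R (b_val F x y *\<^sub>R n_cov F x - n_val F x y *\<^sub>R b_cov F x)"

definition m_vec :: "fields \<Rightarrow> real^2 \<Rightarrow> real^2 \<Rightarrow> real^2" where
  "m_vec F x y = matrix_inv (g_low F x y) *v m_cov F x y"

section \<open>The angle function\<close>

definition w_of :: "fields \<Rightarrow> real^2 \<Rightarrow> real \<Rightarrow> real" where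
  "w_of F x u = sqrt (u\<^sup>2 + (1 - (c_of F x)\<^sup>2) / (c_of F x)\<^sup>2)"

definition theta_I :: "fields \<Rightarrow> real^2 \<Rightarrow> real" where
  "theta_I F x = 1 / c_of F x * integral {0..} (\<lambda>u.
     sqrt (1 + (1 - (c_of F x)\<^sup>2) * g_of F x / w_of F x u) /
       (1 + g_of F x * w_of F x u + (w_of F x u)\<^sup>2))"

definition theta_II :: "fields \<Rightarrow> real^2 \<Rightarrow> real" where
  "theta_II F x = 1 / c_of F x * integral {0..} (\<lambda>u.
     sqrt (1 - (1 - (c_of F x)\<^sup>2) * g_of F x / w_of F x u) /
       (1 - g_of F x * w_of F x u + (w_of F x u)\<^sup>2))"

definition theta_max :: "fields \<Rightarrow> real^2 \<Rightarrow> real" where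
  "theta_max F x = 2 * (theta_I F x + theta_II F x)"

text \<open>The single-valued angle function with \<open>0 \<le> \<theta> < \<theta>max\<close>. Integrating \<open>m / K\<close> once around the
  indicatrix gives \<open>\<theta>max > 0\<close>, so the equation \<open>K \<partial>\<theta>/\<partial>y = m\<close> cannot hold for a real-valued
  function on all of the slit tangent plane. It is imposed on the charts \<open>n > 0\<close>, \<open>n < 0\<close>,
  \<open>b < 0\<close>, i.e. off the ray spanned by \<open>b\<close>, where \<open>\<theta>\<close> jumps by \<open>\<theta>max\<close>.\<close>

definition angle_function ::
    "'m chart set \<Rightarrow> ('m chart \<Rightarrow> fields) \<Rightarrow> ('m chart \<Rightarrow> real^2 \<Rightarrow> real^2 \<Rightarrow> real) \<Rightarrow> bool" where
  "angle_function A F \<theta> \<longleftrightarrow>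
     slit_tangent_function A \<theta> \<and>
     (\<forall>\<kappa>\<in>A. \<forall>x\<in>chart_image \<kappa>.
        (\<forall>y r. y \<noteq> 0 \<and> 0 < r \<longrightarrow> \<theta> \<kappa> x (r *\<^sub>R y) = \<theta> \<kappa> x y) \<and>
        \<theta> \<kappa> x (b_vec (F \<kappa>) x) = 0 \<and>
        (\<forall>y. y \<noteq> 0 \<longrightarrow> 0 \<le> \<theta> \<kappa> x y \<and> \<theta> \<kappa> x y < theta_max (F \<kappa>) x) \<and>
        (\<forall>y. n_val (F \<kappa>) x y > 0 \<or> n_val (F \<kappa>) x y < 0 \<or> b_val (F \<kappa>) x y < 0 \<longrightarrow>
           (\<theta> \<kappa> x has_derivative (\<lambda>v. (m_cov (F \<kappa>) x y \<bullet> v) / K_val (F \<kappa>) x y)) (at y)))"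

text \<open>Continuous determinations of the angle over an open part \<open>W\<close> of the slit tangent bundle
  (in one coordinate chart of the surface with coordinate domain \<open>X\<close>): as for the Euclidean polar
  angle, the angle is defined up to integer multiples of \<open>\<theta>max\<close>.\<close>

definition angle_branch ::
    "fields \<Rightarrow> (real^2) set \<Rightarrow> (real^2 \<Rightarrow> real^2 \<Rightarrow> real) \<Rightarrow>
     ((real^2) \<times> (real^2)) set \<Rightarrow> (real^2 \<Rightarrow> real^2 \<Rightarrow> real) \<Rightarrow> bool" where
  "angle_branch F X \<theta> W \<phi> \<longleftrightarrow>
     open W \<and> W \<subseteq> X \<times> (- {0}) \<and> continuous_on W (\<lambda>(x, y). \<phi> x y) \<and>
     (\<forall>(x, y)\<in>W. \<exists>j::int. \<phi> x y = \<theta> x y + of_int j * theta_max F x)"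

text \<open>The determination that vanishes at \<open>b(x)\<close> on the chart \<open>b > 0\<close> around the north pole.\<close>

definition north_angle :: "fields \<Rightarrow> (real^2 \<Rightarrow> real^2 \<Rightarrow> real) \<Rightarrow> real^2 \<Rightarrow> real^2 \<Rightarrow> real" where
  "north_angle F \<theta> x y = (if n_val F x y \<ge> 0 then \<theta> x y else \<theta> x y - theta_max F x)"

section \<open>The angle-preserving connection\<close>

text \<open>\<open>dx n s\<close> is the partial derivative by \<open>x\<close>-coordinate \<open>n\<close> with \<open>y\<close> kept fixed.\<close>

definition dx :: "2 \<Rightarrow> (real^2 \<Rightarrow> real^2 \<Rightarrow> real) \<Rightarrow> real^2 \<Rightarrow> real^2 \<Rightarrow> real" where
  "dx n s x y = pd n (\<lambda>z. s z y) x"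

text \<open>\<open>N x y i n\<close> has upper index \<open>i\<close> and lower index \<open>n\<close>; the angle enters through a
  determination \<open>\<phi>\<close>.\<close>

definition N_coeff ::
    "fields \<Rightarrow> (real^2 \<Rightarrow> real^2) \<Rightarrow> (real^2 \<Rightarrow> real^2 \<Rightarrow> real) \<Rightarrow>
     real^2 \<Rightarrow> real^2 \<Rightarrow> 2 \<Rightarrow> 2 \<Rightarrow> real" where
  "N_coeff F k \<phi> x y i n =
     - l_vec F x y $ i * dx n (K_val F) x y
     - K_val F x y * m_vec F x y $ i * (dx n \<phi> x y - k x $ n)"

definition D_coeff ::
    "(real^2 \<Rightarrow> real^2 \<Rightarrow> 2 \<Rightarrow> 2 \<Rightarrow> real) \<Rightarrow> real^2 \<Rightarrow> real^2 \<Rightarrow> 2 \<Rightarrow> 2 \<Rightarrow> 2 \<Rightarrow> real" where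
  "D_coeff N x y i n m = - pd m (\<lambda>z. N x z i n) y"

definition d_op ::
    "(real^2 \<Rightarrow> real^2 \<Rightarrow> 2 \<Rightarrow> 2 \<Rightarrow> real) \<Rightarrow> 2 \<Rightarrow> (real^2 \<Rightarrow> real^2 \<Rightarrow> real) \<Rightarrow>
     real^2 \<Rightarrow> real^2 \<Rightarrow> real" where
  "d_op N n s x y = dx n s x y + (\<Sum>i\<in>UNIV. N x y i n * pd i (s x) y)"

text \<open>\<open>d_op\<close> acting on both vector arguments of a two-vector function.\<close>

definition d_op2 ::
    "(real^2 \<Rightarrow> real^2 \<Rightarrow> 2 \<Rightarrow> 2 \<Rightarrow> real) \<Rightarrow> 2 \<Rightarrow> (real^2 \<Rightarrow> real^2 \<Rightarrow> real^2 \<Rightarrow> real) \<Rightarrow>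
     real^2 \<Rightarrow> real^2 \<Rightarrow> real^2 \<Rightarrow> real" where
  "d_op2 N n s x y1 y2 =
     pd n (\<lambda>z. s z y1 y2) x
     + (\<Sum>i\<in>UNIV. N x y1 i n * pd i (\<lambda>z. s x z y2) y1)
     + (\<Sum>i\<in>UNIV. N x y2 i n * pd i (\<lambda>z. s x y1 z) y2)"

text \<open>\<open>V\<close> is the part of the slit tangent plane at \<open>x\<close> over which \<open>\<phi>\<close> and \<open>N\<close> are considered.\<close>

definition angle_preserving_at ::
    "fields \<Rightarrow> (real^2 \<Rightarrow> real^2) \<Rightarrow> (real^2 \<Rightarrow> real^2 \<Rightarrow> real) \<Rightarrow>
     (real^2 \<Rightarrow> real^2 \<Rightarrow> 2 \<Rightarrow> 2 \<Rightarrow> real) \<Rightarrow> real^2 \<Rightarrow> (real^2) set \<Rightarrow> bool" where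
  "angle_preserving_at F k \<phi> N x V \<longleftrightarrow>
     (\<forall>n. \<forall>y\<in>V.
        d_op N n (K_val F) x y = 0 \<and>
        d_op N n \<phi> x y = k x $ n \<and>
        (\<forall>m i. (\<Sum>j\<in>UNIV. y_low F x y $ j * pd m (pd i (\<lambda>z. N x z j n)) y) = 0)) \<and>
     (\<forall>n. \<forall>y1\<in>V. \<forall>y2\<in>V. d_op2 N n (\<lambda>z u v. \<phi> z v - \<phi> z u) x y1 y2 = 0)"

definition smooth_connection_on ::
    "(real^2 \<Rightarrow> real^2 \<Rightarrow> 2 \<Rightarrow> 2 \<Rightarrow> real) \<Rightarrow> real^2 \<Rightarrow> (real^2) set \<Rightarrow> bool" where
  "smooth_connection_on N x V \<longleftrightarrow>
     (\<forall>i n. smooth_on V (\<lambda>y. N x y i n)) \<and> (\<forall>i n m. smooth_on V (\<lambda>y. D_coeff N x y i n m))"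

end

theory Submission
  imports Defs
begin

text \<open>On a fibre everything depends on the two linear coordinates \<open>u = b~(y)\<close> and \<open>v = n(y)\<close>, with
  \<open>b = c u\<close> and \<open>q\<^sup>2 = (1 - c\<^sup>2) u\<^sup>2 + v\<^sup>2\<close>. Since \<open>c < 1\<close> this form is positive definite, so \<open>q\<close> is smooth and
  positive off the zero section; \<open>B\<close> and \<open>\<nu>\<close> are positive there as well. The two arctan formulas for
  \<open>f\<close> are the single smooth function \<open>pi/2 - arctan ((b + g q/2) / (h q))\<close> (\<open>arctan_cotangent\<close>,
  \<open>K_eq\<close>), hence \<open>K\<close> is smooth in \<open>x\<close> and \<open>y\<close> jointly.

  Differentiation gives \<open>dK = (K/B) ((u + g c q) du + v dv)\<close>, and then the Hessian of \<open>K\<close> in \<open>y\<close> is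
  \<open>K \<omega> \<otimes> \<omega>\<close> with \<open>\<omega> = (sqrt (\<nu>/q) / B) (u dv - v du)\<close> (\<open>K_uv_has_derivative\<close>, \<open>pd_pd_K\<close>). The factor \<open>T\<close>
  is the one for which \<open>m = K \<omega>\<close>, so \<open>g_ij\<close> is \<open>dK \<otimes> dK + m \<otimes> m\<close>, which is invertible, and \<open>m^i\<close> is the
  vector dual to \<open>m\<close> in the frame \<open>dK, m\<close>.

  The form \<open>\<omega>\<close> kills the radial direction and in the polar angle \<open>t\<close> of \<open>(u, v)\<close> it is \<open>J(t) dt\<close> with a positive
  \<open>2 pi\<close>-periodic density. The equation \<open>K d\<theta> = m\<close> therefore says that \<open>\<theta>\<close> is, up to a constant, the
  primitive of \<open>J\<close> evaluated at the polar angle; the integral of \<open>J\<close> over a period is \<open>\<theta>max\<close> (substitute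
  \<open>w~ = tan t / c\<close>, \<open>quarter_integral\<close>), and \<open>0 \<le> \<theta> < \<theta>max\<close> leaves no freedom for the constant
  (\<open>angle_unique\<close>). The primitive is an integral over a fixed interval depending smoothly on parameters,
  so every smooth choice of the polar angle, with the primitive applied to it, is smooth in \<open>x\<close> and \<open>y\<close> jointly. Two continuous
  determinations differ by a continuous integer multiple of \<open>\<theta>max\<close>, that is, by a locally constant
  integer (\<open>branches_locally\<close>). So all determinations are smooth; their \<open>x\<close>-derivatives differ by
  integer multiples of the derivative of \<open>\<theta>max\<close> and agree where it vanishes.

  For the connection, duality of the frame gives \<open>K_j N^j_n = - \<partial>_n K\<close> and \<open>\<theta>_j N^j_n = - (\<partial>_n \<theta> - k_n)\<close>,
  which are the first two preservation laws. Differentiating them in \<open>y\<close>, and using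
  \<open>K_ij = K \<theta>_i \<theta>_j\<close> together with its \<open>x\<close>-derivative, yields the third one
  (\<open>transport_second_derivative\<close>, \<open>pd_pd_dx_K\<close>).\<close>

section \<open>Closure properties of smooth maps\<close>

lemma frechet_derivative_cong_open:
  assumes "open S" "x \<in> S" "\<And>z. z \<in> S \<Longrightarrow> f z = g z"
  shows "frechet_derivative f (at x) = frechet_derivative g (at x)"
proof -
  have "(f has_derivative D) (at x) \<longleftrightarrow> (g has_derivative D) (at x)" for D
    using assms has_derivative_transform_within_open[of _ D x UNIV S]
    by metis
  then show ?thesis
    unfolding frechet_derivative_def by presburger
qed

lemma differentiable_cong_open:
  assumes "open S" "x \<in> S" "\<And>z. z \<in> S \<Longrightarrow> f z = g z" "f differentiable (at x)"
  shows "g differentiable (at x)"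
  using assms has_derivative_transform_within_open[of f _ x UNIV S g]
  unfolding differentiable_def by metis

lemma Ck_on_cong:
  assumes "open S"
  shows "(\<And>x. x \<in> S \<Longrightarrow> f x = g x) \<Longrightarrow> Ck_on k S f \<Longrightarrow> Ck_on k S g"
proof (induction k arbitrary: f g)
  case 0
  then show ?case using continuous_on_cong[of S S f g] by auto
next
  case (Suc k)
  have "g differentiable (at x)" if "x \<in> S" for x
    using differentiable_cong_open[OF assms that, of f g] Suc.prems that by simp
  moreover have "Ck_on k S (\<lambda>x. frechet_derivative g (at x) v)" for v
    using Suc.IH[of "\<lambda>x. frechet_derivative f (at x) v" "\<lambda>x. frechet_derivative g (at x) v"] Suc.prems
      frechet_derivative_cong_open[OF assms, of _ f g] by simp
  ultimately show ?case by simp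
qed

lemma Ck_on_subset: "Ck_on k T f \<Longrightarrow> S \<subseteq> T \<Longrightarrow> Ck_on k S f"
proof (induction k arbitrary: f)
  case 0
  then show ?case using continuous_on_subset[of T f S] by simp
next
  case (Suc k)
  then show ?case by (simp add: subset_iff)
qed

lemma Ck_on_local:
  "(\<And>x. x \<in> S \<Longrightarrow> \<exists>U. open U \<and> x \<in> U \<and> Ck_on k U f) \<Longrightarrow> Ck_on k S f"
proof (induction k arbitrary: f)
  case 0
  have "continuous (at x within S) f" if x: "x \<in> S" for x
  proof -
    obtain U where "open U" "x \<in> U" "continuous_on U f" using 0[OF x] by auto
    then have "isCont f x" by (simp add: continuous_on_eq_continuous_at)
    then show ?thesis by (rule continuous_at_imp_continuous_at_within)
  qed
  then show ?case by (simp add: continuous_on_eq_continuous_within)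
next
  case (Suc k)
  have "f differentiable (at x)" if "x \<in> S" for x
    using Suc.prems[OF that] by auto
  moreover have "Ck_on k S (\<lambda>x. frechet_derivative f (at x) v)" for v
    by (rule Suc.IH) (use Suc.prems in force)
  ultimately show ?case by simp
qed

lemma Ck_on_Suc_imp: "Ck_on (Suc k) S f \<Longrightarrow> Ck_on k S f"
proof (induction k arbitrary: f)
  case 0
  then show ?case
    by (auto intro!: continuous_at_imp_continuous_on differentiable_imp_continuous_within)
qed auto

lemma frechet_derivative_eqI:
  "(f has_derivative D) (at x) \<Longrightarrow> frechet_derivative f (at x) v = D v"
  using frechet_derivative_at by metis

lemma has_frechet_derivative:
  "f differentiable (at x) \<Longrightarrow> (f has_derivative frechet_derivative f (at x)) (at x)"
  by (simp add: frechet_derivative_works)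

text \<open>The inductive step of the closure properties: a derivative given by any formula may take the place
  of the choice term \<open>frechet_derivative\<close>.\<close>

lemma Ck_on_SucI:
  assumes "open S"
    and "\<And>x. x \<in> S \<Longrightarrow> (f has_derivative D x) (at x)"
    and "\<And>v. Ck_on k S (\<lambda>x. D x v)"
  shows "Ck_on (Suc k) S f"
proof -
  have "Ck_on k S (\<lambda>x. frechet_derivative f (at x) v)" for v
    by (rule Ck_on_cong[OF assms(1) _ assms(3)[of v]]) (simp add: frechet_derivative_eqI[OF assms(2)])
  then show ?thesis using assms(2) by (auto simp: differentiable_def)
qed

lemma Ck_on_const: "open S \<Longrightarrow> Ck_on k S (\<lambda>x. c)"
proof (induction k arbitrary: c)
  case (Suc k)
  show ?case by (rule Ck_on_SucI[OF Suc.prems, where D="\<lambda>x v. 0"]) (auto intro!: Suc)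
qed simp

lemma Ck_on_linear:
  assumes "bounded_linear T" "open S"
  shows "Ck_on k S f \<Longrightarrow> Ck_on k S (\<lambda>x. T (f x))"
proof (induction k arbitrary: f)
  case 0
  then show ?case using bounded_linear.continuous_on[OF assms(1)] by simp
next
  case (Suc k)
  show ?case
    by (rule Ck_on_SucI[OF assms(2), where D="\<lambda>x v. T (frechet_derivative f (at x) v)"])
      (use Suc in \<open>auto intro!: bounded_linear.has_derivative[OF assms(1)] has_frechet_derivative\<close>)
qed

lemma Ck_on_add:
  assumes "open S"
  shows "Ck_on k S f \<Longrightarrow> Ck_on k S g \<Longrightarrow> Ck_on k S (\<lambda>x. f x + g x)"
proof (induction k arbitrary: f g)
  case (Suc k)
  show ?case
    by (rule Ck_on_SucI[OF assms, where D="\<lambda>x v. frechet_derivative f (at x) v + frechet_derivative g (at x) v"])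
      (use Suc in \<open>auto intro!: has_derivative_add has_frechet_derivative\<close>)
qed (auto intro: continuous_intros)

lemma Ck_on_bilinear:
  assumes "bounded_bilinear bl" "open S"
  shows "Ck_on k S f \<Longrightarrow> Ck_on k S g \<Longrightarrow> Ck_on k S (\<lambda>x. bl (f x) (g x))"
proof (induction k arbitrary: f g)
  case 0
  then show ?case using bounded_bilinear.continuous_on[OF assms(1)] by simp
next
  case (Suc k)
  show ?case
  proof (rule Ck_on_SucI[OF assms(2)])
    show "((\<lambda>x. bl (f x) (g x)) has_derivative
        (\<lambda>v. bl (f x) (frechet_derivative g (at x) v) + bl (frechet_derivative f (at x) v) (g x))) (at x)"
      if "x \<in> S" for x
      using Suc.prems that by (auto intro!: bounded_bilinear.FDERIV[OF assms(1)] has_frechet_derivative)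
  next
    have "Ck_on k S f" "Ck_on k S g" using Suc.prems Ck_on_Suc_imp by blast+
    then show "Ck_on k S (\<lambda>x. bl (f x) (frechet_derivative g (at x) v) + bl (frechet_derivative f (at x) v) (g x))" for v
      by (intro Ck_on_add[OF assms(2)] Suc.IH) (use Suc.prems in auto)
  qed
qed

lemma Ck_on_sum:
  assumes "open S" "\<And>i. i \<in> I \<Longrightarrow> Ck_on k S (f i)"
  shows "Ck_on k S (\<lambda>x. \<Sum>i\<in>I. f i x)"
  using assms(2)
  by (induction I rule: infinite_finite_induct) (auto intro!: Ck_on_const Ck_on_add assms(1))

text \<open>A Euclidean middle space allows the direction \<open>Df(x) v\<close>, which varies with \<open>x\<close>, to be expanded in
  a basis. The derivative is then a sum of products of a component of \<open>Df\<close> and a fixed directional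
  derivative of \<open>g\<close> composed with \<open>f\<close>, and the induction goes through.\<close>

lemma Ck_on_compose:
  fixes f :: "'a::real_normed_vector \<Rightarrow> 'b::euclidean_space"
  assumes "open S" "open T" "f ` S \<subseteq> T"
  shows "Ck_on k S f \<Longrightarrow> Ck_on k T g \<Longrightarrow> Ck_on k S (\<lambda>x. g (f x))"
proof (induction k arbitrary: g)
  case 0
  then show ?case by (simp add: continuous_on_compose2[OF _ _ assms(3)])
next
  case (Suc k)
  let ?Df = "\<lambda>x. frechet_derivative f (at x)" and ?Dg = "\<lambda>y. frechet_derivative g (at y)"
  show ?case
  proof (rule Ck_on_SucI[OF assms(1)])
    fix x assume x: "x \<in> S"
    have g: "(g has_derivative ?Dg (f x)) (at (f x))" and f: "(f has_derivative ?Df x) (at x)"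
      using Suc.prems x assms(3) by (auto intro!: has_frechet_derivative)
    have "((\<lambda>x. g (f x)) has_derivative (\<lambda>v. ?Dg (f x) (?Df x v))) (at x)"
      using diff_chain_at[OF f g] by (simp add: o_def)
    moreover have "?Dg (f x) (?Df x v) = (\<Sum>e\<in>Basis. (?Df x v \<bullet> e) *\<^sub>R ?Dg (f x) e)" for v
    proof -
      have lin: "linear (?Dg (f x))" by (rule has_derivative_linear[OF g])
      have "?Dg (f x) (?Df x v) = ?Dg (f x) (\<Sum>e\<in>Basis. (?Df x v \<bullet> e) *\<^sub>R e)"
        by (simp only: euclidean_representation)
      also have "\<dots> = (\<Sum>e\<in>Basis. (?Df x v \<bullet> e) *\<^sub>R ?Dg (f x) e)"
        by (simp only: linear_sum[OF lin] linear_scale[OF lin])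
      finally show ?thesis .
    qed
    ultimately show "((\<lambda>x. g (f x)) has_derivative (\<lambda>v. \<Sum>e\<in>Basis. (?Df x v \<bullet> e) *\<^sub>R ?Dg (f x) e)) (at x)"
      by simp
  next
    fix v
    have "Ck_on k S f" by (rule Ck_on_Suc_imp[OF Suc.prems(1)])
    then have "Ck_on k S (\<lambda>x. ?Dg (f x) e)" for e
      using Suc.prems(2) by (intro Suc.IH) auto
    moreover have "Ck_on k S (\<lambda>x. ?Df x v \<bullet> e)" for e
      using Suc.prems(1) by (intro Ck_on_linear[OF bounded_linear_inner_left assms(1)]) auto
    ultimately show "Ck_on k S (\<lambda>x. \<Sum>e\<in>Basis. (?Df x v \<bullet> e) *\<^sub>R ?Dg (f x) e)"
      by (intro Ck_on_sum[OF assms(1)] Ck_on_bilinear[OF bounded_bilinear_scaleR assms(1)])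
  qed
qed

lemma smooth_on_cong:
  "open S \<Longrightarrow> (\<And>x. x \<in> S \<Longrightarrow> f x = g x) \<Longrightarrow> smooth_on S f \<Longrightarrow> smooth_on S g"
  using Ck_on_cong[of S f g] unfolding smooth_on_def by blast

lemma smooth_on_subset: "smooth_on T f \<Longrightarrow> S \<subseteq> T \<Longrightarrow> smooth_on S f"
  unfolding smooth_on_def using Ck_on_subset by blast

lemma smooth_on_local:
  "(\<And>x. x \<in> S \<Longrightarrow> \<exists>U. open U \<and> x \<in> U \<and> smooth_on U f) \<Longrightarrow> smooth_on S f"
  unfolding smooth_on_def by (intro allI Ck_on_local) blast

lemma smooth_on_imp_continuous_on: "smooth_on S f \<Longrightarrow> continuous_on S f"
  unfolding smooth_on_def by (metis Ck_on.simps(1))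

lemma smooth_on_imp_differentiable: "smooth_on S f \<Longrightarrow> x \<in> S \<Longrightarrow> f differentiable (at x)"
  unfolding smooth_on_def by (metis Ck_on.simps(2))

lemma smooth_on_has_derivative:
  "smooth_on S f \<Longrightarrow> x \<in> S \<Longrightarrow> (f has_derivative frechet_derivative f (at x)) (at x)"
  by (rule has_frechet_derivative[OF smooth_on_imp_differentiable])

lemma smooth_on_derivative: "smooth_on S f \<Longrightarrow> smooth_on S (\<lambda>x. frechet_derivative f (at x) v)"
  unfolding smooth_on_def by (metis Ck_on.simps(2))

lemma smooth_on_const: "open S \<Longrightarrow> smooth_on S (\<lambda>x. c)"
  by (simp add: smooth_on_def Ck_on_const)

lemma smooth_on_linear: "bounded_linear T \<Longrightarrow> open S \<Longrightarrow> smooth_on S f \<Longrightarrow> smooth_on S (\<lambda>x. T (f x))"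
  by (simp add: smooth_on_def Ck_on_linear)

lemma smooth_on_id: "open S \<Longrightarrow> smooth_on S (\<lambda>x. x)"
proof -
  assume S: "open S"
  have "Ck_on k S (\<lambda>x. x)" for k
  proof (cases k)
    case (Suc j)
    show ?thesis unfolding Suc
      by (rule Ck_on_SucI[OF S, where D="\<lambda>x v. v"]) (simp_all add: has_derivative_ident Ck_on_const S)
  qed simp
  then show ?thesis unfolding smooth_on_def by blast
qed

lemma smooth_on_bounded_linear: "bounded_linear T \<Longrightarrow> open S \<Longrightarrow> smooth_on S T"
  using smooth_on_linear[of T S "\<lambda>x. x"] smooth_on_id[of S] by blast

lemma smooth_on_add: "open S \<Longrightarrow> smooth_on S f \<Longrightarrow> smooth_on S g \<Longrightarrow> smooth_on S (\<lambda>x. f x + g x)"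
  by (simp add: smooth_on_def Ck_on_add)

lemma smooth_on_bilinear:
  "bounded_bilinear bl \<Longrightarrow> open S \<Longrightarrow> smooth_on S f \<Longrightarrow> smooth_on S g \<Longrightarrow>
    smooth_on S (\<lambda>x. bl (f x) (g x))"
  by (simp add: smooth_on_def Ck_on_bilinear)

lemmas smooth_on_mult = smooth_on_bilinear[OF bounded_bilinear_mult]
lemmas smooth_on_scaleR = smooth_on_bilinear[OF bounded_bilinear_scaleR]
lemmas smooth_on_inner = smooth_on_bilinear[OF bounded_bilinear_inner]

lemma smooth_on_minus: "open S \<Longrightarrow> smooth_on S f \<Longrightarrow> smooth_on S (\<lambda>x. - f x)"
  by (rule smooth_on_linear[OF bounded_linear_minus[OF bounded_linear_ident]])

lemma smooth_on_diff: "open S \<Longrightarrow> smooth_on S f \<Longrightarrow> smooth_on S g \<Longrightarrow> smooth_on S (\<lambda>x. f x - g x)"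
  using smooth_on_add[OF _ _ smooth_on_minus, of S f g] by simp

lemma smooth_on_power: 
  fixes f :: "_ \<Rightarrow> real"
  shows "open S \<Longrightarrow> smooth_on S f \<Longrightarrow> smooth_on S (\<lambda>x. (f x) ^ n)"
  by (induction n) (auto intro: smooth_on_const smooth_on_mult)

lemma smooth_on_compose:
  fixes f :: "'a::real_normed_vector \<Rightarrow> 'b::euclidean_space"
  shows "open S \<Longrightarrow> open T \<Longrightarrow> (\<And>x. x \<in> S \<Longrightarrow> f x \<in> T) \<Longrightarrow> smooth_on S f \<Longrightarrow> smooth_on T g \<Longrightarrow>
    smooth_on S (\<lambda>x. g (f x))"
  unfolding smooth_on_def using Ck_on_compose[of S T f _ g] by blast

lemma smooth_on_Pair:
  fixes f :: "'a::real_normed_vector \<Rightarrow> 'b::real_normed_vector" and g :: "'a \<Rightarrow> 'c::real_normed_vector"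
  assumes "open S" "smooth_on S f" "smooth_on S g"
  shows "smooth_on S (\<lambda>x. (f x, g x))"
proof -
  have "bounded_linear (\<lambda>x::'b. (x, 0::'c))" "bounded_linear (\<lambda>x::'c. (0::'b, x))"
    by (intro bounded_linear_Pair bounded_linear_ident bounded_linear_zero)+
  from smooth_on_add[OF assms(1) smooth_on_linear[OF this(1) assms(1,2)] smooth_on_linear[OF this(2) assms(1,3)]]
  show ?thesis by simp
qed

lemmas smooth_on_fst = smooth_on_linear[OF bounded_linear_fst]
lemmas smooth_on_snd = smooth_on_linear[OF bounded_linear_snd]

lemma Ck_on_real:
  fixes f :: "real \<Rightarrow> real"
  assumes "open S" "\<And>x. x \<in> S \<Longrightarrow> (f has_real_derivative f' x) (at x)" "Ck_on k S f'"
  shows "Ck_on (Suc k) S f"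
  by (rule Ck_on_SucI[OF assms(1), where D="\<lambda>x v. f' x * v"])
    (auto intro!: Ck_on_bilinear[OF bounded_bilinear_mult] Ck_on_const assms
      has_field_derivative_imp_has_derivative)

lemma Ck_on_real_0:
  fixes f :: "real \<Rightarrow> real"
  assumes "\<And>x. x \<in> S \<Longrightarrow> (f has_real_derivative f' x) (at x)"
  shows "Ck_on 0 S f"
  using assms by (auto intro!: continuous_at_imp_continuous_on DERIV_isCont)

lemma smooth_on_exp_real: "smooth_on UNIV (exp :: real \<Rightarrow> real)"
proof -
  have "Ck_on k UNIV (exp :: real \<Rightarrow> real)" for k
    by (induction k) (auto intro!: Ck_on_real[where f'=exp] continuous_intros simp del: Ck_on.simps(2))
  then show ?thesis by (simp add: smooth_on_def)
qed

lemma smooth_on_sin_cos_real: "smooth_on UNIV (sin :: real \<Rightarrow> real)" "smooth_on UNIV (cos :: real \<Rightarrow> real)"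
proof -
  have "Ck_on k UNIV (sin :: real \<Rightarrow> real) \<and> Ck_on k UNIV (cos :: real \<Rightarrow> real)" for k
  proof (induction k)
    case (Suc k)
    have "Ck_on k UNIV (\<lambda>x::real. - sin x)"
      by (rule Ck_on_linear[OF bounded_linear_minus[OF bounded_linear_ident] open_UNIV]) (use Suc in simp)
    with Suc show ?case
      by (intro conjI Ck_on_real[OF open_UNIV DERIV_sin] Ck_on_real[OF open_UNIV DERIV_cos]) auto
  qed (auto intro!: continuous_intros)
  then show "smooth_on UNIV (sin :: real \<Rightarrow> real)" "smooth_on UNIV (cos :: real \<Rightarrow> real)"
    by (auto simp: smooth_on_def)
qed

lemma smooth_on_inverse_real: "smooth_on (- {0}) (inverse :: real \<Rightarrow> real)"
proof -
  have o: "open (- {0::real})" by auto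
  have d: "(inverse has_real_derivative - (inverse x * inverse x)) (at x)" if "x \<in> - {0}" for x :: real
    using that by (auto intro!: derivative_eq_intros simp: power2_eq_square)
  have "Ck_on k (- {0}) (inverse :: real \<Rightarrow> real)" for k
  proof (induction k)
    case 0
    then show ?case by (rule Ck_on_real_0[OF d])
  next
    case (Suc k)
    show ?case
      by (rule Ck_on_real[OF o d]) (auto intro!: Ck_on_linear[OF bounded_linear_minus[OF bounded_linear_ident]]
          Ck_on_bilinear[OF bounded_bilinear_mult] Suc o)
  qed
  then show ?thesis by (simp add: smooth_on_def)
qed

lemma smooth_on_sqrt_real: "smooth_on {0<..} sqrt"
proof -
  have o: "open {0::real<..}" by auto
  have d: "(sqrt has_real_derivative (inverse (sqrt x) / 2)) (at x)" if "x \<in> {0<..}" for x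
    using that by (auto intro!: derivative_eq_intros)
  have "Ck_on k {0<..} sqrt" for k
  proof (induction k)
    case 0
    then show ?case by (rule Ck_on_real_0[OF d])
  next
    case (Suc k)
    have "Ck_on k {0<..} (\<lambda>x. inverse (sqrt x))"
      by (rule Ck_on_compose[where T="- {0}"]) (use Suc smooth_on_inverse_real in \<open>auto simp: smooth_on_def\<close>)
    then show ?case
      by (intro Ck_on_real[OF o d] Ck_on_linear[OF bounded_linear_divide o])
  qed
  then show ?thesis by (simp add: smooth_on_def)
qed

lemma smooth_on_inverse:
  "open S \<Longrightarrow> smooth_on S f \<Longrightarrow> (\<And>x. x \<in> S \<Longrightarrow> f x \<noteq> 0) \<Longrightarrow> smooth_on S (\<lambda>x. inverse (f x :: real))"
  by (rule smooth_on_compose[OF _ _ _ _ smooth_on_inverse_real]) auto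

lemma smooth_on_divide:
  fixes f g :: "_ \<Rightarrow> real"
  shows "open S \<Longrightarrow> smooth_on S f \<Longrightarrow> smooth_on S g \<Longrightarrow> (\<And>x. x \<in> S \<Longrightarrow> g x \<noteq> 0) \<Longrightarrow> smooth_on S (\<lambda>x. f x / g x)"
  unfolding divide_inverse by (intro smooth_on_mult smooth_on_inverse)

lemma smooth_on_sqrt:
  "open S \<Longrightarrow> smooth_on S f \<Longrightarrow> (\<And>x. x \<in> S \<Longrightarrow> f x > 0) \<Longrightarrow> smooth_on S (\<lambda>x. sqrt (f x))"
  by (rule smooth_on_compose[OF _ _ _ _ smooth_on_sqrt_real]) auto

lemma smooth_on_arctan_real: "smooth_on UNIV arctan"
proof -
  have d: "(arctan has_real_derivative inverse (1 + x\<^sup>2)) (at x)" if "x \<in> UNIV" for x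
    by (rule DERIV_arctan)
  have i: "smooth_on UNIV (\<lambda>x::real. inverse (1 + x\<^sup>2))"
    by (intro smooth_on_inverse smooth_on_add smooth_on_power smooth_on_const smooth_on_id)
      (auto simp: add_nonneg_eq_0_iff)
  have "Ck_on k UNIV arctan" for k
  proof (cases k)
    case 0
    then show ?thesis using Ck_on_real_0[OF d] by simp
  next
    case (Suc j)
    then show ?thesis using Ck_on_real[OF open_UNIV d] i by (simp add: smooth_on_def del: Ck_on.simps(2))
  qed
  then show ?thesis by (simp add: smooth_on_def)
qed

lemma smooth_on_exp: "open S \<Longrightarrow> smooth_on S f \<Longrightarrow> smooth_on S (\<lambda>x. exp (f x :: real))"
  by (rule smooth_on_compose[OF _ _ _ _ smooth_on_exp_real]) auto
lemma smooth_on_sin: "open S \<Longrightarrow> smooth_on S f \<Longrightarrow> smooth_on S (\<lambda>x. sin (f x :: real))"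
  by (rule smooth_on_compose[OF _ _ _ _ smooth_on_sin_cos_real(1)]) auto
lemma smooth_on_cos: "open S \<Longrightarrow> smooth_on S f \<Longrightarrow> smooth_on S (\<lambda>x. cos (f x :: real))"
  by (rule smooth_on_compose[OF _ _ _ _ smooth_on_sin_cos_real(2)]) auto
lemma smooth_on_arctan: "open S \<Longrightarrow> smooth_on S f \<Longrightarrow> smooth_on S (\<lambda>x. arctan (f x))"
  by (rule smooth_on_compose[OF _ _ _ _ smooth_on_arctan_real]) auto

lemmas smooth_intros = smooth_on_const smooth_on_id smooth_on_add smooth_on_minus smooth_on_diff
  smooth_on_mult smooth_on_scaleR smooth_on_power smooth_on_divide smooth_on_inverse
  smooth_on_sqrt smooth_on_exp smooth_on_sin smooth_on_cos smooth_on_arctan smooth_on_fst smooth_on_snd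

section \<open>Mixed derivatives commute\<close>

lemma DERIV_along_line:
  fixes f :: "'a::real_normed_vector \<Rightarrow> real"
  assumes "f differentiable (at (p + s *\<^sub>R u))"
  shows "((\<lambda>s. f (p + s *\<^sub>R u)) has_real_derivative frechet_derivative f (at (p + s *\<^sub>R u)) u) (at s)"
proof -
  let ?D = "frechet_derivative f (at (p + s *\<^sub>R u))"
  have f: "(f has_derivative ?D) (at (p + s *\<^sub>R u))" by (rule has_frechet_derivative[OF assms])
  have "((\<lambda>s. p + s *\<^sub>R u) has_derivative (\<lambda>t. t *\<^sub>R u)) (at s)"
    by (auto intro!: derivative_eq_intros)
  from diff_chain_at[OF this f]
  have "((\<lambda>s. f (p + s *\<^sub>R u)) has_derivative (\<lambda>t. ?D (t *\<^sub>R u))) (at s)"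
    by (simp add: o_def)
  then show ?thesis
    unfolding has_field_derivative_def using linear_scale[OF has_derivative_linear[OF f]]
    by (simp add: mult.commute fun_eq_iff mult_commute_abs)
qed

text \<open>Two applications of the mean value theorem, one in each direction. The second difference is
  symmetric in \<open>u\<close> and \<open>v\<close>, and this is what forces the mixed derivatives to agree in the limit.\<close>

lemma second_difference:
  fixes f :: "'a::real_normed_vector \<Rightarrow> real"
  assumes "ball p r \<subseteq> S" "smooth_on S f" "0 < h" "h * (norm u + norm v) < r"
  shows "\<exists>z\<in>ball p r. f (p + h *\<^sub>R u + h *\<^sub>R v) - f (p + h *\<^sub>R u) - f (p + h *\<^sub>R v) + f p
    = h * h * frechet_derivative (\<lambda>x. frechet_derivative f (at x) u) (at z) v"
proof -
  have near: "p + s *\<^sub>R u + t *\<^sub>R v \<in> ball p r" if "0 \<le> s" "s \<le> h" "0 \<le> t" "t \<le> h" for s t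
  proof -
    have "norm (s *\<^sub>R u + t *\<^sub>R v) \<le> s * norm u + t * norm v"
      using norm_triangle_ineq[of "s *\<^sub>R u" "t *\<^sub>R v"] that by simp
    also have "\<dots> \<le> h * (norm u + norm v)"
      using that by (simp add: distrib_left add_mono mult_right_mono)
    also have "\<dots> < r" by (rule assms(4))
    moreover have "dist p (p + w) = norm w" for w
      by (metis add_diff_cancel_left' dist_commute dist_norm)
    ultimately show ?thesis by (simp add: add.assoc)
  qed
  let ?Du = "\<lambda>x. frechet_derivative f (at x) u"
  have df: "f differentiable (at z)" if "z \<in> ball p r" for z
    using smooth_on_imp_differentiable[OF assms(2)] that assms(1) by auto
  have ddf: "?Du differentiable (at z)" if "z \<in> ball p r" for z
    using smooth_on_imp_differentiable[OF smooth_on_derivative[OF assms(2)]] that assms(1) by auto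
  have "\<exists>s>0. s < h \<and> (f ((p + h *\<^sub>R v) + h *\<^sub>R u) - f (p + h *\<^sub>R u)) - (f ((p + h *\<^sub>R v) + 0 *\<^sub>R u) - f (p + 0 *\<^sub>R u))
      = (h - 0) * (?Du ((p + h *\<^sub>R v) + s *\<^sub>R u) - ?Du (p + s *\<^sub>R u))"
  proof (rule MVT2[OF assms(3)])
    fix s :: real assume "0 \<le> s" "s \<le> h"
    then show "((\<lambda>s. f ((p + h *\<^sub>R v) + s *\<^sub>R u) - f (p + s *\<^sub>R u)) has_real_derivative
        ?Du ((p + h *\<^sub>R v) + s *\<^sub>R u) - ?Du (p + s *\<^sub>R u)) (at s)"
      using near[of s h] near[of s 0] assms(3)
      by (intro derivative_intros DERIV_along_line df) (auto simp: algebra_simps)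
  qed
  then obtain s where s: "0 < s" "s < h" and e1: "f (p + h *\<^sub>R v + h *\<^sub>R u) - f (p + h *\<^sub>R u) - (f (p + h *\<^sub>R v) - f p)
      = h * (?Du (p + h *\<^sub>R v + s *\<^sub>R u) - ?Du (p + s *\<^sub>R u))" by auto
  have "\<exists>t>0. t < h \<and> ?Du ((p + s *\<^sub>R u) + h *\<^sub>R v) - ?Du ((p + s *\<^sub>R u) + 0 *\<^sub>R v)
      = (h - 0) * frechet_derivative ?Du (at ((p + s *\<^sub>R u) + t *\<^sub>R v)) v"
  proof (rule MVT2[OF assms(3)])
    fix t :: real assume "0 \<le> t" "t \<le> h"
    then show "((\<lambda>t. ?Du ((p + s *\<^sub>R u) + t *\<^sub>R v)) has_real_derivative
        frechet_derivative ?Du (at ((p + s *\<^sub>R u) + t *\<^sub>R v)) v) (at t)"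
      using near[of s t] s by (intro DERIV_along_line ddf) auto
  qed
  then obtain t where t: "0 < t" "t < h" and e2: "?Du (p + s *\<^sub>R u + h *\<^sub>R v) - ?Du (p + s *\<^sub>R u)
      = h * frechet_derivative ?Du (at (p + s *\<^sub>R u + t *\<^sub>R v)) v" by auto
  have c: "p + h *\<^sub>R v + s *\<^sub>R u = p + s *\<^sub>R u + h *\<^sub>R v" "p + h *\<^sub>R v + h *\<^sub>R u = p + h *\<^sub>R u + h *\<^sub>R v"
    by (simp_all add: algebra_simps)
  have "f (p + h *\<^sub>R u + h *\<^sub>R v) - f (p + h *\<^sub>R u) - f (p + h *\<^sub>R v) + f p
      = h * h * frechet_derivative ?Du (at (p + s *\<^sub>R u + t *\<^sub>R v)) v"
    using e1 unfolding c e2 mult.assoc by linarith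
  then show ?thesis
    using near[of s t] s t by (intro bexI[of _ "p + s *\<^sub>R u + t *\<^sub>R v"]) simp_all
qed

lemma frechet_derivatives_commute:
  fixes f :: "'a::real_normed_vector \<Rightarrow> real"
  assumes "open S" "smooth_on S f" "p \<in> S"
  shows "frechet_derivative (\<lambda>x. frechet_derivative f (at x) u) (at p) v
    = frechet_derivative (\<lambda>x. frechet_derivative f (at x) v) (at p) u"
proof -
  define a where "a = (\<lambda>z. frechet_derivative (\<lambda>x. frechet_derivative f (at x) u) (at z) v)"
  define b where "b = (\<lambda>z. frechet_derivative (\<lambda>x. frechet_derivative f (at x) v) (at z) u)"
  have "smooth_on S a" "smooth_on S b"
    unfolding a_def b_def by (intro smooth_on_derivative assms)+
  then have cont: "isCont a p" "isCont b p"
    using smooth_on_imp_continuous_on assms by (metis continuous_on_eq_continuous_at)+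
  have "dist (a p) (b p) \<le> e" if e: "e > 0" for e
  proof -
    obtain r1 where r1: "r1 > 0" "ball p r1 \<subseteq> S" using assms open_contains_ball by blast
    obtain r2 where r2: "r2 > 0" "\<And>z. dist z p < r2 \<Longrightarrow> dist (a z) (a p) < e / 2"
      using cont(1) e unfolding continuous_at_eps_delta by (meson half_gt_zero)
    obtain r3 where r3: "r3 > 0" "\<And>z. dist z p < r3 \<Longrightarrow> dist (b z) (b p) < e / 2"
      using cont(2) e unfolding continuous_at_eps_delta by (meson half_gt_zero)
    define r where "r = min r1 (min r2 r3)"
    have r: "r > 0" "ball p r \<subseteq> S" using r1 r2 r3 by (auto simp: r_def)
    define h where "h = r / (norm u + norm v + 1)"
    have nn: "norm u + norm v + 1 > 0" by (smt (verit) norm_ge_zero)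
    have h: "h > 0" "h * (norm u + norm v) < r"
      using r nn by (auto simp: h_def pos_divide_less_eq)
    obtain z1 where z1: "z1 \<in> ball p r" "f (p + h *\<^sub>R u + h *\<^sub>R v) - f (p + h *\<^sub>R u) - f (p + h *\<^sub>R v) + f p = h * h * a z1"
      using second_difference[OF r(2) assms(2) h] unfolding a_def by blast
    obtain z2 where z2: "z2 \<in> ball p r" "f (p + h *\<^sub>R v + h *\<^sub>R u) - f (p + h *\<^sub>R v) - f (p + h *\<^sub>R u) + f p = h * h * b z2"
      using second_difference[OF r(2) assms(2) h(1), of v u] h(2) unfolding b_def by (auto simp: add.commute)
    have c: "p + h *\<^sub>R v + h *\<^sub>R u = p + h *\<^sub>R u + h *\<^sub>R v" by (simp add: algebra_simps)
    have "h * h * a z1 = h * h * b z2" using z1(2) z2(2)[unfolded c] by linarith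
    then have "a z1 = b z2" using h by simp
    moreover have "dist (a z1) (a p) < e / 2" "dist (b z2) (b p) < e / 2"
      by (rule r2(2), use z1(1) in \<open>simp add: r_def dist_commute[of p]\<close>)
        (rule r3(2), use z2(1) in \<open>simp add: r_def dist_commute[of p]\<close>)
    ultimately show ?thesis unfolding dist_real_def by linarith
  qed
  then have "dist (a p) (b p) \<le> 0" by (rule field_le_epsilon) simp
  then show ?thesis by (simp add: a_def b_def)
qed

section \<open>Slices and integrals depending on a parameter\<close>

lemma smooth_on_slice_has_derivative:
  assumes "smooth_on W f" "(x, y) \<in> W"
  shows "((\<lambda>z. f (z, y)) has_derivative (\<lambda>v. frechet_derivative f (at (x, y)) (v, 0))) (at x)"
    and "((\<lambda>z. f (x, z)) has_derivative (\<lambda>v. frechet_derivative f (at (x, y)) (0, v))) (at y)"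
proof -
  have f: "(f has_derivative frechet_derivative f (at (x, y))) (at (x, y))"
    by (rule smooth_on_has_derivative[OF assms])
  have "((\<lambda>z. (z, y)) has_derivative (\<lambda>v. (v, 0))) (at x)" "((\<lambda>z. (x, z)) has_derivative (\<lambda>v. (0, v))) (at y)"
    by (auto intro!: derivative_eq_intros)
  then show "((\<lambda>z. f (z, y)) has_derivative (\<lambda>v. frechet_derivative f (at (x, y)) (v, 0))) (at x)"
    and "((\<lambda>z. f (x, z)) has_derivative (\<lambda>v. frechet_derivative f (at (x, y)) (0, v))) (at y)"
    using diff_chain_at f by (force simp: o_def)+
qed

lemma has_derivative_parameter_integral:
  fixes H :: "'a::euclidean_space \<times> real \<Rightarrow> real"
  assumes Z: "open Z" and H: "smooth_on (Z \<times> UNIV) H" and z: "z \<in> Z"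
  shows "((\<lambda>z. integral {0..1} (\<lambda>s. H (z, s))) has_derivative
    (\<lambda>v. integral {0..1} (\<lambda>s. frechet_derivative H (at (z, s)) (v, 0)))) (at z)"
proof -
  obtain r where r: "r > 0" "ball z r \<subseteq> Z" using Z z open_contains_ball by blast
  define D where "D = (\<lambda>z s. Blinfun (\<lambda>v. frechet_derivative H (at (z, s)) (v, 0)))"
  have D: "blinfun_apply (D z s) = (\<lambda>v. frechet_derivative H (at (z, s)) (v, 0))" if "z \<in> Z" for z s
    unfolding D_def using smooth_on_slice_has_derivative(1)[OF H, of z s] that
    by (intro bounded_linear_Blinfun_apply) (auto intro: has_derivative_bounded_linear)
  have contD: "continuous_on (Z \<times> UNIV) (\<lambda>(z, s). D z s)"
  proof (rule continuous_on_blinfun_componentwise)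
    fix i :: 'a
    have "continuous_on (Z \<times> UNIV) (\<lambda>p. frechet_derivative H (at p) (i, 0))"
      by (rule smooth_on_imp_continuous_on[OF smooth_on_derivative[OF H]])
    then show "continuous_on (Z \<times> UNIV) (\<lambda>p. blinfun_apply (case p of (z, s) \<Rightarrow> D z s) i)"
      by (rule continuous_on_eq) (auto simp: D)
  qed
  have cH: "continuous_on {0..1} (\<lambda>s. H (z, s))" if "z \<in> Z" for z
    by (rule continuous_on_compose2[OF smooth_on_imp_continuous_on[OF H]]) (auto intro!: continuous_intros that)
  have "((\<lambda>z. integral (cbox 0 1) (\<lambda>s. H (z, s))) has_derivative integral (cbox 0 1) (D z)) (at z within ball z r)"
  proof (rule leibniz_rule)
    show "((\<lambda>z. H (z, t)) has_derivative blinfun_apply (D x t)) (at x within ball z r)" if "x \<in> ball z r" for x t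
    proof -
      have "x \<in> Z" using that r(2) by blast
      then have "(x, t) \<in> Z \<times> UNIV" by simp
      from has_derivative_at_withinI[OF smooth_on_slice_has_derivative(1)[OF H this]]
      show ?thesis unfolding D[OF \<open>x \<in> Z\<close>] .
    qed
    show "(\<lambda>s. H (x, s)) integrable_on cbox 0 1" if "x \<in> ball z r" for x
      using cH[of x] that r(2) by (auto intro!: integrable_continuous_real)
    show "continuous_on (ball z r \<times> cbox 0 1) (\<lambda>(x, t). D x t)"
      by (rule continuous_on_subset[OF contD]) (use r(2) in auto)
  qed (use r in auto)
  then have "((\<lambda>z. integral {0..1} (\<lambda>s. H (z, s))) has_derivative integral {0..1} (D z)) (at z)"
    using r(1) at_within_open[of z "ball z r"] by simp
  moreover have "D z integrable_on {0..1}"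
    by (rule integrable_continuous_real) 
      (rule continuous_on_compose2[OF contD, where f="\<lambda>s. (z, s)", simplified], auto intro!: continuous_intros z)
  then have "blinfun_apply (integral {0..1} (D z)) v = integral {0..1} (\<lambda>s. frechet_derivative H (at (z, s)) (v, 0))" for v
    using blinfun_apply_integral[of "D z" "{0..1}" v] D[OF z] by simp
  ultimately show ?thesis by (metis (no_types, lifting) ext)
qed

text \<open>Differentiation under the integral sign reproduces an integral of the same shape, so the induction
  runs over all integrands at once.\<close>

lemma smooth_on_parameter_integral:
  fixes H :: "'a::euclidean_space \<times> real \<Rightarrow> real"
  assumes Z: "open Z" and H: "smooth_on (Z \<times> UNIV) H"
  shows "smooth_on Z (\<lambda>z. integral {0..1} (\<lambda>s. H (z, s)))"
proof -
  have "Ck_on k Z (\<lambda>z. integral {0..1} (\<lambda>s. H (z, s)))" for k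
    using H
  proof (induction k arbitrary: H)
    case 0
    then have "continuous_on (Z \<times> cbox 0 1) H"
      by (meson UNIV_I continuous_on_subset smooth_on_imp_continuous_on subset_iff Sigma_mono)
    then show ?case
      using integral_continuous_on_param[of Z 0 1 "\<lambda>z s. H (z, s)"] by simp
  next
    case (Suc k)
    show ?case
      by (rule Ck_on_SucI[OF Z has_derivative_parameter_integral[OF Z Suc.prems]])
        (auto intro!: Suc.IH smooth_on_derivative Suc.prems)
  qed
  then show ?thesis by (simp add: smooth_on_def)
qed

section \<open>The metric function in fibre coordinates\<close>

text \<open>The metric function with the two-case arctan term of \<open>f\<close> replaced by one expression that is
  smooth across \<open>b = 0\<close>.\<close>

definition metric_fun :: "real \<Rightarrow> real \<Rightarrow> real \<Rightarrow> real" where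
  "metric_fun g b q = sqrt (b\<^sup>2 + g * b * q + q\<^sup>2) *
     exp (- (1/2) * (g / sqrt (1 - g\<^sup>2 / 4)) * (pi / 2 - arctan ((b + g / 2 * q) / (sqrt (1 - g\<^sup>2 / 4) * q))))"

lemma charge_radicand_pos: "- 2 < g \<Longrightarrow> g < 2 \<Longrightarrow> 0 < 1 - g\<^sup>2 / (4::real)"
  using abs_square_less_1[of "g / 2"] by (simp add: power_divide)

lemma metric_form_pos:
  fixes g b q :: real
  assumes "- 2 < g" "g < 2" "q > 0"
  shows "0 < b\<^sup>2 + g * b * q + q\<^sup>2"
proof -
  have "b\<^sup>2 + g * b * q + q\<^sup>2 = (b + g / 2 * q)\<^sup>2 + (1 - g\<^sup>2 / 4) * q\<^sup>2"
    by (simp add: power2_eq_square algebra_simps)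
  moreover have "(1 - g\<^sup>2 / 4) * q\<^sup>2 > 0" using charge_radicand_pos assms by simp
  ultimately show ?thesis by (smt (verit) zero_le_power2)
qed

text \<open>The logarithmic derivative of \<open>sqrt B\<close> contributes \<open>dB / (2 B)\<close> and the exponent
  \<open>(g/2) (q db - b dq) / B\<close>, because \<open>h\<^sup>2 q\<^sup>2 + (b + g q/2)\<^sup>2 = B\<close>. Their sum is free of \<open>h\<close>.\<close>

lemma has_derivative_metric_fun:
  fixes b q :: "'a::real_normed_vector \<Rightarrow> real"
  assumes g: "- 2 < g" "g < 2" and qpos: "q y > 0"
    and b: "(b has_derivative b') (at y)" and q: "(q has_derivative q') (at y)"
  shows "((\<lambda>y. metric_fun g (b y) (q y)) has_derivative
    (\<lambda>w. metric_fun g (b y) (q y) / ((b y)\<^sup>2 + g * b y * q y + (q y)\<^sup>2)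
      * (q y * q' w + (b y + g * q y) * b' w))) (at y)"
proof -
  define h where "h = sqrt (1 - g\<^sup>2 / 4)"
  define B where "B = (\<lambda>y. (b y)\<^sup>2 + g * b y * q y + (q y)\<^sup>2)"
  define r where "r = (\<lambda>y. (b y + g / 2 * q y) / (h * q y))"
  define E where "E = (\<lambda>y. exp (- (1/2) * (g / h) * (pi / 2 - arctan (r y))))"
  have h: "h > 0" "h\<^sup>2 = 1 - g\<^sup>2 / 4" using charge_radicand_pos[OF g] by (simp_all add: h_def)
  have Bpos: "B y > 0" using metric_form_pos[OF g qpos] by (simp add: B_def)
  have K: "metric_fun g (b z) (q z) = sqrt (B z) * E z" for z
    by (simp add: metric_fun_def B_def E_def r_def h_def)
  have dB: "(B has_derivative (\<lambda>w. 2 * b y * b' w + g * (b' w * q y + b y * q' w) + 2 * q y * q' w)) (at y)"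
    unfolding B_def
    by (auto intro!: derivative_eq_intros b q simp: fun_eq_iff algebra_simps)
  have dr: "(r has_derivative (\<lambda>w. (b' w * q y - b y * q' w) / (h * (q y)\<^sup>2))) (at y)"
    unfolding r_def
    by (rule derivative_eq_intros b q refl | use h qpos in \<open>force simp: fun_eq_iff field_simps power2_eq_square\<close>)+
  have r2: "1 + (r y)\<^sup>2 = B y / (h\<^sup>2 * (q y)\<^sup>2)"
  proof -
    have "B y = h\<^sup>2 * (q y)\<^sup>2 + (b y + g / 2 * q y)\<^sup>2"
      unfolding h(2) B_def by (simp add: power2_eq_square algebra_simps)
    moreover have "(r y)\<^sup>2 = (b y + g / 2 * q y)\<^sup>2 / (h\<^sup>2 * (q y)\<^sup>2)"
      by (simp only: r_def power_divide power_mult_distrib)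
    moreover have "h\<^sup>2 * (q y)\<^sup>2 \<noteq> 0" using h(1) qpos by simp
    ultimately show ?thesis by (metis add_divide_distrib divide_self)
  qed
  have da: "((\<lambda>y. arctan (r y)) has_derivative (\<lambda>w. h * (b' w * q y - b y * q' w) / B y)) (at y)"
    using h(1) qpos Bpos
    by (intro has_derivative_eq_rhs[OF has_derivative_arctan[OF dr]], simp only: fun_eq_iff r2)
      (simp add: field_simps power2_eq_square)
  have dE: "(E has_derivative (\<lambda>w. E y * (g / 2 * (b' w * q y - b y * q' w) / B y))) (at y)"
    unfolding E_def using h(1) Bpos
    by (intro has_derivative_eq_rhs[OF has_derivative_exp[OF has_derivative_mult_right[OF
          has_derivative_diff[OF has_derivative_const da]]]]) (simp add: fun_eq_iff field_simps)
  have dS: "((\<lambda>y. sqrt (B y)) has_derivative (\<lambda>w. (2 * b y * b' w + g * (b' w * q y + b y * q' w) + 2 * q y * q' w) / (2 * sqrt (B y)))) (at y)"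
    using Bpos by (auto intro!: derivative_eq_intros dB simp: fun_eq_iff field_simps)
  have s: "sqrt (B y) * sqrt (B y) = B y" "sqrt (B y) > 0" using Bpos by auto
  have "((\<lambda>y. sqrt (B y) * E y) has_derivative (\<lambda>w. sqrt (B y) * E y / B y
      * (q y * q' w + (b y + g * q y) * b' w))) (at y)"
  proof (rule has_derivative_eq_rhs[OF has_derivative_mult[OF dS dE]], rule ext)
    fix w
    have i: "1 / sqrt (B y) = sqrt (B y) / B y" using s by (simp add: field_simps)
    have "X / (2 * sqrt (B y)) = 1 / sqrt (B y) * (X / 2)" for X by simp
    then have j: "(2 * b y * b' w + g * (b' w * q y + b y * q' w) + 2 * q y * q' w) / (2 * sqrt (B y))
      = sqrt (B y) / B y * ((2 * b y * b' w + g * (b' w * q y + b y * q' w) + 2 * q y * q' w) / 2)"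
      unfolding i .
    show "sqrt (B y) * (E y * (g / 2 * (b' w * q y - b y * q' w) / B y)) +
        (2 * b y * b' w + g * (b' w * q y + b y * q' w) + 2 * q y * q' w) / (2 * sqrt (B y)) * E y
       = sqrt (B y) * E y / B y * (q y * q' w + (b y + g * q y) * b' w)"
      unfolding j using Bpos by (simp add: field_simps)
  qed
  then show ?thesis by (simp add: K B_def)
qed

lemma spatial_form_pos:
  fixes c U V :: real
  assumes "0 < c" "c < 1" "0 < U\<^sup>2 + V\<^sup>2"
  shows "0 < (1 - c\<^sup>2) * U\<^sup>2 + V\<^sup>2"
proof -
  have c: "0 < 1 - c\<^sup>2" using assms by (simp add: power_less_one_iff)
  show ?thesis
  proof (cases "V = 0")
    case True
    then show ?thesis using assms(3) c by simp
  next
    case False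
    then show ?thesis using c by (simp add: add_nonneg_pos)
  qed
qed

definition spatial_norm :: "real \<Rightarrow> real \<Rightarrow> real \<Rightarrow> real" where
  "spatial_norm c U V = sqrt ((1 - c\<^sup>2) * U\<^sup>2 + V\<^sup>2)"

lemma spatial_norm_pos: "0 < c \<Longrightarrow> c < 1 \<Longrightarrow> 0 < U\<^sup>2 + V\<^sup>2 \<Longrightarrow> 0 < spatial_norm c U V"
  by (simp add: spatial_norm_def spatial_form_pos)

text \<open>Only negative \<open>g u\<close> is critical. The bound rests on \<open>(1 - c\<^sup>2) c\<^sup>2 \<le> 1/4\<close> and \<open>g\<^sup>2 < 4\<close>, which give
  \<open>((1 - c\<^sup>2) g c u)\<^sup>2 < (1 - c\<^sup>2) u\<^sup>2 \<le> q\<^sup>2\<close> for \<open>u \<noteq> 0\<close>.\<close>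

lemma nu_form_pos:
  assumes "0 < c" "c < 1" "- 2 < g" "g < 2" "0 < U\<^sup>2 + V\<^sup>2"
  shows "0 < spatial_norm c U V + (1 - c\<^sup>2) * g * (c * U)"
proof -
  define s where "s = (1 - c\<^sup>2) * g * (c * U)"
  have c: "0 < 1 - c\<^sup>2" using assms by (simp add: power_less_one_iff)
  have q: "0 < spatial_norm c U V" by (rule spatial_norm_pos[OF assms(1,2,5)])
  have "4 * ((1 - c\<^sup>2) * c\<^sup>2) \<le> 1"
  proof -
    have "0 \<le> (1 - 2 * c\<^sup>2)\<^sup>2" by simp
    then show ?thesis by (simp add: power2_eq_square algebra_simps)
  qed
  moreover have "g\<^sup>2 < 4"
    using charge_radicand_pos[OF assms(3,4)] by simp
  moreover have "0 < (1 - c\<^sup>2) * c\<^sup>2" using c assms(1) by simp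
  ultimately have k: "(1 - c\<^sup>2) * c\<^sup>2 * g\<^sup>2 < 1"
    using mult_strict_left_mono[of "g\<^sup>2" 4 "(1 - c\<^sup>2) * c\<^sup>2"] by linarith
  have "s\<^sup>2 < (spatial_norm c U V)\<^sup>2"
  proof (cases "U = 0")
    case True
    then show ?thesis using q by (simp add: s_def)
  next
    case False
    have "s\<^sup>2 = (1 - c\<^sup>2) * U\<^sup>2 * ((1 - c\<^sup>2) * c\<^sup>2 * g\<^sup>2)"
      by (simp add: s_def power2_eq_square algebra_simps)
    also have "\<dots> < (1 - c\<^sup>2) * U\<^sup>2 * 1"
      using k False c by (intro mult_strict_left_mono) auto
    also have "\<dots> \<le> (spatial_norm c U V)\<^sup>2"
      using c by (simp add: spatial_norm_def)
    finally show ?thesis .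
  qed
  then have "- s < spatial_norm c U V"
    using q by (intro power2_less_imp_less[of "- s"]) auto
  then show ?thesis by (simp add: s_def)
qed

text \<open>The factor \<open>sqrt (\<nu>/q) / B\<close> in \<open>d\<theta> = (sqrt (\<nu>/q) / B) (u dv - v du)\<close>.\<close>

definition angle_density :: "real \<Rightarrow> real \<Rightarrow> real \<Rightarrow> real \<Rightarrow> real" where
  "angle_density c g U V =
     sqrt ((spatial_norm c U V + (1 - c\<^sup>2) * g * (c * U)) / spatial_norm c U V)
       / ((c * U)\<^sup>2 + g * (c * U) * spatial_norm c U V + (spatial_norm c U V)\<^sup>2)"

lemma angle_density_pos:
  assumes "0 < c" "c < 1" "- 2 < g" "g < 2" "0 < U\<^sup>2 + V\<^sup>2"
  shows "0 < angle_density c g U V"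
  unfolding angle_density_def
  using nu_form_pos[OF assms] metric_form_pos[OF assms(3,4) spatial_norm_pos[OF assms(1,2,5)]]
    spatial_norm_pos[OF assms(1,2,5)] by simp

lemma angle_density_scale:
  assumes "r > 0"
  shows "angle_density c g (r * U) (r * V) = angle_density c g U V / r\<^sup>2"
proof -
  have q: "spatial_norm c (r * U) (r * V) = r * spatial_norm c U V"
  proof -
    have "(1 - c\<^sup>2) * (r * U)\<^sup>2 + (r * V)\<^sup>2 = r\<^sup>2 * ((1 - c\<^sup>2) * U\<^sup>2 + V\<^sup>2)"
      by (simp add: power_mult_distrib algebra_simps)
    then show ?thesis using assms by (simp add: spatial_norm_def real_sqrt_mult)
  qed
  have 1: "r * q + (1 - c\<^sup>2) * g * (c * (r * U)) = r * (q + (1 - c\<^sup>2) * g * (c * U))" for q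
    by (simp add: algebra_simps)
  have 2: "(c * (r * U))\<^sup>2 + g * (c * (r * U)) * (r * q) + (r * q)\<^sup>2 = ((c * U)\<^sup>2 + g * (c * U) * q + q\<^sup>2) * r\<^sup>2" for q
    by (simp add: power2_eq_square algebra_simps)
  show ?thesis unfolding angle_density_def q 1 2 using assms by simp
qed

lemma smooth_on_angle_density:
  assumes "open W" "smooth_on W c" "smooth_on W g" "smooth_on W U" "smooth_on W V"
    and "\<And>p. p \<in> W \<Longrightarrow> 0 < c p" "\<And>p. p \<in> W \<Longrightarrow> c p < 1" "\<And>p. p \<in> W \<Longrightarrow> - 2 < g p" "\<And>p. p \<in> W \<Longrightarrow> g p < 2"
    and "\<And>p. p \<in> W \<Longrightarrow> 0 < (U p)\<^sup>2 + (V p)\<^sup>2"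
  shows "smooth_on W (\<lambda>p. angle_density (c p) (g p) (U p) (V p))"
proof -
  have sn: "smooth_on W (\<lambda>p. spatial_norm (c p) (U p) (V p))"
    unfolding spatial_norm_def by (intro smooth_intros assms(1-5) spatial_form_pos assms(6-))
  have pos: "spatial_norm (c p) (U p) (V p) > 0" if "p \<in> W" for p
    using that assms(6-) by (intro spatial_norm_pos) auto
  show ?thesis unfolding angle_density_def
  proof (intro smooth_intros sn assms(1-5))
    fix p assume p: "p \<in> W"
    show "spatial_norm (c p) (U p) (V p) \<noteq> 0" using pos[OF p] by simp
    show "0 < (spatial_norm (c p) (U p) (V p) + (1 - (c p)\<^sup>2) * g p * (c p * U p)) / spatial_norm (c p) (U p) (V p)"
      using pos[OF p] nu_form_pos p assms(6-) by simp
    show "(c p * U p)\<^sup>2 + g p * (c p * U p) * spatial_norm (c p) (U p) (V p) + (spatial_norm (c p) (U p) (V p))\<^sup>2 \<noteq> 0"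
      using metric_form_pos[OF assms(8,9)[OF p] pos[OF p]] by (metis less_irrefl)
  qed
qed

text \<open>Both cases of \<open>f\<close> reduce to \<open>pi/2 - arctan ((p + g/2) / h)\<close> with \<open>p = b/q\<close>: the argument on the left is
  the cotangent of \<open>d\<close>, and the sign of \<open>p\<close> decides which shift by \<open>pi/2\<close> brings it into the range of
  arctan.\<close>

lemma arctan_cotangent:
  fixes g h p :: real
  assumes h: "h > 0" "h\<^sup>2 = 1 - g\<^sup>2 / 4" and p: "p \<noteq> 0"
  defines "d \<equiv> arctan ((p + g / 2) / h) - arctan (g / (2 * h))"
  shows "arctan ((1 + g / 2 * p) / (h * p)) = (if p > 0 then pi / 2 else - pi / 2) - d"
proof -
  define A D where "A = arctan ((p + g / 2) / h)" and "D = arctan (g / (2 * h))"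
  have bA: "- (pi / 2) < A" "A < pi / 2" "- (pi / 2) < D" "D < pi / 2"
    unfolding A_def D_def by (simp_all only: arctan_lbound arctan_ubound)
  have tA: "tan A = (p + g / 2) / h" and tD: "tan D = g / (2 * h)" by (simp_all add: A_def D_def tan_arctan)
  have cA: "cos A > 0" "cos D > 0" using bA by (simp_all add: cos_gt_zero_pi)
  have sA: "sin A = cos A * ((p + g / 2) / h)" "sin D = cos D * (g / (2 * h))"
    using tA tD cA by (simp_all add: tan_def field_simps)
  have "sin (A - D) = cos A * cos D * (p / h)"
    using h by (simp add: sin_diff sA field_simps)
  moreover have "cos (A - D) = cos A * cos D * ((1 + g / 2 * p) / h\<^sup>2)"
  proof -
    have "cos (A - D) = cos A * cos D * (1 + (p + g / 2) / h * (g / (2 * h)))"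
    proof -
      have "a * d + a * X * (d * Y) = a * d * (1 + X * Y)" for a d X Y :: real by (simp add: algebra_simps)
      then show ?thesis unfolding cos_diff sA .
    qed
    also have "1 + (p + g / 2) / h * (g / (2 * h)) = (h\<^sup>2 + (p + g / 2) * (g / 2)) / h\<^sup>2"
      using h(1) by (simp add: field_simps power2_eq_square)
    also have "h\<^sup>2 + (p + g / 2) * (g / 2) = 1 + g / 2 * p"
      unfolding h(2) by (simp add: field_simps power2_eq_square)
    finally show ?thesis .
  qed
  moreover have "k * (Z / h\<^sup>2) / (k * (p / h)) = Z / (h * p)" if "k \<noteq> 0" for k Z
    using that h(1) p by (simp add: power2_eq_square)
  moreover have "cos A * cos D \<noteq> 0" using cA by simp
  ultimately have cot: "cos (A - D) / sin (A - D) = (1 + g / 2 * p) / (h * p)"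
    by presburger
  show ?thesis
  proof (cases "p > 0")
    case True
    have "D < A" unfolding A_def D_def using True h by (simp add: arctan_less_iff field_simps)
    have "tan (pi / 2 - (A - D)) = cos (A - D) / sin (A - D)"
      unfolding tan_def by (simp add: sin_diff cos_diff)
    then show ?thesis
      using True bA \<open>D < A\<close> cot unfolding d_def A_def[symmetric] D_def[symmetric]
      by (intro arctan_unique) auto
  next
    case False
    then have "p < 0" using p by simp
    have "A < D" unfolding A_def D_def using \<open>p < 0\<close> h(1) by (simp add: arctan_less_iff field_simps mult_pos_neg)
    have "tan (- pi / 2 - x) = cos x / sin x" for x :: real
      unfolding tan_def by (simp add: sin_diff cos_diff)
    from this[of "A - D"]
    show ?thesis
      using False bA \<open>A < D\<close> cot unfolding d_def A_def[symmetric] D_def[symmetric]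
      by (intro arctan_unique) auto
  qed
qed

lemma matrix_inv_invertible:
  assumes "invertible M"
  shows "M ** matrix_inv M = mat 1" "matrix_inv M ** M = mat 1"
proof -
  have "M ** matrix_inv M = mat 1 \<and> matrix_inv M ** M = mat 1"
    using assms unfolding invertible_def matrix_inv_def by (rule someI_ex)
  then show "M ** matrix_inv M = mat 1" "matrix_inv M ** M = mat 1" by blast+
qed

text \<open>One coordinate chart of the surface with the fields expressed in it. The linear coordinates
  \<open>u\<close>, \<open>v\<close> on the fibre come from the orthonormal coframe \<open>b~\<close>, \<open>n\<close>; the vectors \<open>eu\<close>, \<open>ev\<close> form its dual
  frame.\<close>

locale finsleroid_chart =
  fixes F :: fields and X :: "(real^2) set"
  assumes open_X: "open X"
    and smooth_fields: "smooth_on X (bt_cov F)" "smooth_on X (n_cov F)" "smooth_on X (c_of F)" "smooth_on X (g_of F)"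
    and metric_sym: "x \<in> X \<Longrightarrow> transpose (metric F x) = metric F x"
    and metric_pos: "x \<in> X \<Longrightarrow> v \<noteq> 0 \<Longrightarrow> 0 < v \<bullet> (metric F x *v v)"
    and bt_unit: "x \<in> X \<Longrightarrow> bt_cov F x \<bullet> (matrix_inv (metric F x) *v bt_cov F x) = 1"
    and n_unit: "x \<in> X \<Longrightarrow> n_cov F x \<bullet> (matrix_inv (metric F x) *v n_cov F x) = 1"
    and bt_orth_n: "x \<in> X \<Longrightarrow> bt_cov F x \<bullet> (matrix_inv (metric F x) *v n_cov F x) = 0"
    and norm_b: "x \<in> X \<Longrightarrow> 0 < c_of F x" "x \<in> X \<Longrightarrow> c_of F x < 1"
    and charge: "x \<in> X \<Longrightarrow> - 2 < g_of F x" "x \<in> X \<Longrightarrow> g_of F x < 2"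
begin

abbreviation "u x y \<equiv> bt_cov F x \<bullet> y"
abbreviation "v x y \<equiv> n_cov F x \<bullet> y"
abbreviation "c x \<equiv> c_of F x"
abbreviation "g x \<equiv> g_of F x"
abbreviation "eu x \<equiv> matrix_inv (metric F x) *v bt_cov F x"
abbreviation "ev x \<equiv> matrix_inv (metric F x) *v n_cov F x"

lemma metric_inverse:
  assumes "x \<in> X"
  shows "metric F x ** matrix_inv (metric F x) = mat 1" 
proof -
  have "metric F x *v w = 0 \<Longrightarrow> w = 0" for w
    using metric_pos[OF assms, of w] by force
  then have "invertible (metric F x)"
    using matrix_left_invertible_ker[of "metric F x"] invertible_left_inverse[of "metric F x"] by blast
  then show ?thesis by (rule matrix_inv_invertible(1))
qed

lemma metric_dual:
  assumes "x \<in> X"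
  shows "metric F x *v eu x = bt_cov F x" "metric F x *v ev x = n_cov F x"
  using metric_inverse[OF assms] by (simp_all add: matrix_vector_mul_assoc)

lemma dual_frame: 
  assumes "x \<in> X"
  shows "u x (eu x) = 1" "v x (ev x) = 1" "u x (ev x) = 0" "v x (eu x) = 0"
proof -
  show "u x (eu x) = 1" "v x (ev x) = 1" "u x (ev x) = 0"
    using bt_unit n_unit bt_orth_n assms by auto
  have "v x (eu x) = (metric F x *v ev x) \<bullet> eu x" using metric_dual[OF assms] by simp
  also have "\<dots> = ev x \<bullet> (metric F x *v eu x)"
    using metric_sym[OF assms] by (metis dot_lmul_matrix transpose_matrix_vector)
  also have "\<dots> = 0" using metric_dual[OF assms] bt_orth_n[OF assms] by (simp add: inner_commute)
  finally show "v x (eu x) = 0" .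
qed

text \<open>Duality says that the matrix with rows \<open>b~\<close>, \<open>n\<close> has the matrix with columns \<open>eu\<close>, \<open>ev\<close> as a right
  inverse, hence as a left inverse.\<close>

lemma frame_expansion:
  assumes "x \<in> X"
  shows "y = u x y *\<^sub>R eu x + v x y *\<^sub>R ev x"
proof -
  define M :: "real^2^2" where "M = (\<chi> i j. if i = 1 then bt_cov F x $ j else n_cov F x $ j)"
  define P :: "real^2^2" where "P = (\<chi> i j. if j = 1 then eu x $ i else ev x $ i)"
  have "M ** P = mat 1"
    using dual_frame[OF assms]
    by (simp add: vec_eq_iff forall_2 matrix_matrix_mult_def sum_2 mat_def M_def P_def inner_vec_def)
  then have "P ** M = mat 1" by (simp add: matrix_left_right_inverse)
  then have "y = P *v (M *v y)" by (simp add: matrix_vector_mul_assoc)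
  also have "\<dots> = u x y *\<^sub>R eu x + v x y *\<^sub>R ev x"
    by (simp add: vec_eq_iff forall_2 matrix_vector_mult_def sum_2 M_def P_def inner_vec_def algebra_simps)
  finally show ?thesis .
qed

lemma uv_eqI: "x \<in> X \<Longrightarrow> u x y = u x z \<Longrightarrow> v x y = v x z \<Longrightarrow> y = z"
  using frame_expansion by metis

lemma uv_pos:
  assumes "x \<in> X" "y \<noteq> 0"
  shows "(u x y)\<^sup>2 + (v x y)\<^sup>2 > 0"
  using uv_eqI[OF assms(1), of y 0] assms(2) by (auto simp: sum_power2_gt_zero_iff)

lemma metric_quadratic:
  assumes "x \<in> X"
  shows "y \<bullet> (metric F x *v y) = (u x y)\<^sup>2 + (v x y)\<^sup>2"
proof -
  have "metric F x *v y = u x y *\<^sub>R bt_cov F x + v x y *\<^sub>R n_cov F x"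
    by (subst frame_expansion[OF assms, of y])
      (simp add: matrix_vector_right_distrib matrix_vector_mult_scaleR metric_dual[OF assms])
  then show ?thesis by (simp add: inner_add_right inner_commute power2_eq_square)
qed

lemma b_eq: "b_val F x y = c x * u x y" by (simp add: b_val_def b_cov_def)

lemma one_minus_c2: "x \<in> X \<Longrightarrow> 0 < 1 - (c x)\<^sup>2" 
  using norm_b[of x] by (simp add: power_less_one_iff)

lemma q_eq: "x \<in> X \<Longrightarrow> q_val F x y = sqrt ((1 - (c x)\<^sup>2) * (u x y)\<^sup>2 + (v x y)\<^sup>2)"
  by (simp add: q_val_def S_val_def metric_quadratic b_eq power_mult_distrib algebra_simps)

lemma q_radicand_pos: "x \<in> X \<Longrightarrow> y \<noteq> 0 \<Longrightarrow> 0 < (1 - (c x)\<^sup>2) * (u x y)\<^sup>2 + (v x y)\<^sup>2"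
  by (intro spatial_form_pos norm_b uv_pos)

lemma q_spatial_norm: "x \<in> X \<Longrightarrow> q_val F x y = spatial_norm (c x) (u x y) (v x y)"
  by (simp add: q_eq spatial_norm_def)

lemma q_pos: "x \<in> X \<Longrightarrow> y \<noteq> 0 \<Longrightarrow> q_val F x y > 0"
  using q_radicand_pos by (simp add: q_eq)

lemma q_sq: "x \<in> X \<Longrightarrow> (q_val F x y)\<^sup>2 = (1 - (c x)\<^sup>2) * (u x y)\<^sup>2 + (v x y)\<^sup>2"
  using one_minus_c2[of x] by (simp add: q_eq)

lemma B_pos: "x \<in> X \<Longrightarrow> y \<noteq> 0 \<Longrightarrow> B_val F x y > 0"
  unfolding B_val_def by (intro metric_form_pos q_pos charge)

lemma nu_pos: "x \<in> X \<Longrightarrow> y \<noteq> 0 \<Longrightarrow> nu_val F x y > 0"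
  unfolding nu_val_def b_eq q_spatial_norm by (intro nu_form_pos norm_b charge uv_pos)

lemma K_eq:
  assumes "x \<in> X" "y \<noteq> 0"
  shows "K_val F x y = metric_fun (g x) (b_val F x y) (q_val F x y)"
proof -
  let ?b = "b_val F x y" and ?q = "q_val F x y"
  have q: "?q > 0" by (rule q_pos[OF assms])
  have h: "h_of F x > 0" "(h_of F x)\<^sup>2 = 1 - (g x)\<^sup>2 / 4"
    using charge_radicand_pos[OF charge[OF assms(1)]] by (simp_all add: h_of_def)
  have r: "(?b / ?q + g x / 2) / h_of F x = (?b + g x / 2 * ?q) / (h_of F x * ?q)"
    using q h by (simp add: field_simps)
  have "f_val F x y = pi / 2 - arctan ((?b + g x / 2 * ?q) / (h_of F x * ?q))"
  proof (cases "?b = 0")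
    case True
    then show ?thesis using q h by (simp add: f_val_def G_of_def mult.commute)
  next
    case False
    have "L_val F x y / (h_of F x * ?b) = (1 + g x / 2 * (?b / ?q)) / (h_of F x * (?b / ?q))"
      using q h False by (simp add: L_val_def field_simps)
    moreover have "?b / ?q > 0 \<longleftrightarrow> ?b > 0" "?b / ?q \<noteq> 0"
      using q False by (simp_all add: zero_less_divide_iff)
    moreover have "g x / (2 * h_of F x) = G_of F x / 2" by (simp add: G_of_def)
    ultimately have "arctan (L_val F x y / (h_of F x * ?b)) = (if ?b > 0 then pi / 2 else - pi / 2)
        - (arctan ((?b + g x / 2 * ?q) / (h_of F x * ?q)) - arctan (G_of F x / 2))"
      using arctan_cotangent[OF h, of "?b / ?q"] r by presburger
    then show ?thesis using False by (auto simp: f_val_def)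
  qed
  then show ?thesis by (simp add: K_val_def metric_fun_def B_val_def G_of_def h_of_def)
qed

lemma K_pos: "x \<in> X \<Longrightarrow> y \<noteq> 0 \<Longrightarrow> K_val F x y > 0"
  using B_pos by (simp add: K_val_def)

abbreviation "slit_bundle \<equiv> X \<times> (- {0::real^2})"

lemma open_slit_bundle: "open slit_bundle" by (intro open_Times open_X) auto

lemma smooth_fields_joint:
  assumes "open W" "W \<subseteq> X \<times> UNIV"
  shows "smooth_on W (\<lambda>p. c (fst p))" "smooth_on W (\<lambda>p. g (fst p))"
    "smooth_on W (\<lambda>p. u (fst p) (snd p))" "smooth_on W (\<lambda>p. v (fst p) (snd p))"
proof -
  have X: "fst p \<in> X" if "p \<in> W" for p using assms(2) that by auto
  have fs: "smooth_on W fst" "smooth_on W snd"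
    using smooth_on_bounded_linear[OF bounded_linear_fst assms(1)]
      smooth_on_bounded_linear[OF bounded_linear_snd assms(1)] by auto
  note comp = smooth_on_compose[OF assms(1) open_X X fs(1)]
  show "smooth_on W (\<lambda>p. c (fst p))" "smooth_on W (\<lambda>p. g (fst p))"
    by (rule comp[OF _ smooth_fields(3)] comp[OF _ smooth_fields(4)], assumption)+
  show "smooth_on W (\<lambda>p. u (fst p) (snd p))" 
    by (rule smooth_on_inner[OF assms(1) comp[OF _ smooth_fields(1)] fs(2)])
  show "smooth_on W (\<lambda>p. v (fst p) (snd p))"
    by (rule smooth_on_inner[OF assms(1) comp[OF _ smooth_fields(2)] fs(2)])
qed

lemma smooth_q: "smooth_on slit_bundle (\<lambda>p. q_val F (fst p) (snd p))"
proof -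
  have "smooth_on slit_bundle (\<lambda>p. sqrt ((1 - (c (fst p))\<^sup>2) * (u (fst p) (snd p))\<^sup>2 + (v (fst p) (snd p))\<^sup>2))"
    by (intro smooth_intros smooth_fields_joint open_slit_bundle) (use q_radicand_pos in \<open>force simp: mem_Times_iff\<close>)+
  then show ?thesis
    by (rule smooth_on_cong[OF open_slit_bundle, rotated]) (auto simp: q_eq)
qed

lemma smooth_b: "smooth_on slit_bundle (\<lambda>p. b_val F (fst p) (snd p))"
  unfolding b_eq by (intro smooth_intros smooth_fields_joint open_slit_bundle) auto

lemma smooth_B: "smooth_on slit_bundle (\<lambda>p. B_val F (fst p) (snd p))"
  unfolding B_val_def by (intro smooth_intros smooth_fields_joint smooth_b smooth_q open_slit_bundle) auto

lemma smooth_K: "smooth_on slit_bundle (\<lambda>p. K_val F (fst p) (snd p))"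
proof -
  have h: "0 < 1 - (g x)\<^sup>2 / 4" if "x \<in> X" for x using charge_radicand_pos charge that by blast
  have "smooth_on slit_bundle (\<lambda>p. metric_fun (g (fst p)) (b_val F (fst p) (snd p)) (q_val F (fst p) (snd p)))"
    unfolding metric_fun_def
  proof (intro smooth_intros smooth_fields_joint smooth_b smooth_q open_slit_bundle)
    fix p assume p: "p \<in> slit_bundle"
    then have "0 < q_val F (fst p) (snd p)" "0 < sqrt (1 - (g (fst p))\<^sup>2 / 4)"
      using q_pos h by (auto simp: mem_Times_iff)
    then show "sqrt (1 - (g (fst p))\<^sup>2 / 4) * q_val F (fst p) (snd p) \<noteq> 0" by simp
    show "sqrt (1 - (g (fst p))\<^sup>2 / 4) \<noteq> 0" using h p by (force simp: mem_Times_iff)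
  qed (use h charge q_pos metric_form_pos in \<open>auto simp: mem_Times_iff\<close>)
  then show ?thesis
    by (rule smooth_on_cong[OF open_slit_bundle, rotated]) (use K_eq in force)
qed

lemma q_has_derivative:
  assumes "x \<in> X" "y \<noteq> 0"
  shows "(q_val F x has_derivative (\<lambda>w. ((1 - (c x)\<^sup>2) * u x y * u x w + v x y * v x w) / q_val F x y)) (at y)"
proof -
  have "((\<lambda>z. sqrt ((1 - (c x)\<^sup>2) * (u x z)\<^sup>2 + (v x z)\<^sup>2)) has_derivative
      (\<lambda>w. ((1 - (c x)\<^sup>2) * u x y * u x w + v x y * v x w) / sqrt ((1 - (c x)\<^sup>2) * (u x y)\<^sup>2 + (v x y)\<^sup>2))) (at y)"
    using q_radicand_pos[OF assms]
    by (auto intro!: derivative_eq_intros simp: fun_eq_iff field_simps)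
  then show ?thesis using q_eq[OF assms(1)] by presburger
qed

lemma b_has_derivative: "(b_val F x has_derivative (\<lambda>w. c x * u x w)) (at y)"
  unfolding b_eq by (auto intro!: derivative_eq_intros)

lemma B_has_derivative:
  assumes "x \<in> X" "y \<noteq> 0"
  shows "(B_val F x has_derivative (\<lambda>w. 2 * b_val F x y * (c x * u x w)
    + g x * (c x * u x w * q_val F x y + b_val F x y * (((1 - (c x)\<^sup>2) * u x y * u x w + v x y * v x w) / q_val F x y))
    + 2 * ((1 - (c x)\<^sup>2) * u x y * u x w + v x y * v x w))) (at y)"
  unfolding B_val_def using q_pos[OF assms]
  by (auto intro!: derivative_eq_intros b_has_derivative q_has_derivative assms simp: fun_eq_iff field_simps)

text \<open>The coefficients of \<open>dK = K_u du + K_v dv\<close>.\<close>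

definition K_u where "K_u x y = K_val F x y / B_val F x y * (u x y + g x * c x * q_val F x y)"
definition K_v where "K_v x y = K_val F x y / B_val F x y * v x y"

lemma K_has_derivative:
  assumes "x \<in> X" "y \<noteq> 0"
  shows "(K_val F x has_derivative (\<lambda>w. K_u x y * u x w + K_v x y * v x w)) (at y)"
proof -
  have "((\<lambda>z. metric_fun (g x) (b_val F x z) (q_val F x z)) has_derivative
    (\<lambda>w. metric_fun (g x) (b_val F x y) (q_val F x y) / ((b_val F x y)\<^sup>2 + g x * b_val F x y * q_val F x y + (q_val F x y)\<^sup>2)
      * (q_val F x y * (((1 - (c x)\<^sup>2) * u x y * u x w + v x y * v x w) / q_val F x y)
          + (b_val F x y + g x * q_val F x y) * (c x * u x w)))) (at y)"
    by (intro has_derivative_metric_fun charge q_pos b_has_derivative q_has_derivative assms)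
  then have "(K_val F x has_derivative
    (\<lambda>w. metric_fun (g x) (b_val F x y) (q_val F x y) / ((b_val F x y)\<^sup>2 + g x * b_val F x y * q_val F x y + (q_val F x y)\<^sup>2)
      * (q_val F x y * (((1 - (c x)\<^sup>2) * u x y * u x w + v x y * v x w) / q_val F x y)
          + (b_val F x y + g x * q_val F x y) * (c x * u x w)))) (at y)"
    by (rule has_derivative_transform_within_open[where s="- {0}"]) (use assms K_eq in auto)
  note d = this[unfolded K_eq[OF assms, symmetric] B_val_def[symmetric]]
  show ?thesis
  proof (rule has_derivative_eq_rhs[OF d], rule ext)
    fix w
    have gen: "M * (r * a + s * d) = M * r * a + M * s * d" for M r a s d :: real by (simp add: algebra_simps)
    have j: "q_val F x y * (((1 - (c x)\<^sup>2) * u x y * u x w + v x y * v x w) / q_val F x y)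
          + (b_val F x y + g x * q_val F x y) * (c x * u x w)
        = (u x y + g x * c x * q_val F x y) * u x w + v x y * v x w"
    proof -
      have e: "q_val F x y * (Z / q_val F x y) = Z" for Z using q_pos[OF assms] by simp
      show ?thesis unfolding e by (simp add: b_eq algebra_simps power2_eq_square)
    qed
    show "K_val F x y / B_val F x y * (q_val F x y * (((1 - (c x)\<^sup>2) * u x y * u x w + v x y * v x w) / q_val F x y)
          + (b_val F x y + g x * q_val F x y) * (c x * u x w)) = K_u x y * u x w + K_v x y * v x w"
      unfolding j gen K_u_def K_v_def by (rule refl)
  qed
qed

abbreviation "dens x y \<equiv> angle_density (c x) (g x) (u x y) (v x y)"

lemma dens_eq: "x \<in> X \<Longrightarrow> dens x y = sqrt (nu_val F x y / q_val F x y) / B_val F x y"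
  by (simp add: angle_density_def nu_val_def B_val_def b_eq q_spatial_norm)

lemma dens_pos: "x \<in> X \<Longrightarrow> y \<noteq> 0 \<Longrightarrow> dens x y > 0"
  by (intro angle_density_pos norm_b charge uv_pos)

lemma smooth_dens: "smooth_on slit_bundle (\<lambda>p. dens (fst p) (snd p))"
  by (intro smooth_on_angle_density smooth_fields_joint open_slit_bundle norm_b charge uv_pos) auto

lemma dens_sq: "x \<in> X \<Longrightarrow> y \<noteq> 0 \<Longrightarrow> (dens x y)\<^sup>2 = nu_val F x y / (q_val F x y * (B_val F x y)\<^sup>2)"
  using nu_pos q_pos by (simp add: dens_eq power_divide less_imp_le)

text \<open>The decisive computation: after clearing denominators both identities are polynomial in \<open>u, v, q, c, g\<close>
  modulo \<open>q\<^sup>2 = (1 - c\<^sup>2) u\<^sup>2 + v\<^sup>2\<close>. They say that the Hessian of \<open>K\<close> has rank one and is proportional to the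
  square of \<open>u dv - v du\<close>, with precisely the factor \<open>\<nu>\<close> that enters \<open>T\<close>.\<close>

lemma K_uv_has_derivative:
  assumes "x \<in> X" "y \<noteq> 0"
  shows "(K_u x has_derivative (\<lambda>w. - (K_val F x y * (dens x y)\<^sup>2 * v x y * (u x y * v x w - v x y * u x w)))) (at y)"
    and "(K_v x has_derivative (\<lambda>w. K_val F x y * (dens x y)\<^sup>2 * u x y * (u x y * v x w - v x y * u x w))) (at y)"
proof -
  let ?K = "K_val F x y" and ?B = "B_val F x y" and ?q = "q_val F x y" and ?b = "b_val F x y"
  let ?Q = "\<lambda>w. (1 - (c x)\<^sup>2) * u x y * u x w + v x y * v x w"
  let ?r = "u x y + g x * c x * ?q"
  let ?DB = "\<lambda>w. 2 * ?b * (c x * u x w) + g x * (c x * u x w * ?q + ?b * (?Q w / ?q)) + 2 * ?Q w"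
  let ?DK = "\<lambda>w. ?K / ?B * ?r * u x w + ?K / ?B * v x y * v x w"
  have pos: "?q > 0" "?B > 0" using q_pos B_pos assms by auto
  have Bq: "?B = (c x * u x y)\<^sup>2 + g x * (c x * u x y) * ?q + ?q\<^sup>2" by (simp add: B_val_def b_eq)
  have nq: "nu_val F x y = ?q + (1 - (c x)\<^sup>2) * g x * (c x * u x y)" by (simp add: nu_val_def b_eq)
  have q2: "?q * ?q = (1 - c x * c x) * (u x y * u x y) + v x y * v x y"
    using q_sq[OF assms(1), of y] by (simp add: power2_eq_square)
  have qDB: "?q * ?DB w = ?q * (2 * ?b * (c x * u x w) + g x * (c x * u x w * ?q)) + (g x * ?b + 2 * ?q) * ?Q w" for w
    using pos by (simp add: field_simps)
  have KB: "((\<lambda>z. K_val F x z / B_val F x z) has_derivative (\<lambda>w. (?DK w * ?B - ?K * ?DB w) / (?B * ?B))) (at y)"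
    using has_derivative_divide'[OF K_has_derivative[OF assms] B_has_derivative[OF assms]] pos
    by (simp only: K_u_def K_v_def)
  have dr: "((\<lambda>z. u x z + g x * c x * q_val F x z) has_derivative (\<lambda>w. (?q * u x w + g x * c x * ?Q w) / ?q)) (at y)"
    using pos by (auto intro!: derivative_eq_intros q_has_derivative assms simp: fun_eq_iff field_simps)
  have dv: "(v x has_derivative (\<lambda>w. ?q * v x w / ?q)) (at y)"
    using pos by (auto intro!: derivative_eq_intros)
  have quot: "?K / ?B * (N / ?q) + (?DK w * ?B - ?K * ?DB w) / (?B * ?B) * s
      = ?K / (?q * ?B\<^sup>2) * (N * ?B + (?q * (?r * u x w + v x y * v x w) - ?q * ?DB w) * s)" for N s w
  proof -
    have "K / B * (N / q) + ((K / B * r * a + K / B * e * d) * B - K * D) / (B * B) * s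
      = K / (q * B\<^sup>2) * (N * B + (q * (r * a + e * d) - q * D) * s)" if "q > 0" "B > 0" for K B q r a e d D :: real
      using that by (simp add: field_simps power2_eq_square)
    then show ?thesis using pos by blast
  qed
  show "(K_u x has_derivative (\<lambda>w. - (?K * (dens x y)\<^sup>2 * v x y * (u x y * v x w - v x y * u x w)))) (at y)"
    unfolding K_u_def[abs_def]
  proof (rule has_derivative_eq_rhs[OF has_derivative_mult[OF KB dr]], rule ext)
    fix w
    have "(?q * u x w + g x * c x * ?Q w) * ?B + (?q * (?r * u x w + v x y * v x w) - ?q * ?DB w) * ?r
        = - (nu_val F x y * v x y * (u x y * v x w - v x y * u x w))"
      unfolding qDB unfolding Bq nq b_eq power2_eq_square using q2 by algebra
    then show "?K / ?B * ((?q * u x w + g x * c x * ?Q w) / ?q) + (?DK w * ?B - ?K * ?DB w) / (?B * ?B) * ?r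
      = - (?K * (dens x y)\<^sup>2 * v x y * (u x y * v x w - v x y * u x w))"
      unfolding quot dens_sq[OF assms] by simp
  qed
  show "(K_v x has_derivative (\<lambda>w. ?K * (dens x y)\<^sup>2 * u x y * (u x y * v x w - v x y * u x w))) (at y)"
    unfolding K_v_def[abs_def]
  proof (rule has_derivative_eq_rhs[OF has_derivative_mult[OF KB dv]], rule ext)
    fix w
    have "?q * v x w * ?B + (?q * (?r * u x w + v x y * v x w) - ?q * ?DB w) * v x y
        = nu_val F x y * u x y * (u x y * v x w - v x y * u x w)"
      unfolding qDB unfolding Bq nq b_eq power2_eq_square using q2 by algebra
    then show "?K / ?B * (?q * v x w / ?q) + (?DK w * ?B - ?K * ?DB w) / (?B * ?B) * v x y
      = ?K * (dens x y)\<^sup>2 * u x y * (u x y * v x w - v x y * u x w)"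
      unfolding quot dens_sq[OF assms] by simp
  qed
qed

end

section \<open>The angle as a function of the polar angle\<close>

definition angle_speed :: "real \<Rightarrow> real \<Rightarrow> real \<Rightarrow> real" where
  "angle_speed c g t = angle_density c g (cos t) (sin t)"

text \<open>The integral of the speed from \<open>0\<close> to \<open>t\<close>, rescaled to the unit interval. In this form it makes
  sense for \<open>t\<close> of either sign and the upper limit becomes one more parameter of the integrand.\<close>

definition angle_primitive :: "real \<Rightarrow> real \<Rightarrow> real \<Rightarrow> real" where
  "angle_primitive c g t = t * integral {0..1} (\<lambda>s. angle_speed c g (t * s))"

lemma smooth_on_angle_primitive:
  fixes a :: "'a::euclidean_space \<Rightarrow> real"
  assumes "open W" "smooth_on W c" "smooth_on W g" "smooth_on W a"
    and "\<And>p. p \<in> W \<Longrightarrow> 0 < c p" "\<And>p. p \<in> W \<Longrightarrow> c p < 1" "\<And>p. p \<in> W \<Longrightarrow> - 2 < g p" "\<And>p. p \<in> W \<Longrightarrow> g p < 2"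
  shows "smooth_on W (\<lambda>p. angle_primitive (c p) (g p) (a p))"
proof -
  have o: "open (W \<times> (UNIV :: real set))" using assms(1) by (intro open_Times) auto
  have fs: "smooth_on (W \<times> (UNIV :: real set)) fst" "smooth_on (W \<times> (UNIV :: real set)) snd"
    using smooth_on_bounded_linear[OF bounded_linear_fst o] smooth_on_bounded_linear[OF bounded_linear_snd o] by auto
  have comp: "smooth_on (W \<times> (UNIV :: real set)) (\<lambda>p. f (fst p))" if "smooth_on W f" for f :: "'a \<Rightarrow> real"
    by (rule smooth_on_compose[OF o assms(1) _ fs(1) that]) auto
  have "smooth_on (W \<times> UNIV) (\<lambda>p. angle_speed (c (fst p)) (g (fst p)) (a (fst p) * snd p))"
    unfolding angle_speed_def
    by (intro smooth_on_angle_density smooth_on_cos smooth_on_sin smooth_on_mult comp assms fs o) auto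
  from smooth_on_parameter_integral[OF assms(1) this]
  show ?thesis unfolding angle_primitive_def by (intro smooth_on_mult assms) auto
qed

locale finsleroid_parameters =
  fixes c g :: real
  assumes c: "0 < c" "c < 1" and g: "- 2 < g" "g < 2"
begin

lemma speed_pos: "0 < angle_speed c g t"
  unfolding angle_speed_def by (intro angle_density_pos c g) simp

lemma speed_cont: "continuous_on UNIV (angle_speed c g)"
  unfolding angle_speed_def
  by (intro smooth_on_imp_continuous_on smooth_on_angle_density smooth_on_cos smooth_on_sin smooth_on_id smooth_on_const) (use c g in auto)

text \<open>The rescaled integral is \<open>P t - P 0\<close> for any antiderivative \<open>P\<close> of the speed on the whole line.\<close>

lemma primitive_deriv: "(angle_primitive c g has_real_derivative angle_speed c g t) (at t)"
proof -
  let ?J = "angle_speed c g"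
  have isc: "isCont ?J t" for t
    using speed_cont by (simp add: continuous_on_eq_continuous_at)
  obtain P where P: "\<And>t. (P has_vector_derivative ?J t) (at t)"
    using einterval_antiderivative[of "-\<infinity>" "\<infinity>" ?J] isc by auto
  have "angle_primitive c g t = P t - P 0" for t
  proof -
    have "((\<lambda>s. P (t * s)) has_vector_derivative t * ?J (t * s)) (at s within {0..1})" for s
    proof -
      have "((\<lambda>s. P (t * s)) has_real_derivative ?J (t * s) * t) (at s)"
        using P[of "t * s"] by (intro DERIV_chain2[of P]) (auto intro!: derivative_eq_intros simp: has_real_derivative_iff_has_vector_derivative)
      then show ?thesis
        by (simp add: has_real_derivative_iff_has_vector_derivative mult.commute has_vector_derivative_at_within)
    qed
    then have "((\<lambda>s. t * ?J (t * s)) has_integral P (t * 1) - P (t * 0)) {0..1}"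
      by (intro fundamental_theorem_of_calculus) auto
    then show ?thesis by (simp add: angle_primitive_def integral_unique flip: integral_mult_right)
  qed
  then have "angle_primitive c g = (\<lambda>t. P t - P 0)" by auto
  then show ?thesis
    using P[of t] by (auto intro!: derivative_eq_intros simp: has_real_derivative_iff_has_vector_derivative)
qed

lemma primitive_0 [simp]: "angle_primitive c g 0 = 0" by (simp add: angle_primitive_def)

lemma primitive_strict_mono: "s < t \<Longrightarrow> angle_primitive c g s < angle_primitive c g t"
  using DERIV_pos_imp_increasing[of s t "angle_primitive c g"] primitive_deriv speed_pos by blast

lemma isCont_primitive: "isCont (angle_primitive c g) t"
  by (rule DERIV_isCont[OF primitive_deriv])

lemma primitive_period: "angle_primitive c g (t + 2 * pi) = angle_primitive c g t + angle_primitive c g (2 * pi)"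
proof -
  have "((\<lambda>t. angle_primitive c g (t + 2 * pi) - angle_primitive c g t) has_real_derivative 0) (at t)" for t
    by (rule derivative_eq_intros DERIV_chain2[OF primitive_deriv] primitive_deriv refl)+ (simp add: angle_speed_def)
  then have "angle_primitive c g (t + 2 * pi) - angle_primitive c g t = angle_primitive c g (0 + 2 * pi) - angle_primitive c g 0"
    by (intro DERIV_isconst_all) auto
  then show ?thesis by simp
qed

text \<open>Reflection \<open>v \<mapsto> - v\<close> leaves the speed unchanged.\<close>

lemma primitive_2pi: "angle_primitive c g (2 * pi) = 2 * angle_primitive c g pi"
proof -
  have J: "angle_speed c g (pi + t) = angle_speed c g (pi - t)" for t
    by (simp add: angle_speed_def angle_density_def spatial_norm_def)
  have "((\<lambda>t. angle_primitive c g (pi + t) + angle_primitive c g (pi - t)) has_real_derivative 0) (at t)" for t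
    by (rule derivative_eq_intros DERIV_chain2[OF primitive_deriv] primitive_deriv refl)+ (simp add: J)
  then have "angle_primitive c g (pi + pi) + angle_primitive c g (pi - pi) = angle_primitive c g (pi + 0) + angle_primitive c g (pi - 0)"
    by (intro DERIV_isconst_all) auto
  then show ?thesis by simp
qed

text \<open>Reflection \<open>u \<mapsto> - u\<close> changes the sign of \<open>g\<close>. This relates the two integrals \<open>\<theta>I\<close> and \<open>\<theta>II\<close>, which
  differ by that sign.\<close>

lemma primitive_pi: "angle_primitive c g pi = angle_primitive c g (pi / 2) + angle_primitive c (- g) (pi / 2)"
proof -
  interpret neg: finsleroid_parameters c "- g" using c g by unfold_locales auto
  have J: "angle_speed c g (pi - t) = angle_speed c (- g) t" for t
    by (simp add: angle_speed_def angle_density_def spatial_norm_def)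
  have "((\<lambda>t. angle_primitive c g (pi - t) + angle_primitive c (- g) t) has_real_derivative 0) (at t)" for t
    by (rule derivative_eq_intros DERIV_chain2[OF primitive_deriv] primitive_deriv neg.primitive_deriv refl)+ (simp add: J)
  then have "angle_primitive c g (pi - 0) + angle_primitive c (- g) 0 = angle_primitive c g (pi - pi / 2) + angle_primitive c (- g) (pi / 2)"
    by (intro DERIV_isconst_all) auto
  then show ?thesis by simp
qed

text \<open>The substitution \<open>s = n/b = tan t / c\<close> turns the quarter of a period into the half line; under it
  \<open>q = c w\<close> on the line \<open>u = 1\<close>. The scaling of the density accounts for the distance of that line
  from the unit circle.\<close>

lemma quarter_integral:
  defines "w \<equiv> \<lambda>s. sqrt (s\<^sup>2 + (1 - c\<^sup>2) / c\<^sup>2)"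
  shows "integral {0..} (\<lambda>s. sqrt (1 + (1 - c\<^sup>2) * g / w s) / (1 + g * w s + (w s)\<^sup>2)) = c * angle_primitive c g (pi / 2)"
proof -
  let ?f = "\<lambda>s. sqrt (1 + (1 - c\<^sup>2) * g / w s) / (1 + g * w s + (w s)\<^sup>2)"
  let ?F = "\<lambda>s. c * angle_primitive c g (arctan (c * s))"
  have wpos: "w s > 0" for s
    using c by (simp add: w_def add_nonneg_pos power_less_one_iff)
  have q: "spatial_norm c 1 (c * s) = c * w s" for s
  proof -
    have "(1 - c\<^sup>2) * 1\<^sup>2 + (c * s)\<^sup>2 = c\<^sup>2 * (s\<^sup>2 + (1 - c\<^sup>2) / c\<^sup>2)"
      using c by (simp add: field_simps power2_eq_square)
    then show ?thesis using c by (simp add: spatial_norm_def w_def real_sqrt_mult)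
  qed
  have dens: "angle_density c g 1 (c * s) = ?f s / c\<^sup>2" for s
  proof -
    have 1: "(c * w + (1 - c\<^sup>2) * g * (c * 1)) / (c * w) = 1 + (1 - c\<^sup>2) * g / w" if "w > 0" for w
      using that c by (simp add: field_simps)
    have 2: "(c * 1)\<^sup>2 + g * (c * 1) * (c * w) + (c * w)\<^sup>2 = (1 + g * w + w\<^sup>2) * c\<^sup>2" for w
      by (simp add: power2_eq_square algebra_simps)
    show ?thesis unfolding angle_density_def q 1[OF wpos] 2 by simp
  qed
  have speed: "angle_speed c g (arctan (c * s)) * (c / (1 + (c * s)\<^sup>2)) = ?f s / c" for s
  proof -
    define r where "r = 1 / sqrt (1 + (c * s)\<^sup>2)"
    have p: "1 + (c * s)\<^sup>2 > 0" by (simp add: add_pos_nonneg)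
    have r: "r > 0" "r\<^sup>2 = 1 / (1 + (c * s)\<^sup>2)" using p by (simp_all add: r_def power_divide)
    have "angle_speed c g (arctan (c * s)) = angle_density c g (r * 1) (r * (c * s))"
      by (simp add: angle_speed_def cos_arctan sin_arctan r_def)
    also have "\<dots> = ?f s / c\<^sup>2 * (1 + (c * s)\<^sup>2)"
      unfolding angle_density_scale[OF r(1)] dens r(2) by simp
    finally show ?thesis using p c by (simp add: power2_eq_square)
  qed
  have dF: "(?F has_real_derivative ?f s) (at s)" for s
  proof -
    have "((\<lambda>s. arctan (c * s)) has_real_derivative c / (1 + (c * s)\<^sup>2)) (at s)"
      by (auto intro!: derivative_eq_intros simp: field_simps)
    from DERIV_cmult[OF DERIV_chain2[OF primitive_deriv this], of c]
    show ?thesis unfolding speed using c by simp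
  qed
  have fpos: "?f s > 0" for s
  proof -
    have "0 < ?f s / c\<^sup>2" unfolding dens[symmetric] by (intro angle_density_pos c g) (simp add: add_pos_nonneg)
    moreover have "0 < Y" if "0 < Y / c\<^sup>2" for Y using that c by (simp add: zero_less_divide_iff)
    ultimately show ?thesis by blast
  qed
  have fcont: "isCont ?f s" for s
  proof -
    have "1 + g * w s + (w s)\<^sup>2 \<noteq> 0" using fpos[of s] by force
    then show ?thesis using wpos[of s] unfolding w_def
      by (intro continuous_intros) auto
  qed
  have lim: "((\<lambda>s. ?F s) \<longlongrightarrow> c * angle_primitive c g (pi / 2)) at_top"
  proof -
    have "filterlim (\<lambda>s. c * s) at_top at_top"
      using c filterlim_tendsto_pos_mult_at_top[OF tendsto_const _ filterlim_ident] by blast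
    from tendsto_compose[OF isCont_primitive[of "pi / 2", unfolded isCont_def] filterlim_compose[OF tendsto_arctan_at_top this]]
    show ?thesis by (intro tendsto_mult_left)
  qed
  have lim0: "(?F \<longlongrightarrow> 0) (at_right 0)"
  proof -
    have "isCont ?F 0" by (rule DERIV_isCont[OF dF])
    then have "(?F \<longlongrightarrow> ?F 0) (at 0)" by (simp add: isCont_def)
    then show ?thesis by (simp add: filterlim_at_split)
  qed
  have FTC: "set_integrable lborel (einterval 0 \<infinity>) ?f" "(LBINT s=0..\<infinity>. ?f s) = c * angle_primitive c g (pi / 2) - 0"
  proof -
    have A: "((?F \<circ> real_of_ereal) \<longlongrightarrow> 0) (at_right 0)"
      using lim0 by (simp add: zero_ereal_def ereal_tendsto_simps1)
    have B: "((?F \<circ> real_of_ereal) \<longlongrightarrow> c * angle_primitive c g (pi / 2)) (at_left \<infinity>)"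
      using lim by (simp add: ereal_tendsto_simps1)
    have nn: "AE x in lborel. 0 < ereal x \<longrightarrow> ereal x < \<infinity> \<longrightarrow> 0 \<le> ?f x"
      using fpos by (auto intro: less_imp_le)
    show "set_integrable lborel (einterval 0 \<infinity>) ?f" "(LBINT s=0..\<infinity>. ?f s) = c * angle_primitive c g (pi / 2) - 0"
      by (rule interval_integral_FTC_nonneg[OF _ dF fcont nn A B]; simp)+
  qed
  have "integral {0<..} ?f = (LBINT s=0..\<infinity>. ?f s)"
  proof -
    have e: "einterval 0 \<infinity> = {0::real<..}" by (auto simp: einterval_def)
    show ?thesis
      using set_borel_integral_eq_integral(2)[OF FTC(1)]
      by (simp add: interval_lebesgue_integral_def e)
  qed
  moreover have "integral {0..} ?f = integral {0<..} ?f"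
  proof (rule integral_spike_set)
    have "{x \<in> {0..} - {0<..}. ?f x \<noteq> 0} \<subseteq> {0}" by auto
    then show "negligible {x \<in> {0..} - {0<..}. ?f x \<noteq> 0}" by (rule negligible_subset[OF negligible_sing])
    have "{x \<in> {0<..} - {0..}. ?f x \<noteq> 0} = {}" by auto
    then show "negligible {x \<in> {0<..} - {0..}. ?f x \<noteq> 0}" by (simp only: negligible_empty)
  qed
  ultimately show ?thesis using FTC(2) by simp
qed

end

lemma theta_max_eq:
  assumes "0 < c_of F x" "c_of F x < 1" "- 2 < g_of F x" "g_of F x < 2"
  shows "theta_max F x = angle_primitive (c_of F x) (g_of F x) (2 * pi)"
proof -
  interpret p: finsleroid_parameters "c_of F x" "g_of F x" using assms by unfold_locales
  interpret n: finsleroid_parameters "c_of F x" "- g_of F x" using assms by unfold_locales auto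
  have "theta_I F x = angle_primitive (c_of F x) (g_of F x) (pi / 2)"
    unfolding theta_I_def w_of_def using p.quarter_integral assms by simp
  moreover have "theta_II F x = angle_primitive (c_of F x) (- g_of F x) (pi / 2)"
    unfolding theta_II_def w_of_def using n.quarter_integral assms by simp
  ultimately show ?thesis
    by (simp add: theta_max_def p.primitive_2pi p.primitive_pi)
qed

section \<open>Partial derivatives on slices\<close>

lemma smooth_on_slice:
  fixes f :: "'a::euclidean_space \<times> 'b::euclidean_space \<Rightarrow> 'c::real_normed_vector"
  assumes "open W" "smooth_on W f"
  shows "smooth_on {y. (x, y) \<in> W} (\<lambda>y. f (x, y))"
proof -
  have o: "open {y. (x, y) \<in> W}"
    using open_vimage[OF assms(1), of "Pair x"] by (simp add: vimage_def continuous_on_Pair)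
  show ?thesis
    by (rule smooth_on_compose[OF o assms(1) _ smooth_on_Pair[OF o smooth_on_const[OF o] smooth_on_id[OF o]] assms(2)]) auto
qed

lemma open_slice: "open W \<Longrightarrow> open {y. (x, y) \<in> W}"
  using open_vimage[of W "Pair x"] by (simp add: vimage_def continuous_on_Pair)

lemma open_slice': "open W \<Longrightarrow> open {x. (x, y) \<in> W}"
  using open_vimage[of W "\<lambda>x. (x, y)"] by (simp add: vimage_def continuous_on_Pair)

lemma pd_eqI: "(f has_derivative f') (at y) \<Longrightarrow> pd i f y = f' (axis i 1)"
  unfolding pd_def by (rule frechet_derivative_eqI)

lemma pd_cong_open: "open S \<Longrightarrow> x \<in> S \<Longrightarrow> (\<And>z. z \<in> S \<Longrightarrow> f z = g z) \<Longrightarrow> pd i f x = pd i g x"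
  unfolding pd_def using frechet_derivative_cong_open by metis

lemma smooth_on_pd: "smooth_on S f \<Longrightarrow> smooth_on S (pd i f)"
  using smooth_on_derivative[of S f "axis i 1"] by (simp add: pd_def[abs_def])

context finsleroid_chart
begin

section \<open>The fundamental tensor\<close>

lemma parameters: "x \<in> X \<Longrightarrow> finsleroid_parameters (c x) (g x)"
  by (simp add: finsleroid_parameters_def norm_b charge)

lemma pd_K: "x \<in> X \<Longrightarrow> y \<noteq> 0 \<Longrightarrow> pd i (K_val F x) y = K_u x y * bt_cov F x $ i + K_v x y * n_cov F x $ i"
  using pd_eqI[OF K_has_derivative] by (simp add: inner_axis)

text \<open>The covectors \<open>u dv - v du\<close> and \<open>dK\<close> on the fibre.\<close>

definition "rot_cov x y = u x y *\<^sub>R n_cov F x - v x y *\<^sub>R bt_cov F x"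
definition "l_cov x y = K_u x y *\<^sub>R bt_cov F x + K_v x y *\<^sub>R n_cov F x"

lemma pd_K_l: "x \<in> X \<Longrightarrow> y \<noteq> 0 \<Longrightarrow> pd i (K_val F x) y = l_cov x y $ i"
  by (simp add: pd_K l_cov_def)

text \<open>In terms of the angle this is \<open>K_ij = K \<theta>_i \<theta>_j\<close>.\<close>

lemma pd_pd_K:
  assumes "x \<in> X" "y \<noteq> 0"
  shows "pd j (pd i (K_val F x)) y = K_val F x y * (dens x y * rot_cov x y $ j) * (dens x y * rot_cov x y $ i)"
proof -
  have "pd j (pd i (K_val F x)) y = pd j (\<lambda>y. K_u x y * bt_cov F x $ i + K_v x y * n_cov F x $ i) y"
    by (rule pd_cong_open[of "- {0}"]) (use assms pd_K in auto)
  also have "\<dots> = - (K_val F x y * (dens x y)\<^sup>2 * v x y * (u x y * n_cov F x $ j - v x y * bt_cov F x $ j)) * bt_cov F x $ i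
      + K_val F x y * (dens x y)\<^sup>2 * u x y * (u x y * n_cov F x $ j - v x y * bt_cov F x $ j) * n_cov F x $ i"
    using pd_eqI[OF has_derivative_add[OF has_derivative_mult_left[OF K_uv_has_derivative(1)[OF assms]]
          has_derivative_mult_left[OF K_uv_has_derivative(2)[OF assms]]]]
    by (simp add: inner_axis)
  finally show ?thesis by (simp add: rot_cov_def power2_eq_square algebra_simps)
qed

text \<open>The factor \<open>1/c\<close> in \<open>T\<close> cancels the \<open>c\<close> in \<open>b n_i - n b_i = c (u n_i - v b~_i)\<close>.\<close>

lemma m_cov_eq: "x \<in> X \<Longrightarrow> y \<noteq> 0 \<Longrightarrow> m_cov F x y = (K_val F x y * dens x y) *\<^sub>R rot_cov x y"
proof -
  assume a: "x \<in> X" "y \<noteq> 0"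
  have "m_cov F x y = (1 / K_val F x y * T_val F x y * c x) *\<^sub>R rot_cov x y"
    by (simp add: m_cov_def rot_cov_def b_eq n_val_def b_cov_def scaleR_right_diff_distrib mult_ac)
  also have "1 / K_val F x y * T_val F x y * c x = K_val F x y * dens x y"
    unfolding T_val_def dens_eq[OF a(1)] using K_pos[OF a] norm_b(1)[OF a(1)] by (simp add: power2_eq_square)
  finally show ?thesis .
qed

lemma m_cov_inner: "x \<in> X \<Longrightarrow> y \<noteq> 0 \<Longrightarrow> (m_cov F x y \<bullet> w) / K_val F x y = dens x y * (u x y * v x w - v x y * u x w)"
  using K_pos[of x y] by (simp add: m_cov_eq rot_cov_def inner_diff_left)

lemma g_low_eq:
  assumes "x \<in> X" "y \<noteq> 0"
  shows "g_low F x y $ i $ j = l_cov x y $ i * l_cov x y $ j + m_cov F x y $ i * m_cov F x y $ j"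
proof -
  have 1: "pd j (\<lambda>z. (K_val F x z)\<^sup>2) z = 2 * K_val F x z * pd j (K_val F x) z" if "z \<noteq> 0" for z
    using pd_eqI[OF has_derivative_power[OF K_has_derivative[OF assms(1) that], of 2]] that
    by (simp add: pd_K assms(1) inner_axis)
  have sK: "smooth_on (- {0}) (K_val F x)"
    using smooth_on_slice[OF open_slit_bundle smooth_K, of x] assms(1) by (simp add: Compl_eq)
  have "pd i (pd j (\<lambda>z. (K_val F x z)\<^sup>2)) y = pd i (\<lambda>z. 2 * K_val F x z * pd j (K_val F x) z) y"
    by (rule pd_cong_open[of "- {0}"]) (use assms 1 in auto)
  also have "\<dots> = 2 * K_val F x y * pd i (pd j (K_val F x)) y + 2 * pd i (K_val F x) y * pd j (K_val F x) y"
  proof -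
    have "(K_val F x has_derivative frechet_derivative (K_val F x) (at y)) (at y)"
      "(pd j (K_val F x) has_derivative frechet_derivative (pd j (K_val F x)) (at y)) (at y)"
      using smooth_on_has_derivative[OF sK] smooth_on_has_derivative[OF smooth_on_pd[OF sK]] assms by auto
    from pd_eqI[OF has_derivative_mult[OF has_derivative_mult_right[OF this(1), of 2] this(2)], of i]
    show ?thesis by (simp add: pd_def)
  qed
  finally show ?thesis
    using assms by (simp add: g_low_def pd_K_l pd_pd_K m_cov_eq power2_eq_square)
qed

text \<open>Euler's relation for \<open>K\<close> in disguise: \<open>u K_u + v K_v = K\<close>.\<close>

lemma B_split: "x \<in> X \<Longrightarrow> B_val F x y = (u x y + g x * c x * q_val F x y) * u x y + (v x y)\<^sup>2"
proof -
  assume "x \<in> X"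
  from q_sq[OF this, of y] show ?thesis
    by (simp add: B_val_def b_eq algebra_simps power2_eq_square)
qed

lemma l_cov_radial: "x \<in> X \<Longrightarrow> y \<noteq> 0 \<Longrightarrow> l_cov x y \<bullet> y = K_val F x y"
proof -
  assume a: "x \<in> X" "y \<noteq> 0"
  have "l_cov x y \<bullet> y = K_val F x y / B_val F x y * ((u x y + g x * c x * q_val F x y) * u x y + (v x y)\<^sup>2)"
    unfolding l_cov_def K_u_def K_v_def inner_add_left inner_scaleR_left power2_eq_square by (simp only: algebra_simps)
  then show ?thesis unfolding B_split[OF a(1), symmetric] using B_pos[OF a] by simp
qed

lemma m_cov_radial: "x \<in> X \<Longrightarrow> y \<noteq> 0 \<Longrightarrow> m_cov F x y \<bullet> y = 0"
  by (simp add: m_cov_eq rot_cov_def inner_diff_left)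

lemma g_low_mult:
  assumes "x \<in> X" "y \<noteq> 0"
  shows "g_low F x y *v w = (l_cov x y \<bullet> w) *\<^sub>R l_cov x y + (m_cov F x y \<bullet> w) *\<^sub>R m_cov F x y"
  by (simp add: vec_eq_iff matrix_vector_mult_def g_low_eq[OF assms] inner_vec_def sum_2 algebra_simps)

lemma y_low_eq: "x \<in> X \<Longrightarrow> y \<noteq> 0 \<Longrightarrow> y_low F x y = K_val F x y *\<^sub>R l_cov x y"
  by (simp add: y_low_def g_low_mult l_cov_radial m_cov_radial)

text \<open>A vector in the kernel is annihilated by \<open>dK\<close> and by \<open>m\<close>. The determinant of these two covectors in
  the coordinates \<open>u, v\<close> is a positive multiple of \<open>B\<close>.\<close>

lemma invertible_g_low:
  assumes "x \<in> X" "y \<noteq> 0"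
  shows "invertible (g_low F x y)"
proof -
  have "w = 0" if "g_low F x y *v w = 0" for w
  proof -
    have "(l_cov x y \<bullet> w)\<^sup>2 + (m_cov F x y \<bullet> w)\<^sup>2 = (g_low F x y *v w) \<bullet> w"
      by (simp add: g_low_mult[OF assms] inner_add_left power2_eq_square)
    then have "l_cov x y \<bullet> w = 0" "m_cov F x y \<bullet> w = 0"
      using that by (simp_all add: sum_power2_eq_zero_iff)
    then have 1: "(u x y + g x * c x * q_val F x y) * u x w + v x y * v x w = 0" and 2: "u x y * v x w = v x y * u x w"
      using K_pos[OF assms] B_pos[OF assms] dens_pos[OF assms]
      by (simp_all add: l_cov_def K_u_def K_v_def inner_add_left m_cov_eq[OF assms] rot_cov_def inner_diff_left flip: distrib_left add_divide_distrib)
         (metis (no_types, opaque_lifting) distrib_left mult.assoc mult_eq_0_iff order_less_irrefl)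
    have "B_val F x y * u x w = 0" "B_val F x y * v x w = 0"
      unfolding B_split[OF assms(1)] power2_eq_square using 1 2 by algebra+
    then have "u x w = 0" "v x w = 0" using B_pos[OF assms] by auto
    then show "w = 0" using uv_eqI[OF assms(1), of w 0] by simp
  qed
  then show ?thesis
    using matrix_left_invertible_ker[of "g_low F x y"] invertible_left_inverse[of "g_low F x y"] by blast
qed

text \<open>The vector is determined by \<open>dK(m^i) = 0\<close> and \<open>m(m^i) = 1\<close>; an explicit formula makes smoothness in \<open>y\<close>
  visible.\<close>

lemma m_vec_eq:
  assumes "x \<in> X" "y \<noteq> 0"
  shows "m_vec F x y = (1 / (K_val F x y * dens x y * B_val F x y)) *\<^sub>R
    ((u x y + g x * c x * q_val F x y) *\<^sub>R ev x - v x y *\<^sub>R eu x)" (is "_ = ?m")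
proof -
  have pos: "K_val F x y > 0" "dens x y > 0" "B_val F x y > 0" using K_pos dens_pos B_pos assms by auto
  have uv: "u x ?m = - v x y / (K_val F x y * dens x y * B_val F x y)"
    "v x ?m = (u x y + g x * c x * q_val F x y) / (K_val F x y * dens x y * B_val F x y)"
    by (simp_all add: inner_diff_right dual_frame[OF assms(1)])
  have l: "l_cov x y \<bullet> ?m = 0"
    unfolding l_cov_def inner_add_left inner_scaleR_left uv by (simp add: K_u_def K_v_def)
  have wm: "rot_cov x y \<bullet> ?m = 1 / (K_val F x y * dens x y * B_val F x y) * ((u x y + g x * c x * q_val F x y) * u x y + (v x y)\<^sup>2)"
    unfolding rot_cov_def inner_diff_left inner_scaleR_left uv
    by (simp add: power2_eq_square diff_divide_distrib add_divide_distrib distrib_left distrib_right)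
  have m: "m_cov F x y \<bullet> ?m = 1"
    unfolding m_cov_eq[OF assms] inner_scaleR_left wm unfolding B_split[OF assms(1), symmetric] using pos by simp
  have "g_low F x y *v ?m = m_cov F x y" unfolding g_low_mult[OF assms] l m by simp
  then have "m_vec F x y = matrix_inv (g_low F x y) *v (g_low F x y *v ?m)" by (simp add: m_vec_def)
  also have "\<dots> = ?m"
    by (simp add: matrix_vector_mul_assoc matrix_inv_invertible(2)[OF invertible_g_low[OF assms]] del: matrix_vector_mult_diff_distrib)
  finally show ?thesis .
qed

lemma m_vec_inner:
  assumes "x \<in> X" "y \<noteq> 0"
  shows "l_cov x y \<bullet> m_vec F x y = 0" "m_cov F x y \<bullet> m_vec F x y = 1"
proof -
  have e: "g_low F x y *v m_vec F x y = m_cov F x y"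
    by (simp add: m_vec_def matrix_vector_mul_assoc matrix_inv_invertible(1)[OF invertible_g_low[OF assms]])
  have "y \<bullet> (g_low F x y *v m_vec F x y) = K_val F x y * (l_cov x y \<bullet> m_vec F x y)"
    using l_cov_radial[OF assms] m_cov_radial[OF assms]
    by (simp add: g_low_mult[OF assms] inner_add_right inner_commute)
  then show l: "l_cov x y \<bullet> m_vec F x y = 0"
    using e m_cov_radial[OF assms] K_pos[OF assms] by (simp add: inner_commute)
  have "(m_cov F x y \<bullet> m_vec F x y) *\<^sub>R m_cov F x y = m_cov F x y"
    using e l by (simp add: g_low_mult[OF assms])
  moreover have "m_cov F x y \<noteq> 0"
  proof
    assume "m_cov F x y = 0"
    then have "rot_cov x y = 0" using K_pos[OF assms] dens_pos[OF assms] by (simp add: m_cov_eq[OF assms])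
    then have "rot_cov x y \<bullet> eu x = 0" "rot_cov x y \<bullet> ev x = 0" by auto
    then show False using dual_frame[OF assms(1)] uv_pos[OF assms] by (simp add: rot_cov_def inner_diff_left)
  qed
  ultimately show "m_cov F x y \<bullet> m_vec F x y = 1"
    by (metis scaleR_cancel_right scaleR_one)
qed

lemma slice_slit_bundle: "x \<in> X \<Longrightarrow> {y. (x, y) \<in> slit_bundle} = - {0}" by auto

lemma fiber_smooth: "x \<in> X \<Longrightarrow> smooth_on slit_bundle f \<Longrightarrow> smooth_on (- {0}) (\<lambda>y. f (x, y))"
  for f :: "_ \<Rightarrow> real"
  using smooth_on_slice[OF open_slit_bundle, of f x] slice_slit_bundle by simp

lemma open_nonzero: "open (- {0::real^2})" by auto

lemma fiber_smooth_K: "x \<in> X \<Longrightarrow> smooth_on (- {0}) (K_val F x)"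
  using fiber_smooth[OF _ smooth_K] by simp

lemma fiber_smooth_uv: "smooth_on S (u x)" "smooth_on S (v x)" if "open S"
  by (rule smooth_on_bounded_linear[OF bounded_linear_inner_right that])+

lemma fiber_smooth_l: "x \<in> X \<Longrightarrow> smooth_on (- {0}) (l_vec F x)"
  unfolding l_vec_def
  by (intro smooth_on_scaleR smooth_on_inverse fiber_smooth_K smooth_on_id open_nonzero) (use K_pos in force)+

lemma fiber_smooth_m:
  assumes "x \<in> X"
  shows "smooth_on (- {0}) (m_vec F x)"
proof -
  have s: "smooth_on (- {0}) (\<lambda>y. dens x y)" "smooth_on (- {0}) (q_val F x)" "smooth_on (- {0}) (B_val F x)"
    using fiber_smooth[OF assms smooth_dens] fiber_smooth[OF assms smooth_q] fiber_smooth[OF assms smooth_B] by simp_all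
  have pos: "K_val F x y * dens x y * B_val F x y \<noteq> 0" if "y \<in> - {0}" for y
    using K_pos[OF assms, of y] dens_pos[OF assms, of y] B_pos[OF assms, of y] that by force
  have "smooth_on (- {0}) (\<lambda>y. (1 / (K_val F x y * dens x y * B_val F x y)) *\<^sub>R
    ((u x y + g x * c x * q_val F x y) *\<^sub>R ev x - v x y *\<^sub>R eu x))"
    by (intro smooth_on_scaleR smooth_on_divide smooth_on_mult smooth_on_diff smooth_on_add
        smooth_on_const fiber_smooth_K assms s fiber_smooth_uv open_nonzero pos)
  then show ?thesis
    by (rule smooth_on_cong[OF open_nonzero, rotated]) (use m_vec_eq[OF assms] in auto)
qed

section \<open>The angle as a function on the fibres\<close>

definition "rad x y = sqrt ((u x y)\<^sup>2 + (v x y)\<^sup>2)"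

lemma rad_pos: "x \<in> X \<Longrightarrow> y \<noteq> 0 \<Longrightarrow> rad x y > 0" using uv_pos by (simp add: rad_def)
lemma rad_sq: "(rad x y)\<^sup>2 = (u x y)\<^sup>2 + (v x y)\<^sup>2" by (simp add: rad_def)

lemma smooth_rad:
  assumes "open W" "W \<subseteq> slit_bundle" shows "smooth_on W (\<lambda>p. rad (fst p) (snd p))"
  unfolding rad_def
  by (intro smooth_intros smooth_fields_joint assms) (use assms uv_pos in \<open>force+\<close>)

text \<open>A smooth choice \<open>a\<close> of the Euclidean polar angle of \<open>(u, v)\<close> over a part \<open>W\<close> of the slit tangent bundle.\<close>

definition polar_lift :: "((real^2) \<times> (real^2)) set \<Rightarrow> (real^2 \<Rightarrow> real^2 \<Rightarrow> real) \<Rightarrow> bool" where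
  "polar_lift W a \<longleftrightarrow> open W \<and> W \<subseteq> slit_bundle \<and> smooth_on W (\<lambda>p. a (fst p) (snd p)) \<and>
     (\<forall>(x, y)\<in>W. u x y = rad x y * cos (a x y) \<and> v x y = rad x y * sin (a x y))"

lemma polar_lift_smooth:
  assumes "polar_lift W a"
  shows "smooth_on W (\<lambda>p. angle_primitive (c (fst p)) (g (fst p)) (a (fst p) (snd p)))"
  using assms unfolding polar_lift_def
  by (intro smooth_on_angle_primitive smooth_fields_joint norm_b charge) auto

text \<open>Differentiating \<open>u = r cos a\<close> and \<open>v = r sin a\<close> and eliminating \<open>dr\<close> gives \<open>r\<^sup>2 da = u dv - v du\<close>, so the
  derivative of \<open>a\<close> follows from these two relations. The density has degree \<open>-2\<close>, which absorbs \<open>r\<^sup>2\<close>.\<close>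

lemma polar_lift_has_derivative:
  assumes "polar_lift W a" "(x, y) \<in> W"
  shows "((\<lambda>y. angle_primitive (c x) (g x) (a x y)) has_derivative
    (\<lambda>w. (m_cov F x y \<bullet> w) / K_val F x y)) (at y)"
proof -
  have W: "open W" "W \<subseteq> slit_bundle" "smooth_on W (\<lambda>p. a (fst p) (snd p))" 
    and uv: "\<And>x y. (x, y) \<in> W \<Longrightarrow> u x y = rad x y * cos (a x y)" "\<And>x y. (x, y) \<in> W \<Longrightarrow> v x y = rad x y * sin (a x y)"
    using assms(1) unfolding polar_lift_def by auto
  have xy: "x \<in> X" "y \<noteq> 0" using assms(2) W(2) by auto
  interpret finsleroid_parameters "c x" "g x" by (rule parameters[OF xy(1)])
  obtain a' where a': "(a x has_derivative a') (at y)"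
    using smooth_on_slice_has_derivative(2)[OF W(3) assms(2)] by auto
  obtain r' where r': "(rad x has_derivative r') (at y)"
    using smooth_on_slice_has_derivative(2)[OF smooth_rad[OF W(1,2)] assms(2)] by auto
  let ?V = "{y. (x, y) \<in> W}"
  have V: "open ?V" "y \<in> ?V" using open_slice[OF W(1)] assms(2) by auto
  have r: "rad x y > 0" by (rule rad_pos[OF xy])
  have "((\<lambda>y. rad x y * cos (a x y)) has_derivative (\<lambda>w. rad x y * (- sin (a x y) * a' w) + r' w * cos (a x y))) (at y)"
    by (rule has_derivative_eq_rhs[OF has_derivative_mult[OF r' has_derivative_cos[OF a']]]) (simp add: fun_eq_iff)
  then have du1: "(u x has_derivative (\<lambda>w. rad x y * (- sin (a x y) * a' w) + r' w * cos (a x y))) (at y)"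
    by (rule has_derivative_transform_within_open[OF _ V]) (use uv in auto)
  have "(u x has_derivative u x) (at y)" by (auto intro!: derivative_eq_intros)
  from fun_cong[OF has_derivative_unique[OF this du1]]
  have 1: "u x w = rad x y * (- sin (a x y) * a' w) + r' w * cos (a x y)" for w .
  have "((\<lambda>y. rad x y * sin (a x y)) has_derivative (\<lambda>w. rad x y * (cos (a x y) * a' w) + r' w * sin (a x y))) (at y)"
    by (rule has_derivative_eq_rhs[OF has_derivative_mult[OF r' has_derivative_sin[OF a']]]) (simp add: fun_eq_iff)
  then have du2: "(v x has_derivative (\<lambda>w. rad x y * (cos (a x y) * a' w) + r' w * sin (a x y))) (at y)"
    by (rule has_derivative_transform_within_open[OF _ V]) (use uv in auto)
  have "(v x has_derivative v x) (at y)" by (auto intro!: derivative_eq_intros)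
  from fun_cong[OF has_derivative_unique[OF this du2]]
  have 2: "v x w = rad x y * (cos (a x y) * a' w) + r' w * sin (a x y)" for w .
  have da: "(rad x y)\<^sup>2 * a' w = u x y * v x w - v x y * u x w" for w
  proof -
    have "u x y * v x w - v x y * u x w = (rad x y)\<^sup>2 * a' w * ((cos (a x y))\<^sup>2 + (sin (a x y))\<^sup>2)"
      unfolding 1[of w] 2[of w] uv[OF assms(2)] power2_eq_square by (simp only: algebra_simps)
    then show ?thesis by simp
  qed
  have "angle_speed (c x) (g x) (a x y) = (rad x y)\<^sup>2 * dens x y"
    unfolding uv[OF assms(2)] angle_density_scale[OF r] using r by (simp add: angle_speed_def)
  then have J: "angle_speed (c x) (g x) (a x y) * a' w = dens x y * (u x y * v x w - v x y * u x w)" for w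
    unfolding da[symmetric] by simp
  have "((\<lambda>y. angle_primitive (c x) (g x) (a x y)) has_derivative (\<lambda>w. angle_speed (c x) (g x) (a x y) * a' w)) (at y)"
    using diff_chain_at[OF a' has_field_derivative_imp_has_derivative[OF primitive_deriv]]
    by (simp add: o_def)
  then show ?thesis by (simp add: J m_cov_inner[OF xy])
qed

definition "north_region = {(x, y). x \<in> X \<and> b_val F x y > 0}"
definition "slit_region = {(x, y). x \<in> X \<and> (n_val F x y > 0 \<or> n_val F x y < 0 \<or> b_val F x y < 0)}"

definition "north_polar x y = arctan (v x y / u x y)"
text \<open>By the half-angle formula the arctan term is the polar angle of \<open>(- u, v)\<close>, taken in \<open>(- pi, pi)\<close> and
  halved, so that the value lies in \<open>(0, 2 pi)\<close> and the ray \<open>v = 0, u \<ge> 0\<close> is the only place where it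
  is discontinuous.\<close>

definition "slit_polar x y = pi - 2 * arctan (v x y / (rad x y - u x y))"

lemma north_region_iff: "(x, y) \<in> north_region \<longleftrightarrow> x \<in> X \<and> u x y > 0"
  using norm_b[of x] by (auto simp: north_region_def b_eq zero_less_mult_iff)

lemma slit_region_iff: "(x, y) \<in> slit_region \<longleftrightarrow> x \<in> X \<and> (v x y \<noteq> 0 \<or> u x y < 0)"
  using norm_b[of x] by (auto simp: slit_region_def b_eq n_val_def mult_less_0_iff)

lemma regions_cover: "x \<in> X \<Longrightarrow> y \<noteq> 0 \<Longrightarrow> (x, y) \<in> north_region \<or> (x, y) \<in> slit_region"
  using uv_pos[of x y] by (auto simp: north_region_iff slit_region_iff)

lemma open_regions: "open north_region" "open slit_region"
proof -
  have XU: "open (X \<times> (UNIV :: (real^2) set))" by (intro open_Times open_X) auto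
  have c: "continuous_on (X \<times> UNIV) (\<lambda>p. u (fst p) (snd p))" "continuous_on (X \<times> UNIV) (\<lambda>p. v (fst p) (snd p))"
    by (rule smooth_on_imp_continuous_on, rule smooth_fields_joint[OF XU], simp)+
  have "north_region = (X \<times> UNIV) \<inter> (\<lambda>p. u (fst p) (snd p)) -` {0<..}"
    by (auto simp: north_region_iff)
  then show "open north_region" using continuous_open_preimage[OF c(1) XU open_greaterThan] by simp
  have "slit_region = ((X \<times> UNIV) \<inter> (\<lambda>p. v (fst p) (snd p)) -` (- {0})) \<union> ((X \<times> UNIV) \<inter> (\<lambda>p. u (fst p) (snd p)) -` {..<0})"
    by (auto simp: slit_region_iff)
  moreover have "open ((X \<times> UNIV) \<inter> (\<lambda>p. v (fst p) (snd p)) -` (- {0}))"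
    by (rule continuous_open_preimage[OF c(2) XU]) auto
  moreover have "open ((X \<times> UNIV) \<inter> (\<lambda>p. u (fst p) (snd p)) -` {..<0})"
    by (rule continuous_open_preimage[OF c(1) XU open_lessThan])
  ultimately show "open slit_region" by auto
qed

lemma regions_subset: "north_region \<subseteq> slit_bundle" "slit_region \<subseteq> slit_bundle"
  by (auto simp: north_region_iff slit_region_iff)

lemma north_polar_lift: "polar_lift north_region north_polar"
proof -
  have "u x y = rad x y * cos (north_polar x y) \<and> v x y = rad x y * sin (north_polar x y)" if "(x, y) \<in> north_region" for x y
  proof -
    have u: "u x y > 0" using that by (simp add: north_region_iff)
    have "rad x y = u x y * sqrt (1 + (v x y / u x y)\<^sup>2)"
    proof -
      have "(u x y)\<^sup>2 + (v x y)\<^sup>2 = (u x y)\<^sup>2 * (1 + (v x y / u x y)\<^sup>2)" using u by (simp add: field_simps)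
      then show ?thesis using u by (simp add: rad_def real_sqrt_mult)
    qed
    moreover have "sqrt (1 + (v x y / u x y)\<^sup>2) > 0" by (simp add: add_pos_nonneg)
    ultimately show ?thesis using u by (simp add: north_polar_def cos_arctan sin_arctan)
  qed
  moreover have "smooth_on north_region (\<lambda>p. north_polar (fst p) (snd p))"
    unfolding north_polar_def
    by (intro smooth_intros smooth_fields_joint open_regions) (use regions_subset north_region_iff in \<open>force+\<close>)
  ultimately show ?thesis unfolding polar_lift_def using open_regions regions_subset by blast
qed

lemma rad_gt: "(x, y) \<in> slit_region \<Longrightarrow> u x y < rad x y"
proof -
  assume "(x, y) \<in> slit_region"
  then consider "v x y \<noteq> 0" | "u x y < 0" by (auto simp: slit_region_iff)
  then show ?thesis
  proof cases
    case 1
    then have "(u x y)\<^sup>2 < (rad x y)\<^sup>2" by (simp add: rad_sq)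
    then show ?thesis by (rule power2_less_imp_less) (simp add: rad_def)
  next
    case 2
    then show ?thesis by (simp add: rad_def order_less_le_trans)
  qed
qed

lemma slit_polar_lift: "polar_lift slit_region slit_polar"
proof -
  have "u x y = rad x y * cos (slit_polar x y) \<and> v x y = rad x y * sin (slit_polar x y)" if p: "(x, y) \<in> slit_region" for x y
  proof -
    define R U V t where "R = rad x y" and "U = u x y" and "V = v x y" and "t = V / (R - U)"
    have RU: "R - U > 0" using rad_gt[OF p] by (simp add: R_def U_def)
    have R2: "R * R = U * U + V * V" using rad_sq[of x y] by (simp add: R_def U_def V_def power2_eq_square)
    have R: "R > 0" using rad_pos p regions_subset by (auto simp: R_def)
    have tt: "1 + t\<^sup>2 = 2 * R / (R - U)"
    proof -
      have "(R - U)\<^sup>2 + V\<^sup>2 = 2 * R * (R - U)" using R2 by (simp add: power2_eq_square algebra_simps)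
      moreover have "1 + t\<^sup>2 = ((R - U)\<^sup>2 + V\<^sup>2) / (R - U)\<^sup>2"
        using RU by (simp add: t_def power_divide add_divide_distrib)
      ultimately show ?thesis using RU by (simp add: power2_eq_square)
    qed
    have s: "sqrt (1 + t\<^sup>2) * sqrt (1 + t\<^sup>2) = 1 + t\<^sup>2" by simp
    have cs: "cos (slit_polar x y) = 1 - 2 / (1 + t\<^sup>2)" "sin (slit_polar x y) = 2 * t / (1 + t\<^sup>2)"
      unfolding slit_polar_def R_def[symmetric] U_def[symmetric] V_def[symmetric] t_def[symmetric]
      using s by (simp_all add: cos_double_cos sin_double cos_arctan sin_arctan power_divide)
    show ?thesis
      unfolding cs tt R_def[symmetric] U_def[symmetric] V_def[symmetric]
      using R RU by (simp add: t_def field_simps)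
  qed
  moreover have "smooth_on slit_region (\<lambda>p. slit_polar (fst p) (snd p))"
    unfolding slit_polar_def
    by (intro smooth_intros smooth_fields_joint smooth_rad open_regions regions_subset) (use regions_subset rad_gt in \<open>force+\<close>)
  ultimately show ?thesis unfolding polar_lift_def using open_regions regions_subset by blast
qed

lemma slit_polar_range: "0 < slit_polar x y" "slit_polar x y < 2 * pi"
  using arctan_bounded[of "v x y / (rad x y - u x y)"] by (auto simp: slit_polar_def)

definition "polar x y = (if v x y = 0 \<and> u x y \<ge> 0 then 0 else slit_polar x y)"

lemma polar_slit: "(x, y) \<in> slit_region \<Longrightarrow> polar x y = slit_polar x y"
  by (auto simp: polar_def slit_region_iff)

lemma polar_range: "0 \<le> polar x y" "polar x y < 2 * pi"
  using slit_polar_range[of x y] by (auto simp: polar_def)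

lemma polar_trig:
  assumes "x \<in> X" "y \<noteq> 0"
  shows "u x y = rad x y * cos (polar x y)" "v x y = rad x y * sin (polar x y)"
proof -
  have "u x y = rad x y * cos (polar x y) \<and> v x y = rad x y * sin (polar x y)"
  proof (cases "(x, y) \<in> slit_region")
    case True
    then show ?thesis using slit_polar_lift by (auto simp: polar_lift_def polar_slit)
  next
    case False
    then have "v x y = 0" "u x y \<ge> 0" using assms by (auto simp: slit_region_iff)
    then show ?thesis by (simp add: polar_def rad_def)
  qed
  then show "u x y = rad x y * cos (polar x y)" "v x y = rad x y * sin (polar x y)" by auto
qed

lemma polar_unique:
  assumes "x \<in> X" "y \<noteq> 0" "u x y = r * cos t" "v x y = r * sin t" "r > 0" "0 \<le> t" "t < 2 * pi"
  shows "polar x y = t"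
proof -
  have "(rad x y)\<^sup>2 = r\<^sup>2 * ((cos t)\<^sup>2 + (sin t)\<^sup>2)"
    unfolding rad_sq assms(3,4) by (simp only: power_mult_distrib distrib_left)
  then have "rad x y = r" using assms(5) rad_pos[OF assms(1,2)] by (simp add: power2_eq_iff_nonneg)
  then have "cos (polar x y) = cos t" "sin (polar x y) = sin t"
    using polar_trig[OF assms(1,2)] assms(3-5) by simp_all
  then obtain n :: int where n: "polar x y = t + 2 * pi * n" using sin_cos_eq_iff by blast
  then have "\<bar>2 * pi * n\<bar> < 2 * pi * 1" using polar_range[of x y] assms(6,7) by linarith
  then have "\<bar>real_of_int n\<bar> < 1" by (simp add: abs_mult)
  then have "n = 0" by linarith
  then show ?thesis using n by simp
qed

text \<open>The angle function itself; \<open>angle_unique\<close> shows that there is no other.\<close>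

definition "Theta x y = angle_primitive (c x) (g x) (polar x y)"

lemma theta_max: "x \<in> X \<Longrightarrow> theta_max F x = angle_primitive (c x) (g x) (2 * pi)"
  by (intro theta_max_eq norm_b charge)

lemma theta_max_pos: "x \<in> X \<Longrightarrow> theta_max F x > 0"
  using finsleroid_parameters.primitive_strict_mono[OF parameters, of x 0 "2 * pi"]
    finsleroid_parameters.primitive_0[OF parameters, of x] by (simp add: theta_max)

lemma Theta_range: "x \<in> X \<Longrightarrow> 0 \<le> Theta x y" "x \<in> X \<Longrightarrow> Theta x y < theta_max F x"
proof -
  assume x: "x \<in> X"
  interpret finsleroid_parameters "c x" "g x" by (rule parameters[OF x])
  show "0 \<le> Theta x y" using primitive_strict_mono[of 0 "polar x y"] polar_range[of x y]
    by (cases "polar x y = 0") (auto simp: Theta_def)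
  show "Theta x y < theta_max F x" unfolding theta_max[OF x] Theta_def
    by (rule primitive_strict_mono[OF polar_range(2)])
qed

lemma Theta_scale: "x \<in> X \<Longrightarrow> y \<noteq> 0 \<Longrightarrow> 0 < r \<Longrightarrow> Theta x (r *\<^sub>R y) = Theta x y"
proof -
  assume a: "x \<in> X" "y \<noteq> 0" "0 < r"
  have "polar x (r *\<^sub>R y) = polar x y"
    by (rule polar_unique[of x _ "r * rad x y"]) (use a rad_pos polar_range in \<open>auto simp: polar_trig\<close>)
  then show ?thesis by (simp add: Theta_def)
qed

lemma Theta_has_derivative:
  assumes "(x, y) \<in> slit_region"
  shows "(Theta x has_derivative (\<lambda>w. (m_cov F x y \<bullet> w) / K_val F x y)) (at y)"
proof (rule has_derivative_transform_within_open[OF polar_lift_has_derivative[OF slit_polar_lift assms]])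
  show "open {y. (x, y) \<in> slit_region}" by (rule open_slice[OF open_regions(2)])
qed (use assms in \<open>auto simp: Theta_def polar_slit\<close>)

lemma b_vec_eq: "b_vec F x = c x *\<^sub>R eu x"
  by (simp add: b_vec_def b_cov_def matrix_vector_mult_scaleR)

lemma Theta_b_vec: "x \<in> X \<Longrightarrow> Theta x (b_vec F x) = 0"
proof -
  assume x: "x \<in> X"
  interpret finsleroid_parameters "c x" "g x" by (rule parameters[OF x])
  have "polar x (b_vec F x) = 0" using norm_b(1)[OF x] dual_frame[OF x] by (simp add: polar_def b_vec_eq)
  then show ?thesis by (simp add: Theta_def)
qed

text \<open>Along the curve \<open>e(t) = cos t eu + sin t ev\<close>, \<open>0 < t < 2 pi\<close>, which meets every ray off the north
  pole once, the given function and the primitive have the same derivative, so they differ by a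
  constant \<open>C\<close>. Letting \<open>t\<close> tend to \<open>0\<close> and to \<open>2 pi\<close>, the bounds \<open>0 \<le> \<theta> < \<theta>max\<close> give \<open>C \<ge> 0\<close> and \<open>C \<le> 0\<close>.\<close>

lemma angle_unique:
  assumes x: "x \<in> X"
    and scale: "\<And>y r. y \<noteq> 0 \<Longrightarrow> 0 < r \<Longrightarrow> \<theta> (r *\<^sub>R y) = \<theta> y"
    and north: "\<theta> (b_vec F x) = 0"
    and range: "\<And>y. y \<noteq> 0 \<Longrightarrow> 0 \<le> \<theta> y" "\<And>y. y \<noteq> 0 \<Longrightarrow> \<theta> y < theta_max F x"
    and deriv: "\<And>y. (x, y) \<in> slit_region \<Longrightarrow> (\<theta> has_derivative (\<lambda>w. (m_cov F x y \<bullet> w) / K_val F x y)) (at y)"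
    and y: "y \<noteq> 0"
  shows "\<theta> y = Theta x y"
proof -
  interpret finsleroid_parameters "c x" "g x" by (rule parameters[OF x])
  define e where "e t = cos t *\<^sub>R eu x + sin t *\<^sub>R ev x" for t
  have uve: "u x (e t) = cos t" "v x (e t) = sin t" for t
    using dual_frame[OF x] by (simp_all add: e_def inner_add_right)
  have e0: "e t \<noteq> 0" for t
  proof
    assume "e t = 0"
    then have "cos t = 0" "sin t = 0" using uve[of t] by auto
    then show False using sin_cos_squared_add[of t] by simp
  qed
  have eslit: "(x, e t) \<in> slit_region" if "0 < t" "t < 2 * pi" for t
  proof -
    have "\<not> (sin t = 0 \<and> 0 \<le> cos t)"
    proof
      assume a: "sin t = 0 \<and> 0 \<le> cos t"
      then have "cos t = 1" using sin_cos_squared_add[of t] by (auto simp: power2_eq_1_iff)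
      then obtain n :: int where n: "t = real_of_int n * 2 * pi" unfolding cos_one_2pi_int by blast
      then have "0 < real_of_int n * (2 * pi)" "real_of_int n * (2 * pi) < 1 * (2 * pi)" using that n by simp_all
      then have "0 < real_of_int n" "real_of_int n < 1"
        by (simp add: zero_less_mult_iff, simp only: mult_less_cancel_right_pos pi_gt_zero zero_less_mult_iff, simp)
      then have "0 < n" "n < 1" by simp_all
      then show False by linarith
    qed
    then show ?thesis using x by (auto simp: slit_region_iff uve)
  qed
  have de: "(e has_vector_derivative (- sin t *\<^sub>R eu x + cos t *\<^sub>R ev x)) (at t)" for t
    unfolding e_def by (auto intro!: derivative_eq_intros simp: has_vector_derivative_def fun_eq_iff algebra_simps)
  have d: "((\<lambda>t. \<theta> (e t) - angle_primitive (c x) (g x) t) has_real_derivative 0) (at t)" if t: "0 < t" "t < 2 * pi" for t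
  proof -
    have "((\<lambda>t. \<theta> (e t)) has_vector_derivative
        (m_cov F x (e t) \<bullet> (- sin t *\<^sub>R eu x + cos t *\<^sub>R ev x)) / K_val F x (e t)) (at t)"
      using diff_chain_at[OF de[unfolded has_vector_derivative_def] deriv[OF eslit[OF t]]]
      unfolding has_vector_derivative_def o_def inner_scaleR_right by simp
    also have "(m_cov F x (e t) \<bullet> (- sin t *\<^sub>R eu x + cos t *\<^sub>R ev x)) / K_val F x (e t) = angle_speed (c x) (g x) t * ((cos t)\<^sup>2 + (sin t)\<^sup>2)"
      unfolding m_cov_inner[OF x e0] uve angle_speed_def power2_eq_square
      using dual_frame[OF x] by (simp add: inner_add_right inner_diff_right)
    finally have "((\<lambda>t. \<theta> (e t)) has_real_derivative angle_speed (c x) (g x) t) (at t)"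
      by (simp add: has_real_derivative_iff_has_vector_derivative)
    from DERIV_diff[OF this primitive_deriv] show ?thesis by simp
  qed
  obtain C where C: "\<And>t. 0 < t \<Longrightarrow> t < 2 * pi \<Longrightarrow> \<theta> (e t) = angle_primitive (c x) (g x) t + C"
  proof -
    have "\<theta> (e t) - angle_primitive (c x) (g x) t = \<theta> (e pi) - angle_primitive (c x) (g x) pi" if t: "0 < t" "t < 2 * pi" for t
    proof (rule has_field_derivative_zero_constant[of "{0<..<2*pi}" "\<lambda>t. \<theta> (e t) - angle_primitive (c x) (g x) t", THEN exE])
      show "convex {0<..<2 * pi}" by simp
      show "((\<lambda>t. \<theta> (e t) - angle_primitive (c x) (g x) t) has_real_derivative 0) (at t within {0<..<2 * pi})" if "t \<in> {0<..<2 * pi}" for t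
        using d that by (auto intro: has_field_derivative_at_within)
    qed (use t in auto)
    then show ?thesis by (intro that[of "\<theta> (e pi) - angle_primitive (c x) (g x) pi"]) (auto simp: algebra_simps)
  qed
  have "C \<ge> 0"
  proof (rule tendsto_lowerbound[of "\<lambda>t. angle_primitive (c x) (g x) t + C" _ "at_right 0"])
    have "((\<lambda>t. angle_primitive (c x) (g x) t + C) \<longlongrightarrow> angle_primitive (c x) (g x) 0 + C) (at_right 0)"
      using isCont_primitive[of 0] by (intro tendsto_intros) (simp add: isCont_def filterlim_at_split)
    then show "((\<lambda>t. angle_primitive (c x) (g x) t + C) \<longlongrightarrow> C) (at_right 0)" by simp
    show "\<forall>\<^sub>F t in at_right 0. 0 \<le> angle_primitive (c x) (g x) t + C"
      using eventually_at_right_less eventually_at_right_real[of 0 "2 * pi"]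
      by (auto elim!: eventually_mono simp flip: C intro!: range e0)
  qed simp
  moreover have "angle_primitive (c x) (g x) (2 * pi) + C \<le> theta_max F x"
  proof (rule tendsto_upperbound[of "\<lambda>t. angle_primitive (c x) (g x) t + C" _ "at_left (2 * pi)"])
    show "((\<lambda>t. angle_primitive (c x) (g x) t + C) \<longlongrightarrow> angle_primitive (c x) (g x) (2 * pi) + C) (at_left (2 * pi))"
      using isCont_primitive[of "2 * pi"] by (intro tendsto_intros) (simp add: isCont_def filterlim_at_split)
    show "\<forall>\<^sub>F t in at_left (2 * pi). angle_primitive (c x) (g x) t + C \<le> theta_max F x"
      using eventually_at_left_real[of 0 "2 * pi"]
      by (auto elim!: eventually_mono simp flip: C intro!: less_imp_le range e0)
  qed simp
  ultimately have C0: "C = 0" using theta_max[OF x] by simp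
  have ye: "y = rad x y *\<^sub>R e (polar x y)"
    by (rule uv_eqI[OF x]) (simp_all add: uve polar_trig[OF x y, symmetric])
  have "\<theta> y = \<theta> (e (polar x y))"
    using scale[OF e0 rad_pos[OF x y]] ye by metis
  also have "\<dots> = Theta x y"
  proof (cases "polar x y = 0")
    case True
    have "e 0 = eu x" by (simp add: e_def)
    moreover have "\<theta> (c x *\<^sub>R eu x) = \<theta> (eu x)"
      using scale[of "eu x" "c x"] e0[of 0] norm_b(1)[OF x] by (simp add: \<open>e 0 = eu x\<close>)
    ultimately show ?thesis using True north by (simp add: b_vec_eq Theta_def)
  next
    case False
    then show ?thesis using C[of "polar x y"] C0 polar_range[of x y] by (simp add: Theta_def)
  qed
  finally show ?thesis .
qed

end

section \<open>The connection determined by a smooth angle\<close>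

lemma pd_mult:
  assumes "smooth_on V a" "smooth_on V b" "y \<in> V"
  shows "pd i (\<lambda>z. a z * b z) y = a y * pd i b y + pd i a y * b y"
  using pd_eqI[OF has_derivative_mult[OF smooth_on_has_derivative[OF assms(1,3)] smooth_on_has_derivative[OF assms(2,3)]]]
  by (simp add: pd_def)

lemma pd_add:
  assumes "smooth_on V a" "smooth_on V b" "y \<in> V"
  shows "pd i (\<lambda>z. a z + b z) y = pd i a y + pd i b y"
  using pd_eqI[OF has_derivative_add[OF smooth_on_has_derivative[OF assms(1,3)] smooth_on_has_derivative[OF assms(2,3)]]]
  by (simp add: pd_def)

lemma pd_minus:
  assumes "smooth_on V a" "y \<in> V"
  shows "pd i (\<lambda>z. - a z) y = - pd i a y"
  using pd_eqI[OF has_derivative_minus[OF smooth_on_has_derivative[OF assms]]]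
  by (simp add: pd_def)

lemma pd_commute: "open V \<Longrightarrow> smooth_on V f \<Longrightarrow> y \<in> V \<Longrightarrow> pd i (pd j f) y = pd j (pd i f) y"
  unfolding pd_def[abs_def] by (rule frechet_derivatives_commute)

text \<open>Here \<open>\<kappa>, \<theta>\<close> are the metric function and the angle on one fibre, \<open>P, Q\<close> their prescribed changes under the
  transport and \<open>N\<close> the transport field. The Hessian relation \<open>H\<close> and its first-order change \<open>HP\<close> are compatible with
  \<open>I\<close> and \<open>II\<close>. Differentiating \<open>I\<close> twice leaves the wanted term and terms with \<open>\<theta>_j \<partial>_m N^j\<close>; these are
  supplied by one derivative of \<open>II\<close>, where the unknown contraction \<open>N^j \<theta>_jm\<close> is obtained from the symmetry
  of the third derivatives of \<open>\<kappa>\<close>.\<close>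

lemma transport_second_derivative:
  fixes \<kappa> \<theta> P Q :: "real^2 \<Rightarrow> real" and N :: "2 \<Rightarrow> real^2 \<Rightarrow> real"
  assumes V: "open V" and sm: "smooth_on V \<kappa>" "smooth_on V \<theta>" "smooth_on V P" "smooth_on V Q" "\<And>j. smooth_on V (N j)"
    and I: "\<And>y. y \<in> V \<Longrightarrow> N 1 y * pd 1 \<kappa> y + N 2 y * pd 2 \<kappa> y = - P y"
    and II: "\<And>y. y \<in> V \<Longrightarrow> N 1 y * pd 1 \<theta> y + N 2 y * pd 2 \<theta> y = - Q y"
    and H: "\<And>y i j. y \<in> V \<Longrightarrow> pd j (pd i \<kappa>) y = \<kappa> y * pd j \<theta> y * pd i \<theta> y"
    and HP: "\<And>y. y \<in> V \<Longrightarrow> pd i (pd m P) y = P y * pd i \<theta> y * pd m \<theta> y + \<kappa> y * pd i Q y * pd m \<theta> y + \<kappa> y * pd i \<theta> y * pd m Q y"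
    and y: "y \<in> V"
  shows "pd 1 \<kappa> y * pd i (pd m (N 1)) y + pd 2 \<kappa> y * pd i (pd m (N 2)) y = 0"
proof -
  note spd = smooth_on_pd
  have I1: "pd m (N 1) z * pd 1 \<kappa> z + pd m (N 2) z * pd 2 \<kappa> z = - pd m P z + \<kappa> z * pd m \<theta> z * Q z" if z: "z \<in> V" for z
  proof -
    have "pd m (\<lambda>y. N 1 y * pd 1 \<kappa> y + N 2 y * pd 2 \<kappa> y) z = pd m (\<lambda>y. - P y) z"
      by (rule pd_cong_open[OF V z I])
    moreover have "pd m (\<lambda>y. N 1 y * pd 1 \<kappa> y + N 2 y * pd 2 \<kappa> y) z
        = (N 1 z * pd m (pd 1 \<kappa>) z + pd m (N 1) z * pd 1 \<kappa> z) + (N 2 z * pd m (pd 2 \<kappa>) z + pd m (N 2) z * pd 2 \<kappa> z)"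
      by (simp add: pd_add[OF smooth_on_mult[OF V sm(5) spd[OF sm(1)]] smooth_on_mult[OF V sm(5) spd[OF sm(1)]] z]
          pd_mult[OF sm(5) spd[OF sm(1)] z])
    ultimately have "(N 1 z * pd m (pd 1 \<kappa>) z + pd m (N 1) z * pd 1 \<kappa> z) + (N 2 z * pd m (pd 2 \<kappa>) z + pd m (N 2) z * pd 2 \<kappa> z)
      = - pd m P z" by (simp add: pd_minus[OF sm(3) z])
    then show ?thesis unfolding H[OF z] using II[OF z] by algebra
  qed
  have E1: "(pd m (N 1) y * pd i (pd 1 \<kappa>) y + pd i (pd m (N 1)) y * pd 1 \<kappa> y) + (pd m (N 2) y * pd i (pd 2 \<kappa>) y + pd i (pd m (N 2)) y * pd 2 \<kappa> y)
      = - pd i (pd m P) y + (\<kappa> y * pd m \<theta> y * pd i Q y + (\<kappa> y * pd i (pd m \<theta>) y + pd i \<kappa> y * pd m \<theta> y) * Q y)"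
  proof -
    have "pd i (\<lambda>z. pd m (N 1) z * pd 1 \<kappa> z + pd m (N 2) z * pd 2 \<kappa> z) y = pd i (\<lambda>z. - pd m P z + \<kappa> z * pd m \<theta> z * Q z) y"
      by (rule pd_cong_open[OF V y I1])
    moreover have "pd i (\<lambda>z. pd m (N 1) z * pd 1 \<kappa> z + pd m (N 2) z * pd 2 \<kappa> z) y
      = (pd m (N 1) y * pd i (pd 1 \<kappa>) y + pd i (pd m (N 1)) y * pd 1 \<kappa> y) + (pd m (N 2) y * pd i (pd 2 \<kappa>) y + pd i (pd m (N 2)) y * pd 2 \<kappa> y)"
      by (simp add: pd_add[OF smooth_on_mult[OF V spd[OF sm(5)] spd[OF sm(1)]] smooth_on_mult[OF V spd[OF sm(5)] spd[OF sm(1)]] y]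
          pd_mult[OF spd[OF sm(5)] spd[OF sm(1)] y])
    moreover have "pd i (\<lambda>z. - pd m P z + \<kappa> z * pd m \<theta> z * Q z) y
      = - pd i (pd m P) y + (\<kappa> y * pd m \<theta> y * pd i Q y + (\<kappa> y * pd i (pd m \<theta>) y + pd i \<kappa> y * pd m \<theta> y) * Q y)"
      by (simp only: pd_add[OF smooth_on_minus[OF V spd[OF sm(3)]] smooth_on_mult[OF V smooth_on_mult[OF V sm(1) spd[OF sm(2)]] sm(4)] y]
          pd_mult[OF smooth_on_mult[OF V sm(1) spd[OF sm(2)]] sm(4) y] pd_mult[OF sm(1) spd[OF sm(2)] y] pd_minus[OF spd[OF sm(3)] y])
    ultimately show ?thesis by simp
  qed
  have E2: "(N 1 y * pd m (pd 1 \<theta>) y + pd m (N 1) y * pd 1 \<theta> y) + (N 2 y * pd m (pd 2 \<theta>) y + pd m (N 2) y * pd 2 \<theta> y) = - pd m Q y"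
  proof -
    have "pd m (\<lambda>y. N 1 y * pd 1 \<theta> y + N 2 y * pd 2 \<theta> y) y = pd m (\<lambda>y. - Q y) y"
      by (rule pd_cong_open[OF V y II])
    then show ?thesis
      by (simp add: pd_add[OF smooth_on_mult[OF V sm(5) spd[OF sm(2)]] smooth_on_mult[OF V sm(5) spd[OF sm(2)]] y]
          pd_mult[OF sm(5) spd[OF sm(2)] y] pd_minus[OF sm(4) y])
  qed
  \<comment> \<open>symmetry of \<open>\<kappa>_mij\<close> in \<open>i\<close> and \<open>j\<close>, with \<open>\<kappa>_mi\<close> and \<open>\<kappa>_mj\<close> rewritten by \<open>H\<close>\<close>
  have E3: "pd i \<kappa> y * pd m \<theta> y * pd j \<theta> y + \<kappa> y * pd i (pd m \<theta>) y * pd j \<theta> y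
      = pd j \<kappa> y * pd m \<theta> y * pd i \<theta> y + \<kappa> y * pd m (pd j \<theta>) y * pd i \<theta> y" for j
  proof -
    have third: "pd b (pd a (pd m \<kappa>)) y = (\<kappa> y * pd a \<theta> y) * pd b (pd m \<theta>) y + (\<kappa> y * pd b (pd a \<theta>) y + pd b \<kappa> y * pd a \<theta> y) * pd m \<theta> y" for a b
    proof -
      have "pd b (pd a (pd m \<kappa>)) y = pd b (\<lambda>z. \<kappa> z * pd a \<theta> z * pd m \<theta> z) y"
        by (rule pd_cong_open[OF V y H])
      then show ?thesis
        by (simp add: pd_mult[OF smooth_on_mult[OF V sm(1) spd[OF sm(2)]] spd[OF sm(2)] y] pd_mult[OF sm(1) spd[OF sm(2)] y])
    qed
    have "pd i (pd j (pd m \<kappa>)) y = pd j (pd i (pd m \<kappa>)) y"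
      by (rule pd_commute[OF V spd[OF sm(1)] y])
    moreover have "pd i (pd j \<theta>) y = pd j (pd i \<theta>) y" "pd m (pd j \<theta>) y = pd j (pd m \<theta>) y"
      by (rule pd_commute[OF V sm(2) y])+
    ultimately show ?thesis unfolding third by algebra
  qed
  have E1': "pd m (N 1) y * (\<kappa> y * pd i \<theta> y * pd 1 \<theta> y) + pd i (pd m (N 1)) y * pd 1 \<kappa> y + (pd m (N 2) y * (\<kappa> y * pd i \<theta> y * pd 2 \<theta> y) + pd i (pd m (N 2)) y * pd 2 \<kappa> y)
      = - (P y * pd i \<theta> y * pd m \<theta> y + \<kappa> y * pd i Q y * pd m \<theta> y + \<kappa> y * pd i \<theta> y * pd m Q y) + (\<kappa> y * pd m \<theta> y * pd i Q y + (\<kappa> y * pd i (pd m \<theta>) y + pd i \<kappa> y * pd m \<theta> y) * Q y)"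
    using E1 unfolding H[OF y] HP[OF y] .
  show ?thesis
    using E1' E2 E3[of 1] E3[of 2] I[OF y] II[OF y] by algebra
qed

lemma dx_eq:
  assumes "smooth_on W (\<lambda>p. f (fst p) (snd p))" "(x, y) \<in> W"
  shows "dx n f x y = frechet_derivative (\<lambda>p. f (fst p) (snd p)) (at (x, y)) (axis n 1, 0)"
  using pd_eqI[OF smooth_on_slice_has_derivative(1)[OF assms]] by (simp add: dx_def)

lemma pd_slice_eq:
  assumes "smooth_on W h" "(x, y) \<in> W"
  shows "pd i (\<lambda>y. h (x, y)) y = frechet_derivative h (at (x, y)) (0, axis i 1)"
  using pd_eqI[OF smooth_on_slice_has_derivative(2)[OF assms]] by simp

lemma smooth_on_dx:
  assumes "open W" "smooth_on W (\<lambda>p. f (fst p) (snd p))"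
  shows "smooth_on {y. (x, y) \<in> W} (dx n f x)"
  by (rule smooth_on_cong[OF open_slice[OF assms(1)] _ smooth_on_slice[OF assms(1) smooth_on_derivative[OF assms(2)]]])
    (simp add: dx_eq[OF assms(2)])

lemma smooth_connection_onI:
  assumes "open V" "\<And>i n. smooth_on V (\<lambda>y. N x y i n)"
  shows "smooth_connection_on N x V"
  unfolding smooth_connection_on_def D_coeff_def[abs_def]
  using assms by (auto intro!: smooth_on_minus smooth_on_pd)

context finsleroid_chart
begin

text \<open>The \<open>x\<close>-derivative of \<open>K_im = K \<theta>_i \<theta>_m\<close>, with \<open>x\<close>- and \<open>y\<close>-derivatives interchanged. This is the place where
  joint smoothness in \<open>x\<close> and \<open>y\<close> is needed.\<close>

lemma pd_pd_dx_K:
  assumes W: "open W" "W \<subseteq> slit_bundle" and s: "smooth_on W (\<lambda>p. \<phi> (fst p) (snd p))"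
    and d: "\<And>x y. (x, y) \<in> W \<Longrightarrow> (\<phi> x has_derivative (\<lambda>w. (m_cov F x y \<bullet> w) / K_val F x y)) (at y)"
    and xy: "(x, y) \<in> W"
  shows "pd i (pd m (dx n (K_val F) x)) y = dx n (K_val F) x y * pd i (\<phi> x) y * pd m (\<phi> x) y
    + K_val F x y * pd i (dx n \<phi> x) y * pd m (\<phi> x) y + K_val F x y * pd i (\<phi> x) y * pd m (dx n \<phi> x) y"
proof -
  let ?K = "\<lambda>p. K_val F (fst p) (snd p)" and ?f = "\<lambda>p. \<phi> (fst p) (snd p)"
  let ?X = "(axis n 1, 0) :: (real^2) \<times> (real^2)" and ?Y = "\<lambda>i. (0, axis i 1) :: (real^2) \<times> (real^2)"
  define dd where "dd v h = (\<lambda>p. frechet_derivative h (at p) v)" for v :: "(real^2) \<times> (real^2)" and h :: "(real^2) \<times> (real^2) \<Rightarrow> real"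
  have sdd: "smooth_on W (dd v h)" if "smooth_on W h" for v h
    unfolding dd_def by (rule smooth_on_derivative[OF that])
  have comm: "dd v (dd w h) p = dd w (dd v h) p" if "smooth_on W h" "p \<in> W" for v w h p
    unfolding dd_def by (rule frechet_derivatives_commute[OF W(1) that])
  have cong: "dd v h p = dd v h' p" if "p \<in> W" "\<And>z. z \<in> W \<Longrightarrow> h z = h' z" for v h h' p
    unfolding dd_def by (rule fun_cong[OF frechet_derivative_cong_open[OF W(1) that]])
  have mult: "dd v (\<lambda>p. a p * b p) p = a p * dd v b p + dd v a p * b p" if "smooth_on W a" "smooth_on W b" "p \<in> W" for v a b p
    unfolding dd_def
    by (rule frechet_derivative_eqI[OF has_derivative_mult[OF smooth_on_has_derivative[OF that(1,3)] smooth_on_has_derivative[OF that(2,3)]]])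
  have sK: "smooth_on W ?K" by (rule smooth_on_subset[OF smooth_K W(2)])
  have pdd: "pd i (\<lambda>y. h (x, y)) y = dd (?Y i) h (x, y)" if "smooth_on W h" "(x, y) \<in> W" for i h x y
    unfolding dd_def by (rule pd_slice_eq[OF that])
  have pdK: "pd i (K_val F x) y = dd (?Y i) ?K (x, y)" and pdf: "pd i (\<phi> x) y = dd (?Y i) ?f (x, y)"
    and dxK: "dx n (K_val F) x y = dd ?X ?K (x, y)" and dxf: "dx n \<phi> x y = dd ?X ?f (x, y)" if "(x, y) \<in> W" for i x y
    using pdd[OF sK that] pdd[OF s that] dx_eq[OF sK that] dx_eq[OF s that] by (simp_all add: dd_def)
  have pd2: "pd i g y = dd (?Y i) h (x, y)" if "smooth_on W h" "(x, y) \<in> W" "\<And>y. (x, y) \<in> W \<Longrightarrow> g y = h (x, y)" for i g h x y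
  proof -
    have "pd i g y = pd i (\<lambda>y. h (x, y)) y"
      by (rule pd_cong_open[OF open_slice[OF W(1), of x]]) (use that in auto)
    then show ?thesis using pdd[OF that(1,2)] by simp
  qed
  have H: "dd (?Y i) (dd (?Y m) ?K) p = ?K p * dd (?Y i) ?f p * dd (?Y m) ?f p" if "p \<in> W" for p
  proof -
    obtain x y where p: "p = (x, y)" by fastforce
    have xyW: "(x, y) \<in> W" "x \<in> X" "y \<noteq> 0" using that p W(2) by auto
    have "pd i (\<phi> x) y = dens x y * rot_cov x y $ i" for i
      using pd_eqI[OF d[OF xyW(1)]] K_pos[OF xyW(2,3)] by (simp add: m_cov_eq[OF xyW(2,3)] inner_axis)
    moreover have "pd i (pd m (K_val F x)) y = dd (?Y i) (dd (?Y m) ?K) (x, y)"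
      by (rule pd2[OF sdd[OF sK] xyW(1)]) (use pdK in auto)
    ultimately show ?thesis using pd_pd_K[OF xyW(2,3)] pdf[OF xyW(1)] unfolding p by simp
  qed
  have mixed: "dd ?X (dd (?Y m) ?f) (x, y) = pd m (dx n \<phi> x) y" for m
    using comm[OF s xy] pd2[OF sdd[OF s] xy dxf] by simp
  have "pd i (pd m (dx n (K_val F) x)) y = dd (?Y i) (dd (?Y m) (dd ?X ?K)) (x, y)"
    by (rule pd2[OF sdd[OF sdd[OF sK]] xy], rule pd2[OF sdd[OF sK]]) (use dxK in auto)
  also have "\<dots> = dd (?Y i) (dd ?X (dd (?Y m) ?K)) (x, y)"
    by (rule cong[OF xy comm[OF sK]])
  also have "\<dots> = dd ?X (dd (?Y i) (dd (?Y m) ?K)) (x, y)"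
    by (rule comm[OF sdd[OF sK] xy])
  also have "\<dots> = dd ?X (\<lambda>p. ?K p * dd (?Y i) ?f p * dd (?Y m) ?f p) (x, y)"
    by (rule cong[OF xy H])
  also have "\<dots> = ?K (x, y) * dd (?Y i) ?f (x, y) * dd ?X (dd (?Y m) ?f) (x, y)
      + (?K (x, y) * dd ?X (dd (?Y i) ?f) (x, y) + dd ?X ?K (x, y) * dd (?Y i) ?f (x, y)) * dd (?Y m) ?f (x, y)"
    by (simp add: mult[OF smooth_on_mult[OF W(1) sK sdd[OF s]] sdd[OF s] xy] mult[OF sK sdd[OF s] xy])
  finally show ?thesis by (simp add: mixed pdf[OF xy] dxK[OF xy] algebra_simps)
qed

lemma inner_2: "(a :: real^2) \<bullet> b = a $ 1 * b $ 1 + a $ 2 * b $ 2"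
  by (simp add: inner_vec_def sum_2)

text \<open>Contracting \<open>N\<close> with \<open>dK\<close> and with \<open>d\<theta> = m / K\<close> uses only \<open>dK(l) = 1\<close>, \<open>m(l) = 0\<close>, \<open>dK(m^i) = 0\<close> and \<open>m(m^i) = 1\<close>.\<close>

lemma connection_of_determination:
  fixes k :: "real^2 \<Rightarrow> real^2"
  assumes W: "open W" "W \<subseteq> slit_bundle" and s: "smooth_on W (\<lambda>p. \<phi> (fst p) (snd p))"
    and d: "\<And>x y. (x, y) \<in> W \<Longrightarrow> (\<phi> x has_derivative (\<lambda>w. (m_cov F x y \<bullet> w) / K_val F x y)) (at y)"
    and x: "x \<in> X"
  defines "V \<equiv> {y. (x, y) \<in> W}" and "N \<equiv> N_coeff F k \<phi>"
  shows "smooth_connection_on N x V" "angle_preserving_at F k \<phi> N x V"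
proof -
  have V: "open V" unfolding V_def by (rule open_slice[OF W(1)])
  have V0: "V \<subseteq> - {0}" using W(2) by (auto simp: V_def)
  have sdx: "smooth_on V (dx n \<phi> x)" "smooth_on V (dx n (K_val F) x)" for n
    unfolding V_def using smooth_on_dx[OF W(1) s] smooth_on_dx[OF W(1) smooth_on_subset[OF smooth_K W(2)]] by auto
  have s\<phi>: "smooth_on V (\<phi> x)" unfolding V_def using smooth_on_slice[OF W(1) s, of x] by simp
  have sK: "smooth_on V (K_val F x)" "smooth_on V (l_vec F x)" "smooth_on V (m_vec F x)"
    using fiber_smooth_K[OF x] fiber_smooth_l[OF x] fiber_smooth_m[OF x] V0 by (auto intro: smooth_on_subset)
  have sQ: "smooth_on V (\<lambda>y. dx n \<phi> x y - k x $ n)" for n by (intro smooth_on_diff smooth_on_const sdx V)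
  have sN: "smooth_on V (\<lambda>y. N x y i n)" for i n
    unfolding N_def N_coeff_def
    by (intro smooth_on_diff smooth_on_mult smooth_on_minus smooth_on_linear[OF bounded_linear_vec_nth] sdx sK sQ V)
  show "smooth_connection_on N x V" by (rule smooth_connection_onI[where N=N, OF V sN])
  have y0: "y \<noteq> 0" if "y \<in> V" for y using V0 that by auto
  have pd\<phi>: "pd i (\<phi> x) y = m_cov F x y $ i / K_val F x y" if "y \<in> V" for y i
    using pd_eqI[OF d] that by (simp add: V_def inner_axis)
  have I: "N x y 1 n * pd 1 (K_val F x) y + N x y 2 n * pd 2 (K_val F x) y = - dx n (K_val F) x y" if y: "y \<in> V" for y n
  proof -
    have "N x y 1 n * pd 1 (K_val F x) y + N x y 2 n * pd 2 (K_val F x) y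
        = - (l_cov x y \<bullet> l_vec F x y) * dx n (K_val F) x y
          - K_val F x y * (l_cov x y \<bullet> m_vec F x y) * (dx n \<phi> x y - k x $ n)"
      unfolding N_def N_coeff_def inner_2 pd_K_l[OF x y0[OF y]] by (simp add: algebra_simps)
    also have "l_cov x y \<bullet> l_vec F x y = 1"
      using l_cov_radial[OF x y0[OF y]] K_pos[OF x y0[OF y]] by (simp add: l_vec_def)
    finally show ?thesis using m_vec_inner[OF x y0[OF y]] by simp
  qed
  have II: "N x y 1 n * pd 1 (\<phi> x) y + N x y 2 n * pd 2 (\<phi> x) y = - (dx n \<phi> x y - k x $ n)" if y: "y \<in> V" for y n
  proof -
    have "K_val F x y * (N x y 1 n * pd 1 (\<phi> x) y + N x y 2 n * pd 2 (\<phi> x) y)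
        = - (m_cov F x y \<bullet> l_vec F x y) * dx n (K_val F) x y
          - K_val F x y * (m_cov F x y \<bullet> m_vec F x y) * (dx n \<phi> x y - k x $ n)"
      unfolding N_def N_coeff_def inner_2 pd\<phi>[OF y] using K_pos[OF x y0[OF y]] by (simp add: field_simps)
    also have "m_cov F x y \<bullet> l_vec F x y = 0"
      using m_cov_radial[OF x y0[OF y]] by (simp add: l_vec_def)
    finally have "K_val F x y * (N x y 1 n * pd 1 (\<phi> x) y + N x y 2 n * pd 2 (\<phi> x) y) = K_val F x y * (- (dx n \<phi> x y - k x $ n))"
      using m_vec_inner[OF x y0[OF y]] by (simp add: algebra_simps)
    then show ?thesis using K_pos[OF x y0[OF y]] by (metis mult_cancel_left order_less_irrefl)
  qed
  have H: "pd j (pd i (K_val F x)) y = K_val F x y * pd j (\<phi> x) y * pd i (\<phi> x) y" if y: "y \<in> V" for y i j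
    using K_pos[OF x y0[OF y]] by (simp add: pd_pd_K[OF x y0[OF y]] pd\<phi>[OF y] m_cov_eq[OF x y0[OF y]])
  have third: "pd 1 (K_val F x) y * pd m (pd i (\<lambda>z. N x z 1 n)) y + pd 2 (K_val F x) y * pd m (pd i (\<lambda>z. N x z 2 n)) y = 0" if y: "y \<in> V" for y m i n
  proof (rule transport_second_derivative[OF V sK(1) s\<phi> sdx(2) sQ sN I II H _ y])
    have pdQ: "pd i (\<lambda>y. dx n \<phi> x y - k x $ n) z = pd i (dx n \<phi> x) z" if z: "z \<in> V" for z i
      using pd_eqI[OF has_derivative_diff[OF smooth_on_has_derivative[OF sdx(1) z] has_derivative_const], of i n "k x $ n"]
      by (simp add: pd_def)
    fix z assume z: "z \<in> V"
    show "pd m (pd i (dx n (K_val F) x)) z = dx n (K_val F) x z * pd m (\<phi> x) z * pd i (\<phi> x) z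
        + K_val F x z * pd m (\<lambda>y. dx n \<phi> x y - k x $ n) z * pd i (\<phi> x) z
        + K_val F x z * pd m (\<phi> x) z * pd i (\<lambda>y. dx n \<phi> x y - k x $ n) z"
      unfolding pdQ[OF z] by (rule pd_pd_dx_K[OF W s d]) (use z in \<open>auto simp: V_def\<close>)
  qed
  show "angle_preserving_at F k \<phi> N x V"
    unfolding angle_preserving_at_def
  proof (intro conjI allI ballI)
    fix n y assume y: "y \<in> V"
    show "d_op N n (K_val F) x y = 0" "d_op N n \<phi> x y = k x $ n"
      using I[OF y, of n] II[OF y, of n] by (simp_all add: d_op_def sum_2)
    show "(\<Sum>j\<in>UNIV. y_low F x y $ j * pd m (pd i (\<lambda>z. N x z j n)) y) = 0" for m i
    proof -
      have "(\<Sum>j\<in>UNIV. y_low F x y $ j * pd m (pd i (\<lambda>z. N x z j n)) y)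
        = K_val F x y * (pd 1 (K_val F x) y * pd m (pd i (\<lambda>z. N x z 1 n)) y + pd 2 (K_val F x) y * pd m (pd i (\<lambda>z. N x z 2 n)) y)"
        by (simp add: sum_2 y_low_eq[OF x y0[OF y]] pd_K_l[OF x y0[OF y]] algebra_simps)
      then show ?thesis unfolding third[OF y] by simp
    qed
  next
    fix n y1 y2 assume y: "y1 \<in> V" "y2 \<in> V"
    have D1: "((\<lambda>z. \<phi> z y) has_derivative (\<lambda>w. frechet_derivative (\<lambda>p. \<phi> (fst p) (snd p)) (at (x, y)) (w, 0))) (at x)" if "y \<in> V" for y
      using smooth_on_slice_has_derivative(1)[OF s, of x y] that by (simp add: V_def)
    have "pd n (\<lambda>z. \<phi> z y2 - \<phi> z y1) x = dx n \<phi> x y2 - dx n \<phi> x y1"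
      using pd_eqI[OF has_derivative_diff[OF D1[OF y(2)] D1[OF y(1)]]] pd_eqI[OF D1[OF y(1)]] pd_eqI[OF D1[OF y(2)]]
      by (simp add: dx_def)
    moreover have "pd i (\<lambda>z. \<phi> x y2 - \<phi> x z) y1 = - pd i (\<phi> x) y1" for i
      using pd_eqI[OF has_derivative_diff[OF has_derivative_const smooth_on_has_derivative[OF s\<phi> y(1)]], of i "\<phi> x y2"] by (simp add: pd_def)
    moreover have "pd i (\<lambda>z. \<phi> x z - \<phi> x y1) y2 = pd i (\<phi> x) y2" for i
      using pd_eqI[OF has_derivative_diff[OF smooth_on_has_derivative[OF s\<phi> y(2)] has_derivative_const], of i "\<phi> x y1"] by (simp add: pd_def)
    ultimately show "d_op2 N n (\<lambda>z u v. \<phi> z v - \<phi> z u) x y1 y2 = 0"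
      using II[OF y(1), of n] II[OF y(2), of n] by (simp add: d_op2_def sum_2)
  qed
qed

end

section \<open>Determinations of the angle\<close>

context finsleroid_chart
begin

definition "lift_angle a x y = angle_primitive (c x) (g x) (a x y)"

definition "agrees_with_Theta \<theta> \<longleftrightarrow> (\<forall>x\<in>X. \<forall>y. y \<noteq> 0 \<longrightarrow> \<theta> x y = Theta x y)"

lemma smooth_theta_max: "smooth_on X (theta_max F)"
proof -
  have "smooth_on X (\<lambda>x. angle_primitive (c x) (g x) (2 * pi))"
    by (intro smooth_on_angle_primitive smooth_fields smooth_on_const open_X norm_b charge)
  then show ?thesis by (rule smooth_on_cong[OF open_X, rotated]) (simp add: theta_max)
qed

lemma theta_max_continuous: "W \<subseteq> X \<times> T \<Longrightarrow> continuous_on W (\<lambda>p. theta_max F (fst p))"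
  by (rule continuous_on_compose2[OF smooth_on_imp_continuous_on[OF smooth_theta_max]])
    (auto intro: continuous_intros)

text \<open>The quotient of the difference by \<open>\<theta>max > 0\<close> is continuous with integer values, hence constant on the
  set where it is within distance \<open>1\<close> of its value at the given point.\<close>

lemma branches_locally:
  assumes b1: "angle_branch F X \<theta> W \<phi>" and b2: "angle_branch F X \<theta> W' \<psi>" and p: "(x, y) \<in> W" "(x, y) \<in> W'"
  obtains U and j :: int where "open U" "(x, y) \<in> U" "U \<subseteq> W" "U \<subseteq> W'"
    "\<And>x y. (x, y) \<in> U \<Longrightarrow> \<phi> x y = \<psi> x y + of_int j * theta_max F x"
proof -
  have W: "open W" "W \<subseteq> X \<times> (- {0})" "continuous_on W (\<lambda>p. \<phi> (fst p) (snd p))"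
    and i1: "\<And>x y. (x, y) \<in> W \<Longrightarrow> \<exists>j::int. \<phi> x y = \<theta> x y + of_int j * theta_max F x"
    and W': "open W'" "continuous_on W' (\<lambda>p. \<psi> (fst p) (snd p))"
    and i2: "\<And>x y. (x, y) \<in> W' \<Longrightarrow> \<exists>j::int. \<psi> x y = \<theta> x y + of_int j * theta_max F x"
    using b1 b2 unfolding angle_branch_def split_beta by fastforce+
  define r where "r = (\<lambda>p. (\<phi> (fst p) (snd p) - \<psi> (fst p) (snd p)) / theta_max F (fst p))"
  let ?I = "W \<inter> W'"
  have oI: "open ?I" using W W' by auto
  have rint: "\<exists>j::int. r p = of_int j" if "p \<in> ?I" for p
  proof -
    obtain x y where xy: "p = (x, y)" by fastforce
    have m: "(x, y) \<in> W" "(x, y) \<in> W'" using that xy by auto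
    obtain j1 j2 :: int where j: "\<phi> x y = \<theta> x y + of_int j1 * theta_max F x" "\<psi> x y = \<theta> x y + of_int j2 * theta_max F x"
      using i1[OF m(1)] i2[OF m(2)] by blast
    have "theta_max F x > 0" using that xy W(2) by (intro theta_max_pos) auto
    then have "r p = of_int (j1 - j2)" by (simp add: r_def xy j flip: left_diff_distrib)
    then show ?thesis by blast
  qed
  have "continuous_on ?I r"
    unfolding r_def
  proof (intro continuous_on_divide continuous_on_diff)
    show "continuous_on ?I (\<lambda>p. \<phi> (fst p) (snd p))" "continuous_on ?I (\<lambda>p. \<psi> (fst p) (snd p))"
      by (rule continuous_on_subset[OF W(3) Int_lower1], rule continuous_on_subset[OF W'(2) Int_lower2])
    show "continuous_on ?I (\<lambda>p. theta_max F (fst p))"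
      by (rule theta_max_continuous[of _ "- {0}"]) (use W in auto)
    show "\<forall>p\<in>?I. theta_max F (fst p) \<noteq> 0"
      using theta_max_pos W(2) by fastforce
  qed
  then have oU: "open (?I \<inter> r -` ball (r (x, y)) 1)"
    by (rule continuous_open_preimage[OF _ oI open_ball])
  obtain j :: int where j: "r (x, y) = of_int j" using rint p by blast
  have "\<phi> x' y' = \<psi> x' y' + of_int j * theta_max F x'" if q: "(x', y') \<in> ?I \<inter> r -` ball (r (x, y)) 1" for x' y'
  proof -
    obtain i :: int where i: "r (x', y') = of_int i" using rint q by blast
    have "\<bar>real_of_int j - real_of_int i\<bar> < 1" using q by (simp add: i j dist_real_def)
    then have "\<bar>j - i\<bar> < 1" by linarith
    then have "r (x', y') = of_int j" using i by simp
    moreover have "theta_max F x' > 0" using q W(2) by (intro theta_max_pos) auto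
    ultimately show ?thesis by (simp add: r_def field_simps)
  qed
  with oU p show ?thesis by (intro that[of "?I \<inter> r -` ball (r (x, y)) 1" j]) auto
qed

text \<open>Two polar angles differ by a multiple of \<open>2 pi\<close>, which the primitive turns into a multiple of \<open>\<theta>max\<close>.\<close>

lemma lift_branch:
  assumes "agrees_with_Theta \<theta>" "polar_lift W a"
  shows "angle_branch F X \<theta> W (lift_angle a)"
proof -
  have W: "open W" "W \<subseteq> slit_bundle" 
    and uv: "\<And>x y. (x, y) \<in> W \<Longrightarrow> u x y = rad x y * cos (a x y) \<and> v x y = rad x y * sin (a x y)"
    using assms(2) unfolding polar_lift_def by auto
  have "\<exists>j::int. lift_angle a x y = \<theta> x y + of_int j * theta_max F x" if xy: "(x, y) \<in> W" for x y
  proof -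
    have x: "x \<in> X" "y \<noteq> 0" using xy W by auto
    interpret finsleroid_parameters "c x" "g x" by (rule parameters[OF x(1)])
    have "sin (a x y) = sin (polar x y) \<and> cos (a x y) = cos (polar x y)"
      using uv[OF xy] polar_trig[OF x] rad_pos[OF x] by auto
    then obtain n :: int where n: "a x y = polar x y + 2 * pi * n" using sin_cos_eq_iff by blast
    have up: "angle_primitive (c x) (g x) (t + 2 * pi * real m) = angle_primitive (c x) (g x) t + real m * theta_max F x" for t and m :: nat
    proof (induction m)
      case (Suc m)
      have "angle_primitive (c x) (g x) (t + 2 * pi * real (Suc m)) = angle_primitive (c x) (g x) ((t + 2 * pi * real m) + 2 * pi)"
        by (simp add: algebra_simps)
      then show ?case unfolding primitive_period Suc theta_max[OF x(1)] by (simp add: algebra_simps)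
    qed simp
    have "angle_primitive (c x) (g x) (t + 2 * pi * real_of_int n) = angle_primitive (c x) (g x) t + real_of_int n * theta_max F x" for t
    proof (cases n)
      case (nonneg m)
      then show ?thesis using up[of t m] by simp
    next
      case (neg m)
      have "angle_primitive (c x) (g x) (t + 2 * pi * real_of_int n + 2 * pi * real (Suc m))
        = angle_primitive (c x) (g x) (t + 2 * pi * real_of_int n) + real (Suc m) * theta_max F x"
        by (rule up)
      moreover have "t + 2 * pi * real_of_int n + 2 * pi * real (Suc m) = t"
        unfolding neg by (simp add: algebra_simps)
      ultimately show ?thesis unfolding neg by (simp add: algebra_simps)
    qed
    then show ?thesis using assms(1) x n by (auto simp: lift_angle_def agrees_with_Theta_def Theta_def)
  qed
  moreover have "continuous_on W (\<lambda>(x, y). lift_angle a x y)"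
    using smooth_on_imp_continuous_on[OF polar_lift_smooth[OF assms(2)]] by (simp add: lift_angle_def split_beta)
  ultimately show ?thesis using W unfolding angle_branch_def by auto
qed

lemma slit_angle:
  assumes "agrees_with_Theta \<theta>" "(x, y) \<in> slit_region"
  shows "\<theta> x y = lift_angle slit_polar x y"
proof -
  have "x \<in> X" "y \<noteq> 0" using assms(2) regions_subset(2) by auto
  then show ?thesis
    using assms by (simp add: agrees_with_Theta_def Theta_def lift_angle_def polar_slit)
qed

text \<open>On the half plane \<open>u > 0\<close> the polar angle in \<open>(- pi/2, pi/2)\<close> is the one in \<open>[0, 2 pi)\<close> for \<open>v \<ge> 0\<close> and lies one
  period below it for \<open>v < 0\<close>, which matches the definition of \<open>north_angle\<close>.\<close>

lemma north_angle_lift: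
  assumes "agrees_with_Theta \<theta>" "(x, y) \<in> north_region"
  shows "north_angle F \<theta> x y = lift_angle north_polar x y"
proof -
  have x: "x \<in> X" "y \<noteq> 0" and u: "u x y > 0" using assms(2) by (auto simp: north_region_iff)
  interpret finsleroid_parameters "c x" "g x" by (rule parameters[OF x(1)])
  have uv: "u x y = rad x y * cos (north_polar x y)" "v x y = rad x y * sin (north_polar x y)"
    using north_polar_lift assms(2) by (auto simp: polar_lift_def)
  have th: "\<theta> x y = angle_primitive (c x) (g x) (polar x y)" using assms(1) x by (simp add: agrees_with_Theta_def Theta_def)
  have b: "- (pi / 2) < north_polar x y" "north_polar x y < pi / 2"
    unfolding north_polar_def by (rule arctan_lbound arctan_ubound)+
  show ?thesis
  proof (cases "v x y \<ge> 0")
    case True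
    then have "0 \<le> north_polar x y" using u by (simp add: north_polar_def)
    then have "polar x y = north_polar x y"
      using uv b pi_gt_zero by (intro polar_unique[OF x _ _ rad_pos[OF x]]) auto
    then show ?thesis using True th by (simp add: north_angle_def n_val_def lift_angle_def)
  next
    case False
    then have "north_polar x y < 0" using u by (simp add: north_polar_def divide_less_0_iff)
    then have "polar x y = north_polar x y + 2 * pi"
      using uv b by (intro polar_unique[OF x _ _ rad_pos[OF x]]) auto
    then show ?thesis using False th primitive_period
      by (simp add: north_angle_def n_val_def lift_angle_def theta_max[OF x(1)])
  qed
qed

lemma branch_cong:
  assumes "angle_branch F X \<theta> W \<phi>" "\<And>x y. (x, y) \<in> W \<Longrightarrow> \<psi> x y = \<phi> x y"
  shows "angle_branch F X \<theta> W \<psi>"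
proof -
  have "continuous_on W (\<lambda>(x, y). \<psi> x y) \<longleftrightarrow> continuous_on W (\<lambda>(x, y). \<phi> x y)"
    using assms(2) by (intro continuous_on_cong) auto
  then show ?thesis using assms unfolding angle_branch_def by auto
qed

lemma north_branch: "agrees_with_Theta \<theta> \<Longrightarrow> angle_branch F X \<theta> north_region (north_angle F \<theta>)"
  by (rule branch_cong[OF lift_branch[OF _ north_polar_lift] north_angle_lift])

lemma slit_branch: "agrees_with_Theta \<theta> \<Longrightarrow> angle_branch F X \<theta> slit_region \<theta>"
  by (rule branch_cong[OF lift_branch[OF _ slit_polar_lift] slit_angle])

lemma branch_near_lift:
  assumes "agrees_with_Theta \<theta>" "angle_branch F X \<theta> W \<phi>" "(x, y) \<in> W" "polar_lift W' a" "(x, y) \<in> W'"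
  obtains U and j :: int where "open U" "(x, y) \<in> U" "U \<subseteq> W" "polar_lift U a"
    "\<And>x y. (x, y) \<in> U \<Longrightarrow> \<phi> x y = lift_angle a x y + of_int j * theta_max F x"
proof -
  obtain U and j :: int where U: "open U" "(x, y) \<in> U" "U \<subseteq> W" "U \<subseteq> W'"
    "\<And>x y. (x, y) \<in> U \<Longrightarrow> \<phi> x y = lift_angle a x y + of_int j * theta_max F x"
    by (rule branches_locally[OF assms(2) lift_branch[OF assms(1,4)] assms(3,5)]) blast
  have "polar_lift U a"
    using assms(4) U(1,4) unfolding polar_lift_def by (auto intro: smooth_on_subset)
  then show ?thesis using U that by blast
qed

lemma lift_exists:
  assumes "x \<in> X" "y \<noteq> 0"
  obtains W a where "polar_lift W a" "(x, y) \<in> W"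
  using regions_cover[OF assms] north_polar_lift slit_polar_lift by blast

lemma branch_smooth:
  assumes "agrees_with_Theta \<theta>" "angle_branch F X \<theta> W \<phi>"
  shows "smooth_on W (\<lambda>p. \<phi> (fst p) (snd p))"
    and "(x, y) \<in> W \<Longrightarrow> (\<phi> x has_derivative (\<lambda>w. (m_cov F x y \<bullet> w) / K_val F x y)) (at y)"
proof -
  have W: "open W" "W \<subseteq> slit_bundle" using assms(2) by (auto simp: angle_branch_def)
  have loc: "\<exists>U a j. open U \<and> (x, y) \<in> U \<and> U \<subseteq> W \<and> polar_lift U a \<and>
      (\<forall>x y. (x, y) \<in> U \<longrightarrow> \<phi> x y = lift_angle a x y + of_int j * theta_max F x)" if xy: "(x, y) \<in> W" for x y
  proof -
    have "x \<in> X" "y \<noteq> 0" using xy W by auto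
    from lift_exists[OF this] obtain W' a where a: "polar_lift W' a" "(x, y) \<in> W'" .
    obtain U and j :: int where "open U" "(x, y) \<in> U" "U \<subseteq> W" "polar_lift U a"
      "\<And>x y. (x, y) \<in> U \<Longrightarrow> \<phi> x y = lift_angle a x y + of_int j * theta_max F x"
      by (rule branch_near_lift[OF assms xy a]) blast
    then show ?thesis by (intro exI[of _ U] exI[of _ a] exI[of _ j]) auto
  qed
  show "smooth_on W (\<lambda>p. \<phi> (fst p) (snd p))"
  proof (rule smooth_on_local)
    fix p assume "p \<in> W"
    then obtain U a j where U: "open U" "p \<in> U" "U \<subseteq> W" "polar_lift U a"
      and eq: "\<forall>x y. (x, y) \<in> U \<longrightarrow> \<phi> x y = lift_angle a x y + of_int j * theta_max F x"
      using loc[of "fst p" "snd p"] unfolding prod.collapse by blast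
    have "smooth_on U (\<lambda>p. theta_max F (fst p))"
      using U W by (intro smooth_on_compose[OF U(1) open_X _ smooth_on_bounded_linear[OF bounded_linear_fst U(1)] smooth_theta_max]) auto
    then have "smooth_on U (\<lambda>p. angle_primitive (c (fst p)) (g (fst p)) (a (fst p) (snd p)) + of_int j * theta_max F (fst p))"
      by (intro smooth_on_add smooth_on_mult smooth_on_const polar_lift_smooth U)
    then have "smooth_on U (\<lambda>p. \<phi> (fst p) (snd p))"
      by (rule smooth_on_cong[OF U(1), rotated]) (simp add: eq lift_angle_def)
    then show "\<exists>U. open U \<and> p \<in> U \<and> smooth_on U (\<lambda>p. \<phi> (fst p) (snd p))" using U by blast
  qed
  assume xy: "(x, y) \<in> W"
  then obtain U a j where U: "open U" "(x, y) \<in> U" "polar_lift U a"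
    and eq: "\<forall>x y. (x, y) \<in> U \<longrightarrow> \<phi> x y = lift_angle a x y + of_int j * theta_max F x"
    using loc[of x y] by blast
  have "((\<lambda>y. angle_primitive (c x) (g x) (a x y) + of_int j * theta_max F x) has_derivative (\<lambda>w. (m_cov F x y \<bullet> w) / K_val F x y)) (at y)"
    using has_derivative_add[OF polar_lift_has_derivative[OF U(3,2)] has_derivative_const] by simp
  then show "(\<phi> x has_derivative (\<lambda>w. (m_cov F x y \<bullet> w) / K_val F x y)) (at y)"
    by (rule has_derivative_transform_within_open[OF _ open_slice[OF U(1)]]) (use U eq in \<open>auto simp: lift_angle_def\<close>)
qed

text \<open>Locally the two determinations differ by \<open>j \<theta>max\<close>, which contributes \<open>j \<partial>_n \<theta>max\<close>.\<close>

lemma dx_branches: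
  assumes "agrees_with_Theta \<theta>" "angle_branch F X \<theta> W \<phi>" "angle_branch F X \<theta> W' \<psi>" "(x, y) \<in> W" "(x, y) \<in> W'"
    and stat: "pd n (theta_max F) x = 0"
  shows "dx n \<phi> x y = dx n \<psi> x y"
proof -
  obtain U and j :: int where U: "open U" "(x, y) \<in> U" "U \<subseteq> W" "U \<subseteq> W'"
    and eq: "\<And>x y. (x, y) \<in> U \<Longrightarrow> \<phi> x y = \<psi> x y + of_int j * theta_max F x"
    by (rule branches_locally[OF assms(2-5)]) blast
  have x: "x \<in> X" using assms(2,4) by (auto simp: angle_branch_def)
  have "dx n \<phi> x y = pd n (\<lambda>z. \<psi> z y + of_int j * theta_max F z) x"
    unfolding dx_def by (rule pd_cong_open[OF open_slice'[OF U(1)], of _ y]) (use U eq in auto)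
  also have "\<dots> = dx n \<psi> x y + of_int j * pd n (theta_max F) x"
    using pd_eqI[OF has_derivative_add[OF smooth_on_slice_has_derivative(1)[OF branch_smooth(1)[OF assms(1,3)] assms(5)]
          has_derivative_mult_right[OF smooth_on_has_derivative[OF smooth_theta_max x]]], of n "of_int j"]
      dx_eq[OF branch_smooth(1)[OF assms(1,3)] assms(5)]
    by (simp add: pd_def)
  finally show ?thesis using stat by simp
qed

text \<open>The derivatives of the determinations near the north pole and off the north ray patch together to
  a single function of \<open>y\<close>; every other determination must agree with it.\<close>

lemma stationary_connection:
  fixes k :: "real^2 \<Rightarrow> real^2"
  assumes ext: "agrees_with_Theta \<theta>" and x: "x \<in> X" and stat: "\<And>n. pd n (theta_max F) x = 0"
  shows "\<exists>\<Omega> N. (\<forall>n. smooth_on (- {0}) (\<lambda>y. \<Omega> y n)) \<and> smooth_connection_on N x (- {0}) \<and>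
    (\<forall>W \<phi>. angle_branch F X \<theta> W \<phi> \<longrightarrow> (\<forall>y n. (x, y) \<in> W \<longrightarrow> dx n \<phi> x y = \<Omega> y n \<and>
       (\<forall>i. N_coeff F k \<phi> x y i n = N x y i n)))"
proof -
  define \<Omega> where "\<Omega> y n = (if (x, y) \<in> north_region then dx n (north_angle F \<theta>) x y else dx n \<theta> x y)" for y n
  define N where "N = (\<lambda>x y i n. - l_vec F x y $ i * dx n (K_val F) x y - K_val F x y * m_vec F x y $ i * (\<Omega> y n - k x $ n))"
  have dx\<Omega>: "dx n \<phi> x y = \<Omega> y n" if "angle_branch F X \<theta> W \<phi>" "(x, y) \<in> W" for W \<phi> y n
  proof (cases "(x, y) \<in> north_region")
    case True
    then show ?thesis using dx_branches[OF ext that(1) north_branch[OF ext] that(2) True stat] by (simp add: \<Omega>_def)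
  next
    case False
    have "(x, y) \<in> slit_region" using False regions_cover[of x y] that by (auto simp: angle_branch_def)
    then show ?thesis using False dx_branches[OF ext that(1) slit_branch[OF ext] that(2) _ stat] by (simp add: \<Omega>_def)
  qed
  have s\<Omega>: "smooth_on (- {0}) (\<lambda>y. \<Omega> y n)" for n
  proof (rule smooth_on_local)
    fix y :: "real^2" assume "y \<in> - {0}"
    then have "x \<in> X" "y \<noteq> 0" using x by auto
    then obtain W a where W: "polar_lift W a" "(x, y) \<in> W" by (rule lift_exists)
    then have oW: "open W" and b: "angle_branch F X \<theta> W (lift_angle a)" using lift_branch[OF ext] by (auto simp: polar_lift_def)
    have "smooth_on {y. (x, y) \<in> W} (dx n (lift_angle a) x)"
      by (rule smooth_on_dx[OF oW branch_smooth(1)[OF ext b]])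
    then have "smooth_on {y. (x, y) \<in> W} (\<lambda>y. \<Omega> y n)"
      by (rule smooth_on_cong[OF open_slice[OF oW], rotated]) (use dx\<Omega>[OF b] in auto)
    then show "\<exists>U. open U \<and> y \<in> U \<and> smooth_on U (\<lambda>y. \<Omega> y n)"
      using open_slice[OF oW, of x] W(2) by blast
  qed
  have sdK: "smooth_on (- {0}) (dx n (K_val F) x)" for n
    using smooth_on_dx[OF open_slit_bundle smooth_K, of x n] slice_slit_bundle[OF x] by simp
  have "smooth_connection_on N x (- {0})"
  proof (rule smooth_connection_onI[OF open_nonzero])
    show "smooth_on (- {0}) (\<lambda>y. N x y i n)" for i n
      unfolding N_def
      by (intro smooth_on_diff smooth_on_mult smooth_on_minus smooth_on_linear[OF bounded_linear_vec_nth] smooth_on_const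
          fiber_smooth_l fiber_smooth_K fiber_smooth_m s\<Omega> sdK open_nonzero x)
  qed
  moreover have "N_coeff F k \<phi> x y i n = N x y i n" if "angle_branch F X \<theta> W \<phi>" "(x, y) \<in> W" for W \<phi> y n i
    unfolding N_coeff_def N_def dx\<Omega>[OF that] ..
  ultimately show ?thesis using s\<Omega> dx\<Omega> by blast
qed

end

section \<open>The surface\<close>

lemma finsleroid_chart_of_space:
  assumes "smooth_surface M A" "finsleroid_space A F" "\<kappa> \<in> A"
  shows "finsleroid_chart (F \<kappa>) (chart_image \<kappa>)"
  using assms unfolding finsleroid_chart_def smooth_surface_def finsleroid_space_def by blast

lemma covector_pairing:
  assumes "covector_field A w" "\<kappa> \<in> A" "\<mu> \<in> A" "x \<in> overlap \<kappa> \<mu>"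
  shows "w \<kappa> x \<bullet> y = w \<mu> (transition \<kappa> \<mu> x) \<bullet> (jacobian \<kappa> \<mu> x *v y)"
proof -
  have "w \<kappa> x = transpose (jacobian \<kappa> \<mu> x) *v w \<mu> (transition \<kappa> \<mu> x)"
    using assms unfolding covector_field_def by blast
  then show ?thesis by (simp add: dot_lmul_matrix)
qed

text \<open>\<open>Theta\<close> is built from \<open>c\<close>, \<open>g\<close> and the pairings of \<open>y\<close> with \<open>b~\<close> and \<open>n\<close>, all independent of coordinates.\<close>

lemma angle_function_exists:
  assumes S: "smooth_surface M A" and F: "finsleroid_space A F"
  shows "angle_function A F (\<lambda>\<kappa>. finsleroid_chart.Theta (F \<kappa>))"
proof -
  have "finsleroid_chart.Theta (F \<kappa>) x y = finsleroid_chart.Theta (F \<mu>) (transition \<kappa> \<mu> x) (jacobian \<kappa> \<mu> x *v y)"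
    if k: "\<kappa> \<in> A" "\<mu> \<in> A" "x \<in> overlap \<kappa> \<mu>" for \<kappa> \<mu> x y
  proof -
    interpret K: finsleroid_chart "F \<kappa>" "chart_image \<kappa>" by (rule finsleroid_chart_of_space[OF S F k(1)])
    interpret M: finsleroid_chart "F \<mu>" "chart_image \<mu>" by (rule finsleroid_chart_of_space[OF S F k(2)])
    have f: "covector_field A (\<lambda>\<kappa>. bt_cov (F \<kappa>))" "covector_field A (\<lambda>\<kappa>. n_cov (F \<kappa>))"
      "c_of (F \<kappa>) x = c_of (F \<mu>) (transition \<kappa> \<mu> x)" "g_of (F \<kappa>) x = g_of (F \<mu>) (transition \<kappa> \<mu> x)"
      using F k unfolding finsleroid_space_def scalar_field_def by auto
    show ?thesis
      unfolding K.Theta_def M.Theta_def K.polar_def M.polar_def K.slit_polar_def M.slit_polar_def K.rad_def M.rad_def f(3,4)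
        covector_pairing[OF f(1) k] covector_pairing[OF f(2) k] ..
  qed
  then have "slit_tangent_function A (\<lambda>\<kappa>. finsleroid_chart.Theta (F \<kappa>))"
    unfolding slit_tangent_function_def by blast
  moreover have "\<forall>\<kappa>\<in>A. \<forall>x\<in>chart_image \<kappa>.
        (\<forall>y r. y \<noteq> 0 \<and> 0 < r \<longrightarrow> finsleroid_chart.Theta (F \<kappa>) x (r *\<^sub>R y) = finsleroid_chart.Theta (F \<kappa>) x y) \<and>
        finsleroid_chart.Theta (F \<kappa>) x (b_vec (F \<kappa>) x) = 0 \<and>
        (\<forall>y. y \<noteq> 0 \<longrightarrow> 0 \<le> finsleroid_chart.Theta (F \<kappa>) x y \<and> finsleroid_chart.Theta (F \<kappa>) x y < theta_max (F \<kappa>) x) \<and>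
        (\<forall>y. n_val (F \<kappa>) x y > 0 \<or> n_val (F \<kappa>) x y < 0 \<or> b_val (F \<kappa>) x y < 0 \<longrightarrow>
           (finsleroid_chart.Theta (F \<kappa>) x has_derivative (\<lambda>v. (m_cov (F \<kappa>) x y \<bullet> v) / K_val (F \<kappa>) x y)) (at y))"
  proof (intro ballI)
    fix \<kappa> x assume k: "\<kappa> \<in> A" and x: "x \<in> chart_image \<kappa>"
    interpret K: finsleroid_chart "F \<kappa>" "chart_image \<kappa>" by (rule finsleroid_chart_of_space[OF S F k])
    show "(\<forall>y r. y \<noteq> 0 \<and> 0 < r \<longrightarrow> K.Theta x (r *\<^sub>R y) = K.Theta x y) \<and> K.Theta x (b_vec (F \<kappa>) x) = 0 \<and>
        (\<forall>y. y \<noteq> 0 \<longrightarrow> 0 \<le> K.Theta x y \<and> K.Theta x y < theta_max (F \<kappa>) x) \<and>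
        (\<forall>y. n_val (F \<kappa>) x y > 0 \<or> n_val (F \<kappa>) x y < 0 \<or> b_val (F \<kappa>) x y < 0 \<longrightarrow>
           (K.Theta x has_derivative (\<lambda>v. (m_cov (F \<kappa>) x y \<bullet> v) / K_val (F \<kappa>) x y)) (at y))"
      using K.Theta_scale[OF x] K.Theta_b_vec[OF x] K.Theta_range[OF x] K.Theta_has_derivative[of x] x
      by (auto simp: K.slit_region_def)
  qed
  ultimately show ?thesis unfolding angle_function_def by blast
qed

lemma angle_function_agrees_with_Theta:
  assumes "smooth_surface M A" "finsleroid_space A F" "angle_function A F \<theta>" "\<kappa> \<in> A"
  shows "finsleroid_chart.agrees_with_Theta (F \<kappa>) (chart_image \<kappa>) (\<theta> \<kappa>)"
proof -
  interpret finsleroid_chart "F \<kappa>" "chart_image \<kappa>" by (rule finsleroid_chart_of_space[OF assms(1,2,4)])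
  have "\<theta> \<kappa> x y = Theta x y" if x: "x \<in> chart_image \<kappa>" and y: "y \<noteq> 0" for x y
    by (rule angle_unique[OF x _ _ _ _ _ y]) (use assms(3,4) x in \<open>auto simp: angle_function_def slit_region_def\<close>)
  then show ?thesis by (simp add: agrees_with_Theta_def)
qed

theorem mainTheorem8:
  fixes M :: "'m topology" and A :: "'m chart set"
    and F :: "'m chart \<Rightarrow> fields" and k :: "'m chart \<Rightarrow> real^2 \<Rightarrow> real^2"
  assumes "smooth_surface M A"
    and "finsleroid_space A F"
    and "covector_field A k"
  shows "(\<exists>\<theta>. angle_function A F \<theta>) \<and>
    (\<forall>\<theta>. angle_function A F \<theta> \<longrightarrow>
      (\<forall>\<kappa>\<in>A.
        \<comment> \<open>every nonzero tangent vector lies in a chart over which the angle has a determination\<close>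
        angle_branch (F \<kappa>) (chart_image \<kappa>) (\<theta> \<kappa>)
          {(x, y). x \<in> chart_image \<kappa> \<and> b_val (F \<kappa>) x y > 0} (north_angle (F \<kappa>) (\<theta> \<kappa>)) \<and>
        angle_branch (F \<kappa>) (chart_image \<kappa>) (\<theta> \<kappa>)
          {(x, y). x \<in> chart_image \<kappa> \<and>
             (n_val (F \<kappa>) x y > 0 \<or> n_val (F \<kappa>) x y < 0 \<or> b_val (F \<kappa>) x y < 0)} (\<theta> \<kappa>) \<and>
        (\<forall>x\<in>chart_image \<kappa>.
          \<comment> \<open>regularity of the metric ingredients on the whole slit tangent plane\<close>
          (\<forall>y. y \<noteq> 0 \<longrightarrow> invertible (g_low (F \<kappa>) x y)) \<and>
          smooth_on (- {0}) (K_val (F \<kappa>) x) \<and>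
          smooth_on (- {0}) (l_vec (F \<kappa>) x) \<and>
          smooth_on (- {0}) (m_vec (F \<kappa>) x) \<and>
          (\<forall>y. y \<noteq> 0 \<longrightarrow> (\<lambda>z. K_val (F \<kappa>) z y) differentiable (at x)) \<and>
          (\<forall>n. smooth_on (- {0}) (dx n (K_val (F \<kappa>)) x)) \<and>
          \<comment> \<open>regularity of the angle and of the connection, for every determination anywhere\<close>
          (\<forall>W \<phi>. angle_branch (F \<kappa>) (chart_image \<kappa>) (\<theta> \<kappa>) W \<phi> \<longrightarrow>
            (let V = {y. (x, y) \<in> W}; N = N_coeff (F \<kappa>) (k \<kappa>) \<phi> in
              smooth_on V (\<phi> x) \<and>
              (\<forall>y\<in>V. (\<phi> x has_derivative
                 (\<lambda>v. (m_cov (F \<kappa>) x y \<bullet> v) / K_val (F \<kappa>) x y)) (at y)) \<and>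
              (\<forall>y\<in>V. (\<lambda>z. \<phi> z y) differentiable (at x)) \<and>
              (\<forall>n. smooth_on V (dx n \<phi> x)) \<and>
              smooth_connection_on N x V \<and>
              angle_preserving_at (F \<kappa>) (k \<kappa>) \<phi> N x V)) \<and>
          \<comment> \<open>no dependence on the determination where the total angle is stationary\<close>
          ((\<forall>n. pd n (theta_max (F \<kappa>)) x = 0) \<longrightarrow>
            (\<exists>\<Omega> N. (\<forall>n. smooth_on (- {0}) (\<lambda>y. \<Omega> y n)) \<and>
              smooth_connection_on N x (- {0}) \<and>
              (\<forall>W \<phi>. angle_branch (F \<kappa>) (chart_image \<kappa>) (\<theta> \<kappa>) W \<phi> \<longrightarrow>
                (\<forall>y n. (x, y) \<in> W \<longrightarrow> dx n \<phi> x y = \<Omega> y n \<and>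
                   (\<forall>i. N_coeff (F \<kappa>) (k \<kappa>) \<phi> x y i n = N x y i n))))))))"
proof (intro conjI allI impI ballI)
  show "\<exists>\<theta>. angle_function A F \<theta>"
    using angle_function_exists[OF assms(1,2)] by blast
next
  fix \<theta> \<kappa> assume \<theta>: "angle_function A F \<theta>" and \<kappa>: "\<kappa> \<in> A"
  interpret finsleroid_chart "F \<kappa>" "chart_image \<kappa>" by (rule finsleroid_chart_of_space[OF assms(1,2) \<kappa>])
  have ext: "agrees_with_Theta (\<theta> \<kappa>)" by (rule angle_function_agrees_with_Theta[OF assms(1,2) \<theta> \<kappa>])
  show "angle_branch (F \<kappa>) (chart_image \<kappa>) (\<theta> \<kappa>)
      {(x, y). x \<in> chart_image \<kappa> \<and> b_val (F \<kappa>) x y > 0} (north_angle (F \<kappa>) (\<theta> \<kappa>))"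
    using north_branch[OF ext] by (simp add: north_region_def)
  show "angle_branch (F \<kappa>) (chart_image \<kappa>) (\<theta> \<kappa>)
      {(x, y). x \<in> chart_image \<kappa> \<and> (n_val (F \<kappa>) x y > 0 \<or> n_val (F \<kappa>) x y < 0 \<or> b_val (F \<kappa>) x y < 0)} (\<theta> \<kappa>)"
    using slit_branch[OF ext] by (simp add: slit_region_def)
  fix x assume x: "x \<in> chart_image \<kappa>"
  show "invertible (g_low (F \<kappa>) x y)" if "y \<noteq> 0" for y by (rule invertible_g_low[OF x that])
  show "smooth_on (- {0}) (K_val (F \<kappa>) x)" "smooth_on (- {0}) (l_vec (F \<kappa>) x)" "smooth_on (- {0}) (m_vec (F \<kappa>) x)"
    using fiber_smooth_K[OF x] fiber_smooth_l[OF x] fiber_smooth_m[OF x] .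
  show "(\<lambda>z. K_val (F \<kappa>) z y) differentiable (at x)" if "y \<noteq> 0" for y
    using smooth_on_slice_has_derivative(1)[OF smooth_K, of x y] x that by (auto simp: differentiable_def)
  show "smooth_on (- {0}) (dx n (K_val (F \<kappa>)) x)" for n
    using smooth_on_dx[OF open_slit_bundle smooth_K, of x n] slice_slit_bundle[OF x] by simp
  show "let V = {y. (x, y) \<in> W}; N = N_coeff (F \<kappa>) (k \<kappa>) \<phi> in
      smooth_on V (\<phi> x) \<and>
      (\<forall>y\<in>V. (\<phi> x has_derivative (\<lambda>v. (m_cov (F \<kappa>) x y \<bullet> v) / K_val (F \<kappa>) x y)) (at y)) \<and>
      (\<forall>y\<in>V. (\<lambda>z. \<phi> z y) differentiable (at x)) \<and>
      (\<forall>n. smooth_on V (dx n \<phi> x)) \<and>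
      smooth_connection_on N x V \<and>
      angle_preserving_at (F \<kappa>) (k \<kappa>) \<phi> N x V"
    if b: "angle_branch (F \<kappa>) (chart_image \<kappa>) (\<theta> \<kappa>) W \<phi>" for W \<phi>
  proof -
    have W: "open W" "W \<subseteq> slit_bundle" using b by (auto simp: angle_branch_def)
    note sm = branch_smooth[OF ext b]
    show ?thesis
      unfolding Let_def
    proof (intro conjI ballI allI)
      show "smooth_on {y. (x, y) \<in> W} (\<phi> x)" using smooth_on_slice[OF W(1) sm(1), of x] by simp
      show "smooth_on {y. (x, y) \<in> W} (dx n \<phi> x)" for n by (rule smooth_on_dx[OF W(1) sm(1)])
      show "(\<phi> x has_derivative (\<lambda>v. (m_cov (F \<kappa>) x y \<bullet> v) / K_val (F \<kappa>) x y)) (at y)"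
        if "y \<in> {y. (x, y) \<in> W}" for y
        using sm(2) that by simp
      show "(\<lambda>z. \<phi> z y) differentiable (at x)" if "y \<in> {y. (x, y) \<in> W}" for y
        using smooth_on_slice_has_derivative(1)[OF sm(1), of x y] that by (auto simp: differentiable_def)
    qed (rule connection_of_determination[OF W sm x], assumption)+
  qed
  show "\<exists>\<Omega> N. (\<forall>n. smooth_on (- {0}) (\<lambda>y. \<Omega> y n)) \<and>
      smooth_connection_on N x (- {0}) \<and>
      (\<forall>W \<phi>. angle_branch (F \<kappa>) (chart_image \<kappa>) (\<theta> \<kappa>) W \<phi> \<longrightarrow>
        (\<forall>y n. (x, y) \<in> W \<longrightarrow> dx n \<phi> x y = \<Omega> y n \<and>
           (\<forall>i. N_coeff (F \<kappa>) (k \<kappa>) \<phi> x y i n = N x y i n)))"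
    if "\<forall>n. pd n (theta_max (F \<kappa>)) x = 0"
    using stationary_connection[OF ext x] that by blast
qed

end
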